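(* Let $K$ be a field and let $H$ be a finite hypergraph. Then: (i) $L_K(H)$ has polynomial growth if and only if there is no selfconnected quasi-cycle. (ii) If $L_K(H)$ has polynomial growth, then $\operatorname{GKdim} L_K(H)=d$, where $d$ is the maximal length of a chain of quasi-cycles.
   Context: Algebras are associative but not necessarily unital. A multiset over a set $Y$ is a function $M:Y\to\mathbb N_0$; its support is $M_{\mathrm{supp}}=\{y\in Y\mid M(y)>0\}$. $\mathrm{Mult}(Y)$ is the set of multisets over $Y$ with finite, nonempty support, and $|M|=\sum_{y\in M_{\mathrm{supp}}}M(y)$. A (directed) hypergraph is a quadruple $H=(H^0,H^1,s,r)$ where $H^0,H^1$ are sets and $s,r:H^1\to\mathrm{Mult}(H^0)$ are maps; it is finite if $H^0$ and $H^1$ are finite. All hypergraphs are assumed nonempty (not $H^0=H^1=\emptyset$). For each $h\in H^1$ fix listings with multiplicity $s(h)=\{s(h)_1,\dots,s(h)_{|s(h)|}\}$ and $r(h)=\{r(h)_1,\dots,r(h)_{|r(h)|}\}$. Let $X:=\{v,h_{ij},h_{ij}^*\mid v\in H^0,h\in H^1,1\le i\le|s(h)|,1\le j\le|r(h)|\}$. The Leavitt path algebra $L_K(H)$ is the (not necessarily unital) $K$-algebra presented by the generating set $X$ and the relations: (i) $uv=\delta_{uv}u$ ($u,v\in H^0$); (ii) $s(h)_ih_{ij}=h_{ij}=h_{ij}r(h)_j$ and $r(h)_jh_{ij}^*=h_{ij}^*=h_{ij}^*s(h)_i$ for all $h,i,j$; (iii) $\sum_{k=1}^{|r(h)|}h_{ik}h_{jk}^*=\delta_{ij}s(h)_i$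 ($h\in H^1$, $1\le i,j\le|s(h)|$); (iv) $\sum_{k=1}^{|s(h)|}h_{ki}^*h_{kj}=\delta_{ij}r(h)_i$ ($h\in H^1$, $1\le i,j\le|r(h)|$). Let $\hat E$ be the directed graph with vertex set $H^0$ and edges all $h_{ij}$ (with source $s(h)_i$ and range $r(h)_j$) and all $h_{ij}^*$ (with source $r(h)_j$ and range $s(h)_i$). A d-path is a word over $X$ which is either a single vertex (length $0$), or a nonempty word $x_1\dots x_n$ of edges of $\hat E$ such that the range of $x_i$ equals the source of $x_{i+1}$ for $1\le i\le n-1$ (length $n$). The length of $p$ is denoted $|p|$. The words $h_{i1}h_{j1}^*$ ($h\in H^1$, $1\le i,j\le|s(h)|$) and $h_{1i}^*h_{1j}$ ($h\in H^1$, $1\le i,j\le|r(h)|$) are called forbidden. A nod-path is a d-path none of whose (contiguous) subwords is forbidden. Products of paths below are juxtapositions of words (so, e.g., $vv$ for a vertex $v$ is not a d-path). For nod-paths $p,q$, write $p\overset{\mathrm{nod}}{\Longrightarrow}q$ if there is a nod-path $o$ such that $p$ is not a prefix of $o$ and $poq$ is a nod-path; write $p\Longrightarrow q$ if $pq$ is a nod-path or $p\overset{\mathrm{nod}}{\Longrightarrow}q$. A nod$^2$-path is a nod-path $p$ such that $p^2$ is a nod-path. A quasi-cycle is a nod$^2$-path $p$ such that none of the subwords of $p^2$ of length $<|p|$ is a nod$^2$-path. A quasi-cycle $p$ is selfconnected if $p\overset{\mathrm{nod}}{\Longrightarrow}p$. For quasi-cycles $p=x_1\dots x_n$ and $q$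 write $p\approx q$ if $q$ is a shift of $p$, i.e. $q=x_{m+1}\dots x_nx_1\dots x_m$ for some $1\le m\le n$. A chain of (quasi-cycles of) length $k$ is a sequence $p_1,\dots,p_k$ of quasi-cycles with $p_i\not\approx p_j$ for all $i\ne j$ and $p_1\Longrightarrow p_2\Longrightarrow\dots\Longrightarrow p_k$; the maximal length $d$ is $0$ if there are no quasi-cycles. For a nonzero finitely generated $K$-algebra $A$ and a finite-dimensional generating subspace $V$, let $V^n$ be the span of all products $v_1\cdots v_k$ with $1\le k\le n$, $v_i\in V$, and $d_V(n)=\dim V^n$. For $f,g:\mathbb N\to\mathbb R_+$ write $f\preccurlyeq g$ if there is $c\in\mathbb N$ with $f(n)\le c\,g(cn)$ for all $n$. $A$ has polynomial growth if $d_V\preccurlyeq n^m$ for some $m\in\mathbb N$. $\operatorname{GKdim}A=\limsup_{n\to\infty}\log_n d_V(n)$. Both notions are independent of $V$. *)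

theory Defs
  imports
    "Jordan_Normal_Form.VS_Connect"
    "HOL-Library.Poly_Mapping"
    "HOL-Library.Sublist"
    "HOL-Library.Extended_Real"
begin

section \<open>Growth of not necessarily unital algebras\<close>

text \<open>
  A \<open>K\<close>-algebra over a field type \<open>'k\<close> is carried by the record \<^typ>\<open>('k, 'a) module\<close>; the field
  \<open>one\<close> is never used, since algebras need not be unital.
\<close>

locale nonunital_algebra = vectorspace "class_ring :: 'k ring" A
  for A :: "('k::field, 'a) module" (structure) +
  assumes mult_closed: "x \<in> carrier A \<Longrightarrow> y \<in> carrier A \<Longrightarrow> x \<otimes> y \<in> carrier A"
    and mult_assoc: "x \<in> carrier A \<Longrightarrow> y \<in> carrier A \<Longrightarrow> z \<in> carrier A
          \<Longrightarrow> (x \<otimes> y) \<otimes> z = x \<otimes> (y \<otimes> z)"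
    and add_mult: "x \<in> carrier A \<Longrightarrow> y \<in> carrier A \<Longrightarrow> z \<in> carrier A
          \<Longrightarrow> (x \<oplus> y) \<otimes> z = x \<otimes> z \<oplus> y \<otimes> z"
    and mult_add: "x \<in> carrier A \<Longrightarrow> y \<in> carrier A \<Longrightarrow> z \<in> carrier A
          \<Longrightarrow> x \<otimes> (y \<oplus> z) = x \<otimes> y \<oplus> x \<otimes> z"
    and smult_mult: "x \<in> carrier A \<Longrightarrow> y \<in> carrier A \<Longrightarrow> (c \<odot> x) \<otimes> y = c \<odot> (x \<otimes> y)"
    and mult_smult: "x \<in> carrier A \<Longrightarrow> y \<in> carrier A \<Longrightarrow> x \<otimes> (c \<odot> y) = c \<odot> (x \<otimes> y)"

definition subalgebra :: "('k::field, 'a) module \<Rightarrow> 'a set \<Rightarrow> bool" where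
  "subalgebra A B \<longleftrightarrow> VectorSpace.subspace class_ring B A \<and> (\<forall>x\<in>B. \<forall>y\<in>B. x \<otimes>\<^bsub>A\<^esub> y \<in> B)"

definition generating_subspace :: "('k::field, 'a) module \<Rightarrow> 'a set \<Rightarrow> bool" where
  "generating_subspace A V \<longleftrightarrow>
     VectorSpace.subspace class_ring V A
   \<and> vectorspace.fin_dim class_ring (A\<lparr>carrier := V\<rparr>)
   \<and> (\<forall>B. subalgebra A B \<and> V \<subseteq> B \<longrightarrow> B = carrier A)"

definition power_space :: "('k::field, 'a) module \<Rightarrow> 'a set \<Rightarrow> nat \<Rightarrow> 'a set" where
  "power_space A V n =
     LinearCombinations.module.span class_ring A
       {foldl (mult A) v vs | v vs. v \<in> V \<and> set vs \<subseteq> V \<and> Suc (length vs) \<le> n}"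

definition growth :: "('k::field, 'a) module \<Rightarrow> 'a set \<Rightarrow> nat \<Rightarrow> nat" where
  "growth A V n = vectorspace.dim class_ring (A\<lparr>carrier := power_space A V n\<rparr>)"

text \<open>Here the functions are considered on the positive integers only.\<close>

definition growth_le :: "(nat \<Rightarrow> real) \<Rightarrow> (nat \<Rightarrow> real) \<Rightarrow> bool" (infix \<open>\<preceq>\<^sub>g\<close> 50) where
  "f \<preceq>\<^sub>g g \<longleftrightarrow> (\<exists>c::nat. c \<ge> 1 \<and> (\<forall>n\<ge>1. f n \<le> real c * g (c * n)))"

text \<open>
  Polynomial growth and the Gelfand-Kirillov dimension do not depend on the finite-dimensional
  generating subspace, so in both definitions any such subspace may be used.
\<close>

definition polynomial_growth :: "('k::field, 'a) module \<Rightarrow> bool" where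
  "polynomial_growth A \<longleftrightarrow>
     (\<exists>V. generating_subspace A V \<and> (\<exists>m::nat. (\<lambda>n. real (growth A V n)) \<preceq>\<^sub>g (\<lambda>n. real n ^ m)))"

definition GKdim :: "('k::field, 'a) module \<Rightarrow> ereal" where
  "GKdim A =
     (let V = (SOME V. generating_subspace A V)
      in limsup (\<lambda>n. ereal (log (real n) (real (growth A V n)))))"


section \<open>Algebras presented by generators and relations\<close>

text \<open>
  With concatenation as the monoid operation on lists, \<^typ>\<open>'x list \<Rightarrow>\<^sub>0 'k\<close> is the free unital
  algebra on \<open>'x\<close>. The free nonunital algebra on \<open>X\<close> consists of the linear combinations of nonempty
  words over \<open>X\<close>.
\<close>

instantiation list :: (type) monoid_add
begin

definition zero_list :: "'a list" where "zero_list = []"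

definition plus_list :: "'a list \<Rightarrow> 'a list \<Rightarrow> 'a list" where "plus_list = (@)"

instance by standard (simp_all add: zero_list_def plus_list_def)

end

abbreviation monomial :: "'x list \<Rightarrow> ('x list \<Rightarrow>\<^sub>0 'k::field)" where
  "monomial w \<equiv> Poly_Mapping.single w 1"

abbreviation scale :: "'k::field \<Rightarrow> ('x list \<Rightarrow>\<^sub>0 'k) \<Rightarrow> ('x list \<Rightarrow>\<^sub>0 'k)" where
  "scale c p \<equiv> Poly_Mapping.map ((*) c) p"

definition free_algebra :: "'x set \<Rightarrow> ('x list \<Rightarrow>\<^sub>0 'k::field) set" where
  "free_algebra X = {p. Poly_Mapping.keys p \<subseteq> {w. w \<noteq> [] \<and> set w \<subseteq> X}}"

inductive_set algebra_ideal :: "'x set \<Rightarrow> ('x list \<Rightarrow>\<^sub>0 'k::field) set \<Rightarrow> ('x list \<Rightarrow>\<^sub>0 'k) set"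
  for X R where
  zero: "0 \<in> algebra_ideal X R"
| relator: "p \<in> R \<Longrightarrow> p \<in> algebra_ideal X R"
| add: "p \<in> algebra_ideal X R \<Longrightarrow> q \<in> algebra_ideal X R \<Longrightarrow> p + q \<in> algebra_ideal X R"
| scale: "p \<in> algebra_ideal X R \<Longrightarrow> scale c p \<in> algebra_ideal X R"
| left: "a \<in> free_algebra X \<Longrightarrow> p \<in> algebra_ideal X R \<Longrightarrow> a * p \<in> algebra_ideal X R"
| right: "p \<in> algebra_ideal X R \<Longrightarrow> a \<in> free_algebra X \<Longrightarrow> p * a \<in> algebra_ideal X R"

definition coset :: "'a::ab_group_add set \<Rightarrow> 'a \<Rightarrow> 'a set" where
  "coset I p = {p + q | q. q \<in> I}"

text \<open>
  Operations on cosets are given by unions over all representatives; each such union is a single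
  coset (see \<open>presented_algebra_ops\<close>).
\<close>

definition presented_algebra ::
    "'x set \<Rightarrow> ('x list \<Rightarrow>\<^sub>0 'k::field) set \<Rightarrow> ('k, ('x list \<Rightarrow>\<^sub>0 'k) set) module" where
  "presented_algebra X R =
    (let I = algebra_ideal X R in
     \<lparr>carrier = coset I ` free_algebra X,
      mult = (\<lambda>a b. \<Union>p\<in>a. \<Union>q\<in>b. coset I (p * q)),
      one = undefined,
      zero = I,
      add = (\<lambda>a b. \<Union>p\<in>a. \<Union>q\<in>b. coset I (p + q)),
      smult = (\<lambda>c a. \<Union>p\<in>a. coset I (scale c p))\<rparr>)"

lemma lookup_scale: "Poly_Mapping.lookup (scale c p) k = c * Poly_Mapping.lookup p k"
  by transfer (auto simp: when_def)

lemma scale_eq_mult: "scale c p = Poly_Mapping.single 0 c * p"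
proof (rule poly_mapping_eqI)
  fix k
  show "Poly_Mapping.lookup (scale c p) k = Poly_Mapping.lookup (Poly_Mapping.single 0 c * p) k"
    by (simp add: lookup_scale lookup_mult lookup_single when_mult Sum_any_when_equal' flip: Sum_any_when_independent)
qed

lemma mult_single_zero_commute: "p * Poly_Mapping.single (0::'x list) (c::'k::field) = Poly_Mapping.single 0 c * p"
proof (rule poly_mapping_eqI)
  fix k
  show "Poly_Mapping.lookup (p * Poly_Mapping.single 0 c) k = Poly_Mapping.lookup (Poly_Mapping.single 0 c * p) k"
  proof -
    have "Poly_Mapping.lookup (p * Poly_Mapping.single 0 c) k = (\<Sum>l. Poly_Mapping.lookup p l * (\<Sum>q. (c when 0 = q) when k = l + q))"
      by (simp add: lookup_mult lookup_single)
    also have "\<dots> = (\<Sum>l. Poly_Mapping.lookup p l * (c when k = l))"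
    proof -
      have "(\<Sum>q. (c when 0 = q) when k = l + q) = (c when k = l)" for l :: "'x list"
      proof -
        have "(\<lambda>q. (c when 0 = q) when k = l + q) = (\<lambda>q. (c when k = l) when 0 = q)"
          by (auto simp: when_def)
        then show ?thesis by (simp only: Sum_any_when_equal')
      qed
      then show ?thesis by simp
    qed
    also have "\<dots> = Poly_Mapping.lookup p k * c" by (simp add: mult_when)
    also have "\<dots> = Poly_Mapping.lookup (scale c p) k" by (simp add: lookup_scale)
    finally show ?thesis by (simp add: scale_eq_mult)
  qed
qed

lemma scale_laws:
  fixes p q :: "'x list \<Rightarrow>\<^sub>0 'k::field"
  shows "scale c (p + q) = scale c p + scale c q" "scale (c + d) p = scale c p + scale d p"
    "scale c (scale d p) = scale (c * d) p" "scale 1 p = p" "scale c (p - q) = scale c p - scale c q"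
    "scale c p * q = scale c (p * q)" "p * scale c q = scale c (p * q)" "scale (-1) p = - p"
  subgoal by (simp add: scale_eq_mult algebra_simps)
  subgoal by (simp add: scale_eq_mult algebra_simps single_add)
  subgoal by (simp add: scale_eq_mult mult_single flip: mult.assoc)
  subgoal by (simp add: scale_eq_mult)
  subgoal by (simp add: scale_eq_mult algebra_simps)
  subgoal by (simp add: scale_eq_mult mult.assoc)
  subgoal by (metis scale_eq_mult mult_single_zero_commute mult.assoc)
  subgoal by (rule poly_mapping_eqI) (simp add: lookup_scale)
  done

lemma free_algebra_closed:
  "0 \<in> free_algebra X"
  "p \<in> free_algebra X \<Longrightarrow> q \<in> free_algebra X \<Longrightarrow> p + q \<in> free_algebra X"
  "p \<in> free_algebra X \<Longrightarrow> q \<in> free_algebra X \<Longrightarrow> p - q \<in> free_algebra X"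
  "p \<in> free_algebra X \<Longrightarrow> q \<in> free_algebra X \<Longrightarrow> p * q \<in> free_algebra X"
  "p \<in> free_algebra X \<Longrightarrow> scale c p \<in> free_algebra X"
  "w \<noteq> [] \<Longrightarrow> set w \<subseteq> X \<Longrightarrow> monomial w \<in> free_algebra X"
proof -
  show "p \<in> free_algebra X \<Longrightarrow> q \<in> free_algebra X \<Longrightarrow> p * q \<in> free_algebra X"
    using keys_mult[of p q] unfolding free_algebra_def by (fastforce simp: plus_list_def)
  show "p \<in> free_algebra X \<Longrightarrow> q \<in> free_algebra X \<Longrightarrow> p + q \<in> free_algebra X"
    using Poly_Mapping.keys_add[of p q] unfolding free_algebra_def by blast
  show "p \<in> free_algebra X \<Longrightarrow> q \<in> free_algebra X \<Longrightarrow> p - q \<in> free_algebra X"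
    using keys_diff[of p q] unfolding free_algebra_def by blast
  show "p \<in> free_algebra X \<Longrightarrow> scale c p \<in> free_algebra X"
    unfolding free_algebra_def by (auto simp: in_keys_iff lookup_scale)
qed (auto simp: free_algebra_def)

lemma free_algebra_sum: "(\<And>k. k \<in> S \<Longrightarrow> f k \<in> free_algebra X) \<Longrightarrow> sum f S \<in> free_algebra X"
  by (induction S rule: infinite_finite_induct) (auto simp: free_algebra_closed)

lemma algebra_ideal_sub:
  assumes "R \<subseteq> free_algebra X" "p \<in> algebra_ideal X R" shows "p \<in> free_algebra X"
  using assms(2) by (induction rule: algebra_ideal.induct) (use assms(1) in \<open>auto intro: free_algebra_closed\<close>)

lemma algebra_ideal_diff:
  assumes "p \<in> algebra_ideal X R" "q \<in> algebra_ideal X R" shows "p - q \<in> algebra_ideal X R"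
  using algebra_ideal.add[OF assms(1) algebra_ideal.scale[OF assms(2), of "-1"]]
  by (simp add: scale_laws)

lemma mem_coset_iff: "q \<in> coset I p \<longleftrightarrow> q - p \<in> I"
  unfolding coset_def by (auto intro: exI[of _ "q - p"])

lemma coset_eq_iff: "coset (algebra_ideal X R) p = coset (algebra_ideal X R) q \<longleftrightarrow> p - q \<in> algebra_ideal X R"
proof
  assume "coset (algebra_ideal X R) p = coset (algebra_ideal X R) q"
  then have "p \<in> coset (algebra_ideal X R) q" using mem_coset_iff[of p _ p] algebra_ideal.zero by auto
  then show "p - q \<in> algebra_ideal X R" by (simp add: mem_coset_iff)
next
  assume a: "p - q \<in> algebra_ideal X R"
  have "x - p \<in> algebra_ideal X R \<longleftrightarrow> x - q \<in> algebra_ideal X R" for x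
    using algebra_ideal.add[OF _ a, of "x - p"] algebra_ideal_diff[OF _ a, of "x - q"] by auto
  then show "coset (algebra_ideal X R) p = coset (algebra_ideal X R) q"
    by (auto simp: mem_coset_iff)
qed

context
  fixes X :: "'x set" and R :: "('x list \<Rightarrow>\<^sub>0 'k::field) set"
  assumes R: "R \<subseteq> free_algebra X"
begin

private abbreviation "I \<equiv> algebra_ideal X R"
private abbreviation "A \<equiv> presented_algebra X R"

private lemma UN_const: "x \<in> S \<Longrightarrow> (\<And>y. y \<in> S \<Longrightarrow> f y = T) \<Longrightarrow> (\<Union>y\<in>S. f y) = T" by blast

private lemma self_coset: "p \<in> coset I p" by (simp add: mem_coset_iff algebra_ideal.zero)

lemma presented_algebra_ops:
  "carrier A = coset I ` free_algebra X"
  "\<zero>\<^bsub>A\<^esub> = coset I 0"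
  "coset I p \<oplus>\<^bsub>A\<^esub> coset I q = coset I (p + q)"
  "c \<odot>\<^bsub>A\<^esub> coset I p = coset I (scale c p)"
  "p \<in> free_algebra X \<Longrightarrow> q \<in> free_algebra X \<Longrightarrow> coset I p \<otimes>\<^bsub>A\<^esub> coset I q = coset I (p * q)"
proof -
  show "carrier A = coset I ` free_algebra X" by (simp add: presented_algebra_def Let_def)
  show "\<zero>\<^bsub>A\<^esub> = coset I 0" by (simp add: presented_algebra_def Let_def coset_def)
  show "coset I p \<oplus>\<^bsub>A\<^esub> coset I q = coset I (p + q)"
  proof -
    have "coset I (x + y) = coset I (p + q)" if "x \<in> coset I p" "y \<in> coset I q" for x y
      using algebra_ideal.add[OF that[unfolded mem_coset_iff]] by (simp add: coset_eq_iff algebra_simps)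
    then have "(\<Union>x\<in>coset I p. \<Union>y\<in>coset I q. coset I (x + y)) = coset I (p + q)"
      by (intro UN_const[OF self_coset]) auto
    then show ?thesis 
      by (simp only: presented_algebra_def Let_def module.simps ring.simps monoid.simps partial_object.simps)
  qed
  show "c \<odot>\<^bsub>A\<^esub> coset I p = coset I (scale c p)"
  proof -
    have "coset I (scale c x) = coset I (scale c p)" if "x \<in> coset I p" for x
      using algebra_ideal.scale[OF that[unfolded mem_coset_iff], of c] by (simp add: coset_eq_iff scale_laws)
    then have "(\<Union>x\<in>coset I p. coset I (scale c x)) = coset I (scale c p)"
      by (intro UN_const[OF self_coset]) auto
    then show ?thesis 
      by (simp only: presented_algebra_def Let_def module.simps ring.simps monoid.simps partial_object.simps)
  qed
  assume p: "p \<in> free_algebra X" and q: "q \<in> free_algebra X"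
  have "coset I (x * y) = coset I (p * q)" if x: "x \<in> coset I p" and y: "y \<in> coset I q" for x y
  proof -
    have y': "y \<in> free_algebra X"
      using y[unfolded mem_coset_iff] q algebra_ideal_sub[OF R] free_algebra_closed(2)[of "y - q" X q] by auto
    have "(x - p) * y + p * (y - q) \<in> I"
      using x y p y' unfolding mem_coset_iff
      by (blast intro: algebra_ideal.add algebra_ideal.left algebra_ideal.right)
    then show ?thesis by (simp add: coset_eq_iff algebra_simps)
  qed
  then have "(\<Union>x\<in>coset I p. \<Union>y\<in>coset I q. coset I (x * y)) = coset I (p * q)"
      by (intro UN_const[OF self_coset]) auto
    then show "coset I p \<otimes>\<^bsub>A\<^esub> coset I q = coset I (p * q)" 
      by (simp only: presented_algebra_def Let_def module.simps ring.simps monoid.simps partial_object.simps)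
qed

lemma presented_algebra_nonunital: "nonunital_algebra A"
proof -
  have ab: "abelian_group A"
  proof (rule abelian_groupI)
    fix x assume "x \<in> carrier A"
    then obtain p where p: "x = coset I p" "p \<in> free_algebra X" by (auto simp: presented_algebra_ops)
    show "\<exists>y\<in>carrier A. y \<oplus>\<^bsub>A\<^esub> x = \<zero>\<^bsub>A\<^esub>"
      using p free_algebra_closed(5)[OF p(2), of "-1"]
      by (intro bexI[of _ "coset I (- p)"]) (auto simp: presented_algebra_ops scale_laws)
  qed (auto simp: presented_algebra_ops free_algebra_closed algebra_simps)
  have cr: "cring (class_ring :: 'k ring)" and fi: "field (class_ring :: 'k ring)"
    by unfold_locales
  have mo: "Module.module class_ring A"
    by (intro Module.module.intro[OF cr ab] Module.module_axioms.intro)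
      (auto simp: presented_algebra_ops free_algebra_closed scale_laws class_ring_simps)
  show ?thesis
    by (intro nonunital_algebra.intro vectorspace.intro mo fi nonunital_algebra_axioms.intro)
      (auto simp: presented_algebra_ops free_algebra_closed scale_laws algebra_simps)
qed

lemma generating_subspace_exists:
  assumes "finite X"
  shows "\<exists>V. generating_subspace A V"
proof -
  interpret A: nonunital_algebra A by (rule presented_algebra_nonunital)
  let ?S = "(\<lambda>x. coset I (monomial [x])) ` X"
  let ?V = "LinearCombinations.module.span class_ring A ?S"
  have S: "?S \<subseteq> carrier A" by (auto simp: presented_algebra_ops free_algebra_closed)
  have sub: "VectorSpace.subspace class_ring ?V A"
    using A.span_is_subspace[OF S] .
  have SV: "?S \<subseteq> ?V" by (rule A.in_own_span[OF S])
  have fd: "vectorspace.fin_dim class_ring (A\<lparr>carrier := ?V\<rparr>)"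
  proof -
    interpret V: vectorspace "class_ring :: 'k ring" "A\<lparr>carrier := ?V\<rparr>"
      using A.subspace_is_vs[OF sub] .
    have "LinearCombinations.module.span class_ring (A\<lparr>carrier := ?V\<rparr>) ?S = ?V"
      using A.span_li_not_depend(1)[OF SV] A.span_is_submodule[OF S] by simp
    then show ?thesis unfolding V.fin_dim_def using SV assms by (intro exI[of _ ?S]) auto
  qed
  have "B = carrier A" if B: "subalgebra A B" "?V \<subseteq> B" for B
  proof
    have sB: "submodule class_ring B A" and mB: "\<And>x y. x \<in> B \<Longrightarrow> y \<in> B \<Longrightarrow> x \<otimes>\<^bsub>A\<^esub> y \<in> B"
      using B(1) by (auto simp: subalgebra_def subspace_def)
    interpret B: submodule "class_ring :: 'k ring" B A by (rule sB)
    show "B \<subseteq> carrier A" by (rule B.subset)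
    have mon: "coset I (monomial w) \<in> B" if "w \<noteq> []" "set w \<subseteq> X" for w
      using that
    proof (induction w rule: list_nonempty_induct)
      case (single x) then show ?case using SV B(2) by auto
    next
      case (cons x w)
      have "coset I (monomial [x]) \<otimes>\<^bsub>A\<^esub> coset I (monomial w) \<in> B"
        using cons SV B(2) by (intro mB) auto
      then show ?case using cons by (simp add: presented_algebra_ops free_algebra_closed mult_single plus_list_def)
    qed
    have single: "coset I (Poly_Mapping.single k v) \<in> B" if "k \<noteq> []" "set k \<subseteq> X" for k v
    proof -
      have "v \<odot>\<^bsub>A\<^esub> coset I (monomial k) \<in> B" using mon[OF that] by simp
      then show ?thesis by (simp add: presented_algebra_ops scale_eq_mult mult_single)
    qed
    have sum: "coset I (sum f S) \<in> B" if "\<And>k. k \<in> S \<Longrightarrow> coset I (f k) \<in> B"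
      for f :: "'x list \<Rightarrow> _" and S
      using that
    proof (induction S rule: infinite_finite_induct)
      case (insert k S)
      then have "coset I (f k) \<oplus>\<^bsub>A\<^esub> coset I (sum f S) \<in> B" by simp
      with insert show ?case by (simp add: presented_algebra_ops)
    qed (use B.zero_closed in \<open>simp_all add: presented_algebra_ops\<close>)
    have "coset I p \<in> B" if p: "p \<in> free_algebra X" for p
    proof -
      have "p = (\<Sum>k\<in>Poly_Mapping.keys p. Poly_Mapping.single k (Poly_Mapping.lookup p k))"
        by (rule poly_mapping_eqI)
          (simp add: lookup_sum lookup_single when_def in_keys_iff)
      moreover have "coset I (\<Sum>k\<in>Poly_Mapping.keys p. Poly_Mapping.single k (Poly_Mapping.lookup p k)) \<in> B"
        by (rule sum, rule single) (use p in \<open>auto simp: free_algebra_def\<close>)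
      ultimately show ?thesis by simp
    qed
    then show "carrier A \<subseteq> B" by (auto simp: presented_algebra_ops)
  qed
  then have "generating_subspace A ?V" using sub fd by (auto simp: generating_subspace_def)
  then show ?thesis by blast
qed

end


section \<open>Hypergraphs and their Leavitt path algebras\<close>

record ('v, 'e) hypergraph =
  verts :: "'v set"
  hedges :: "'e set"
  src :: "'e \<Rightarrow> 'v multiset"
  rng :: "'e \<Rightarrow> 'v multiset"

locale hypergraph =
  fixes H :: "('v, 'e) hypergraph"
  assumes src_ne: "h \<in> hedges H \<Longrightarrow> src H h \<noteq> {#}"
    and src_sub: "h \<in> hedges H \<Longrightarrow> set_mset (src H h) \<subseteq> verts H"
    and rng_ne: "h \<in> hedges H \<Longrightarrow> rng H h \<noteq> {#}"
    and rng_sub: "h \<in> hedges H \<Longrightarrow> set_mset (rng H h) \<subseteq> verts H"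
    and nonempty: "\<not> (verts H = {} \<and> hedges H = {})"

locale finite_hypergraph = hypergraph +
  assumes finite_verts: "finite (verts H)"
    and finite_hedges: "finite (hedges H)"

text \<open>
  The listings with multiplicity of \<open>s(h)\<close> and \<open>r(h)\<close> are lists \<open>\<sigma> h\<close> and \<open>\<rho> h\<close>, so that indices
  start from \<open>0\<close>.
\<close>

definition listings :: "('v, 'e) hypergraph \<Rightarrow> ('e \<Rightarrow> 'v list) \<Rightarrow> ('e \<Rightarrow> 'v list) \<Rightarrow> bool" where
  "listings H \<sigma> \<rho> \<longleftrightarrow> (\<forall>h\<in>hedges H. mset (\<sigma> h) = src H h \<and> mset (\<rho> h) = rng H h)"

datatype ('v, 'e) gen = Vertex 'v | Edge 'e nat nat | Ghost 'e nat nat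

definition edges ::
    "('v, 'e) hypergraph \<Rightarrow> ('e \<Rightarrow> 'v list) \<Rightarrow> ('e \<Rightarrow> 'v list) \<Rightarrow> ('v, 'e) gen set" where
  "edges H \<sigma> \<rho> =
     {Edge h i j | h i j. h \<in> hedges H \<and> i < length (\<sigma> h) \<and> j < length (\<rho> h)}
   \<union> {Ghost h i j | h i j. h \<in> hedges H \<and> i < length (\<sigma> h) \<and> j < length (\<rho> h)}"

definition generators ::
    "('v, 'e) hypergraph \<Rightarrow> ('e \<Rightarrow> 'v list) \<Rightarrow> ('e \<Rightarrow> 'v list) \<Rightarrow> ('v, 'e) gen set" where
  "generators H \<sigma> \<rho> = Vertex ` verts H \<union> edges H \<sigma> \<rho>"

text \<open>Each relation \<open>l = r\<close> is represented by the relator \<open>l - r\<close>.\<close>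

inductive_set leavitt_relators ::
    "('v, 'e) hypergraph \<Rightarrow> ('e \<Rightarrow> 'v list) \<Rightarrow> ('e \<Rightarrow> 'v list)
      \<Rightarrow> (('v, 'e) gen list \<Rightarrow>\<^sub>0 'k::field) set"
  for H \<sigma> \<rho> where
  vertices: "u \<in> verts H \<Longrightarrow> v \<in> verts H \<Longrightarrow>
    monomial [Vertex u, Vertex v] - (if u = v then monomial [Vertex u] else 0)
      \<in> leavitt_relators H \<sigma> \<rho>"
| source_edge: "h \<in> hedges H \<Longrightarrow> i < length (\<sigma> h) \<Longrightarrow> j < length (\<rho> h) \<Longrightarrow>
    monomial [Vertex (\<sigma> h ! i), Edge h i j] - monomial [Edge h i j] \<in> leavitt_relators H \<sigma> \<rho>"
| edge_range: "h \<in> hedges H \<Longrightarrow> i < length (\<sigma> h) \<Longrightarrow> j < length (\<rho> h) \<Longrightarrow>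
    monomial [Edge h i j, Vertex (\<rho> h ! j)] - monomial [Edge h i j] \<in> leavitt_relators H \<sigma> \<rho>"
| range_ghost: "h \<in> hedges H \<Longrightarrow> i < length (\<sigma> h) \<Longrightarrow> j < length (\<rho> h) \<Longrightarrow>
    monomial [Vertex (\<rho> h ! j), Ghost h i j] - monomial [Ghost h i j] \<in> leavitt_relators H \<sigma> \<rho>"
| ghost_source: "h \<in> hedges H \<Longrightarrow> i < length (\<sigma> h) \<Longrightarrow> j < length (\<rho> h) \<Longrightarrow>
    monomial [Ghost h i j, Vertex (\<sigma> h ! i)] - monomial [Ghost h i j] \<in> leavitt_relators H \<sigma> \<rho>"
| edge_ghost: "h \<in> hedges H \<Longrightarrow> i < length (\<sigma> h) \<Longrightarrow> j < length (\<sigma> h) \<Longrightarrow>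
    (\<Sum>k<length (\<rho> h). monomial [Edge h i k, Ghost h j k])
      - (if i = j then monomial [Vertex (\<sigma> h ! i)] else 0) \<in> leavitt_relators H \<sigma> \<rho>"
| ghost_edge: "h \<in> hedges H \<Longrightarrow> i < length (\<rho> h) \<Longrightarrow> j < length (\<rho> h) \<Longrightarrow>
    (\<Sum>k<length (\<sigma> h). monomial [Ghost h k i, Edge h k j])
      - (if i = j then monomial [Vertex (\<rho> h ! i)] else 0) \<in> leavitt_relators H \<sigma> \<rho>"

definition leavitt_path_algebra ::
    "'k::field itself \<Rightarrow> ('v, 'e) hypergraph \<Rightarrow> ('e \<Rightarrow> 'v list) \<Rightarrow> ('e \<Rightarrow> 'v list)
      \<Rightarrow> ('k, (('v, 'e) gen list \<Rightarrow>\<^sub>0 'k) set) module" where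
  "leavitt_path_algebra _ H \<sigma> \<rho> =
     presented_algebra (generators H \<sigma> \<rho>) (leavitt_relators H \<sigma> \<rho>)"


lemma leavitt_relators_free:
  assumes "hypergraph H" "listings H \<sigma> \<rho>"
  shows "leavitt_relators H \<sigma> \<rho> \<subseteq> free_algebra (generators H \<sigma> \<rho>)"
proof
  interpret hypergraph H by fact
  have st: "set (\<sigma> h) \<subseteq> verts H \<and> set (\<rho> h) \<subseteq> verts H" if "h \<in> hedges H" for h
    using assms(2) src_sub[OF that] rng_sub[OF that] that unfolding listings_def by (metis set_mset_mset)
  have "i < length (\<sigma> h) \<Longrightarrow> h \<in> hedges H \<Longrightarrow> \<sigma> h ! i \<in> verts H" 
    "i < length (\<rho> h) \<Longrightarrow> h \<in> hedges H \<Longrightarrow> \<rho> h ! i \<in> verts H" for h i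
    using st[of h] nth_mem by blast+
  note v = this
  fix p :: "('a,'b) gen list \<Rightarrow>\<^sub>0 'c" assume "p \<in> leavitt_relators H \<sigma> \<rho>"
  then show "p \<in> free_algebra (generators H \<sigma> \<rho>)"
  proof cases
    case (edge_ghost h i j)
    have "k < length (\<rho> h) \<Longrightarrow> monomial [Edge h i k, Ghost h j k] \<in> free_algebra (generators H \<sigma> \<rho>)" for k
      using edge_ghost by (intro free_algebra_closed(6)) (auto simp: generators_def edges_def)
    moreover have "monomial [Vertex (\<sigma> h ! i)] \<in> free_algebra (generators H \<sigma> \<rho>)"
      using edge_ghost v(1)[of i h] by (intro free_algebra_closed(6)) (auto simp: generators_def)
    ultimately show ?thesis unfolding edge_ghost(1)
      by (cases "i = j"; intro free_algebra_closed(3) free_algebra_sum) (auto simp: free_algebra_closed(1))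
  next
    case (ghost_edge h i j)
    have "k < length (\<sigma> h) \<Longrightarrow> monomial [Ghost h k i, Edge h k j] \<in> free_algebra (generators H \<sigma> \<rho>)" for k
      using ghost_edge by (intro free_algebra_closed(6)) (auto simp: generators_def edges_def)
    moreover have "monomial [Vertex (\<rho> h ! i)] \<in> free_algebra (generators H \<sigma> \<rho>)"
      using ghost_edge v(2)[of i h] by (intro free_algebra_closed(6)) (auto simp: generators_def)
    ultimately show ?thesis unfolding ghost_edge(1)
      by (cases "i = j"; intro free_algebra_closed(3) free_algebra_sum) (auto simp: free_algebra_closed(1))
  next
    case (vertices u w)
    then show ?thesis unfolding vertices(1)
      by (cases "u = w"; intro free_algebra_closed(3))
        (simp_all add: free_algebra_closed(1) free_algebra_closed(6) generators_def)
  qed (simp only:; intro free_algebra_closed(3) free_algebra_closed(6);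
       simp add: generators_def edges_def v)+
qed

lemma finite_generators:
  assumes "finite_hypergraph H"
  shows "finite (generators H \<sigma> \<rho>)"
proof -
  interpret finite_hypergraph H by fact
  have "edges H \<sigma> \<rho> \<subseteq>
      (\<Union>h\<in>hedges H. \<Union>i<length (\<sigma> h). \<Union>j<length (\<rho> h). {Edge h i j, Ghost h i j})"
    by (auto simp: edges_def)
  then have "finite (edges H \<sigma> \<rho>)"
    by (rule finite_subset) (simp add: finite_hedges)
  then show ?thesis by (simp add: generators_def finite_verts)
qed

lemma leavitt_path_algebra_nonunital:
  assumes "hypergraph H" "listings H \<sigma> \<rho>"
  shows "nonunital_algebra (leavitt_path_algebra TYPE('k::field) H \<sigma> \<rho>)"
  unfolding leavitt_path_algebra_def
  by (rule presented_algebra_nonunital[OF leavitt_relators_free[OF assms]])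

lemma leavitt_path_algebra_generating_subspace:
  assumes "finite_hypergraph H" "listings H \<sigma> \<rho>"
  shows "\<exists>V. generating_subspace (leavitt_path_algebra TYPE('k::field) H \<sigma> \<rho>) V"
  unfolding leavitt_path_algebra_def
  by (rule generating_subspace_exists[OF leavitt_relators_free finite_generators])
    (use assms in \<open>auto simp: finite_hypergraph_def\<close>)


section \<open>Paths and quasi-cycles\<close>

text \<open>Source and range in the directed graph; the equations for vertices are irrelevant.\<close>

fun gen_src :: "('e \<Rightarrow> 'v list) \<Rightarrow> ('e \<Rightarrow> 'v list) \<Rightarrow> ('v, 'e) gen \<Rightarrow> 'v" where
  "gen_src \<sigma> \<rho> (Edge h i j) = \<sigma> h ! i"
| "gen_src \<sigma> \<rho> (Ghost h i j) = \<rho> h ! j"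
| "gen_src \<sigma> \<rho> (Vertex v) = v"

fun gen_rng :: "('e \<Rightarrow> 'v list) \<Rightarrow> ('e \<Rightarrow> 'v list) \<Rightarrow> ('v, 'e) gen \<Rightarrow> 'v" where
  "gen_rng \<sigma> \<rho> (Edge h i j) = \<rho> h ! j"
| "gen_rng \<sigma> \<rho> (Ghost h i j) = \<sigma> h ! i"
| "gen_rng \<sigma> \<rho> (Vertex v) = v"

definition dpath ::
    "('v, 'e) hypergraph \<Rightarrow> ('e \<Rightarrow> 'v list) \<Rightarrow> ('e \<Rightarrow> 'v list) \<Rightarrow> ('v, 'e) gen list \<Rightarrow> bool" where
  "dpath H \<sigma> \<rho> p \<longleftrightarrow>
     (\<exists>v\<in>verts H. p = [Vertex v])
   \<or> (p \<noteq> [] \<and> set p \<subseteq> edges H \<sigma> \<rho>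
      \<and> (\<forall>i. Suc i < length p \<longrightarrow> gen_rng \<sigma> \<rho> (p ! i) = gen_src \<sigma> \<rho> (p ! Suc i)))"

fun path_length :: "('v, 'e) gen list \<Rightarrow> nat" where
  "path_length [Vertex v] = 0"
| "path_length p = length p"

inductive_set forbidden ::
    "('v, 'e) hypergraph \<Rightarrow> ('e \<Rightarrow> 'v list) \<Rightarrow> ('e \<Rightarrow> 'v list) \<Rightarrow> ('v, 'e) gen list set"
  for H \<sigma> \<rho> where
  "h \<in> hedges H \<Longrightarrow> i < length (\<sigma> h) \<Longrightarrow> j < length (\<sigma> h) \<Longrightarrow>
    [Edge h i 0, Ghost h j 0] \<in> forbidden H \<sigma> \<rho>"
| "h \<in> hedges H \<Longrightarrow> i < length (\<rho> h) \<Longrightarrow> j < length (\<rho> h) \<Longrightarrow>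
    [Ghost h 0 i, Edge h 0 j] \<in> forbidden H \<sigma> \<rho>"

definition nod_path ::
    "('v, 'e) hypergraph \<Rightarrow> ('e \<Rightarrow> 'v list) \<Rightarrow> ('e \<Rightarrow> 'v list) \<Rightarrow> ('v, 'e) gen list \<Rightarrow> bool" where
  "nod_path H \<sigma> \<rho> p \<longleftrightarrow> dpath H \<sigma> \<rho> p \<and> (\<forall>w. sublist w p \<longrightarrow> w \<notin> forbidden H \<sigma> \<rho>)"

definition nod_conn ::
    "('v, 'e) hypergraph \<Rightarrow> ('e \<Rightarrow> 'v list) \<Rightarrow> ('e \<Rightarrow> 'v list)
      \<Rightarrow> ('v, 'e) gen list \<Rightarrow> ('v, 'e) gen list \<Rightarrow> bool" where
  "nod_conn H \<sigma> \<rho> p q \<longleftrightarrow>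
     (\<exists>w. nod_path H \<sigma> \<rho> w \<and> \<not> prefix p w \<and> nod_path H \<sigma> \<rho> (p @ w @ q))"

definition conn ::
    "('v, 'e) hypergraph \<Rightarrow> ('e \<Rightarrow> 'v list) \<Rightarrow> ('e \<Rightarrow> 'v list)
      \<Rightarrow> ('v, 'e) gen list \<Rightarrow> ('v, 'e) gen list \<Rightarrow> bool" where
  "conn H \<sigma> \<rho> p q \<longleftrightarrow> nod_path H \<sigma> \<rho> (p @ q) \<or> nod_conn H \<sigma> \<rho> p q"

definition nod2_path ::
    "('v, 'e) hypergraph \<Rightarrow> ('e \<Rightarrow> 'v list) \<Rightarrow> ('e \<Rightarrow> 'v list) \<Rightarrow> ('v, 'e) gen list \<Rightarrow> bool" where
  "nod2_path H \<sigma> \<rho> p \<longleftrightarrow> nod_path H \<sigma> \<rho> p \<and> nod_path H \<sigma> \<rho> (p @ p)"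

definition quasi_cycle ::
    "('v, 'e) hypergraph \<Rightarrow> ('e \<Rightarrow> 'v list) \<Rightarrow> ('e \<Rightarrow> 'v list) \<Rightarrow> ('v, 'e) gen list \<Rightarrow> bool" where
  "quasi_cycle H \<sigma> \<rho> p \<longleftrightarrow> nod2_path H \<sigma> \<rho> p
   \<and> (\<forall>w. sublist w (p @ p) \<and> path_length w < path_length p \<longrightarrow> \<not> nod2_path H \<sigma> \<rho> w)"

definition selfconnected ::
    "('v, 'e) hypergraph \<Rightarrow> ('e \<Rightarrow> 'v list) \<Rightarrow> ('e \<Rightarrow> 'v list) \<Rightarrow> ('v, 'e) gen list \<Rightarrow> bool" where
  "selfconnected H \<sigma> \<rho> p \<longleftrightarrow> nod_conn H \<sigma> \<rho> p p"

definition is_shift :: "'a list \<Rightarrow> 'a list \<Rightarrow> bool" (infix \<open>\<approx>\<^sub>s\<close> 50) where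
  "p \<approx>\<^sub>s q \<longleftrightarrow> (\<exists>m. 1 \<le> m \<and> m \<le> length p \<and> q = drop m p @ take m p)"

definition quasi_cycle_chain ::
    "('v, 'e) hypergraph \<Rightarrow> ('e \<Rightarrow> 'v list) \<Rightarrow> ('e \<Rightarrow> 'v list)
      \<Rightarrow> ('v, 'e) gen list list \<Rightarrow> bool" where
  "quasi_cycle_chain H \<sigma> \<rho> ps \<longleftrightarrow>
     (\<forall>p\<in>set ps. quasi_cycle H \<sigma> \<rho> p)
   \<and> (\<forall>i j. i < length ps \<and> j < length ps \<and> i \<noteq> j \<longrightarrow> \<not> ps ! i \<approx>\<^sub>s ps ! j)
   \<and> (\<forall>i. Suc i < length ps \<longrightarrow> conn H \<sigma> \<rho> (ps ! i) (ps ! Suc i))"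

text \<open>
  The empty list is a chain of length \<open>0\<close>, which gives the value \<open>0\<close> if there are no quasi-cycles.
\<close>

definition max_chain_length ::
    "('v, 'e) hypergraph \<Rightarrow> ('e \<Rightarrow> 'v list) \<Rightarrow> ('e \<Rightarrow> 'v list) \<Rightarrow> nat" where
  "max_chain_length H \<sigma> \<rho> = Max {length ps | ps. quasi_cycle_chain H \<sigma> \<rho> ps}"

end

theory Submission
  imports Defs
begin

text \<open>
  Call a letter \<open>y\<close> a successor of a letter \<open>x\<close> if \<open>xy\<close> is a nod-path. Nod-paths of positive length
  are then exactly the walks in a finite digraph \<open>D\<close>, and quasi-cycles are its chordless cycles.
  The nod-paths form a basis of the Leavitt path algebra: right multiplication by a letter followed
  by a single reduction step respects the defining relations, which gives linear independence. So the
  growth of the algebra is the growth of the number of walks in \<open>D\<close>. If some cycle has a detour back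
  to itself, two different closed walks of equal length can be concatenated freely and the growth is
  exponential. Otherwise every nontrivial strongly connected component of \<open>D\<close> is a single
  chordless cycle, a walk is determined up to finitely many choices by the time that it spends in each
  cycle, and the number of walks of length at most \<open>n\<close> has order \<open>n ^ d\<close>.
\<close>

section \<open>Walks in finite digraphs\<close>

text \<open>One reduction step is enough because it replaces the last two letters of a word by pairs
  whose inner index is not the distinguished \<open>0\<close>; such pairs are not forbidden and
  create no forbidden pair with the letter before them. The only ambiguity is a three-letter overlap
  of two forbidden words. It is resolved once, in \<open>act_relation\<close>, so no termination or
  confluence argument for a rewriting system arises. The operators act on functions on words rather
  than on formal sums, which also lets a word act in the order of its letters. Reductions never
  lengthen words, so the number of edges gives a filtration compatible with products, and an
  arbitrary generating subspace is compared with it up to a linear change of the argument. On the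
  graph side, the clause that \<open>p\<close> is no prefix of the connecting word separates a real
  detour from merely going round \<open>p\<close> again: it forces \<open>p @ w\<close> and
  \<open>w @ p\<close> to differ, and conversely suitable shortest connecting words satisfy it. This
  is how chains and detours can be produced from plain reachability.\<close>

locale finite_digraph =
  fixes E :: "'a set" and R :: "'a \<Rightarrow> 'a \<Rightarrow> bool"
  assumes finite_E: "finite E"
begin

definition walk :: "'a list \<Rightarrow> bool" where
  "walk xs \<longleftrightarrow> xs \<noteq> [] \<and> set xs \<subseteq> E \<and> successively R xs"

definition closed_walk :: "'a list \<Rightarrow> bool" where
  "closed_walk xs \<longleftrightarrow> walk (xs @ xs)"

definition qcycle :: "'a list \<Rightarrow> bool" where
  "qcycle p \<longleftrightarrow> closed_walk p \<and> (\<forall>w. sublist w (p @ p) \<and> closed_walk w \<longrightarrow> length p \<le> length w)"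

definition detour :: "'a list \<Rightarrow> 'a list \<Rightarrow> bool" where
  "detour p q \<longleftrightarrow> (\<exists>w. walk w \<and> \<not> prefix p w \<and> walk (p @ w @ q))"

definition connected_to :: "'a list \<Rightarrow> 'a list \<Rightarrow> bool" where
  "connected_to p q \<longleftrightarrow> walk (p @ q) \<or> detour p q"

text \<open>\<open>sorted_wrt\<close> only compares earlier with later entries, so both directions
  of the shift relation are excluded. The list form suits induction along the chain.\<close>

definition chain :: "'a list list \<Rightarrow> bool" where
  "chain ps \<longleftrightarrow> (\<forall>p\<in>set ps. qcycle p)
     \<and> sorted_wrt (\<lambda>p q. \<not> p \<approx>\<^sub>s q \<and> \<not> q \<approx>\<^sub>s p) ps \<and> successively connected_to ps"

text \<open>Unlike \<open>walk\<close>, this admits the empty word; it will stand for paths of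
  length zero.\<close>

definition walks :: "nat \<Rightarrow> 'a list set" where
  "walks n = {xs. length xs \<le> n \<and> set xs \<subseteq> E \<and> successively R xs}"

definition step :: "'a \<Rightarrow> 'a \<Rightarrow> bool" where
  "step x y \<longleftrightarrow> x \<in> E \<and> y \<in> E \<and> R x y"

section \<open>Elementary properties of walks and quasi-cycles\<close>

lemma walk_append:
  "xs \<noteq> [] \<Longrightarrow> ys \<noteq> [] \<Longrightarrow> walk (xs @ ys) \<longleftrightarrow> walk xs \<and> walk ys \<and> R (last xs) (hd ys)"
  by (auto simp: walk_def successively_append_iff)

lemma closed_walk_iff: "closed_walk xs \<longleftrightarrow> walk xs \<and> R (last xs) (hd xs)"
  by (cases "xs = []") (auto simp: closed_walk_def walk_append, auto simp: walk_def)

lemma walk_sublist: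
  assumes "walk xs" "sublist w xs" "w \<noteq> []" shows "walk w"
  using assms by (auto simp: walk_def sublist_def successively_append_iff)

lemma walk_notNil: "walk xs \<Longrightarrow> xs \<noteq> []"
  by (simp add: walk_def)

lemma finite_walks: "finite (walks n)"
  by (rule finite_subset[OF _ finite_lists_length_le[OF finite_E, of n]]) (auto simp: walks_def)

lemma qcycle_closed: "qcycle p \<Longrightarrow> closed_walk p"
  by (simp add: qcycle_def)

lemma qcycle_walk: "qcycle p \<Longrightarrow> walk p"
  by (simp add: qcycle_def closed_walk_iff)

lemma qcycle_minimal: "qcycle p \<Longrightarrow> sublist w (p @ p) \<Longrightarrow> closed_walk w \<Longrightarrow> length p \<le> length w"
  by (simp add: qcycle_def)

text \<open>The stretch from one occurrence of a letter up to just before the next is a closed walk,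
  closed by the edge into the second occurrence, and it is shorter than \<open>p\<close>.\<close>

lemma qcycle_distinct:
  assumes p: "qcycle p" shows "distinct p"
proof (rule ccontr)
  assume "\<not> distinct p"
  then obtain us vs ws x where eq: "p = us @ [x] @ vs @ [x] @ ws"
    using not_distinct_decomp by blast
  have "walk ((x # vs) @ [x])"
    by (rule walk_sublist[OF qcycle_walk[OF p]]) (auto simp: eq sublist_def)
  then have "closed_walk (x # vs)"
    using walk_append[of "x # vs" "[x]"] by (simp add: closed_walk_iff)
  moreover have "sublist (x # vs) (p @ p)"
    unfolding eq sublist_def
    by (intro exI[of _ us] exI[of _ "[x] @ ws @ us @ [x] @ vs @ [x] @ ws"]) simp
  ultimately show False using qcycle_minimal[OF p, of "x # vs"] eq by simp
qed

lemma finite_qcycles: "finite {p. qcycle p}"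
  by (rule finite_subset[OF _ finite_subset_distinct[OF finite_E]])
    (use qcycle_distinct qcycle_walk in \<open>auto simp: walk_def\<close>)

lemma chain_distinct:
  assumes "chain ps" shows "distinct ps"
proof -
  have "p \<approx>\<^sub>s p" if "qcycle p" for p
    using walk_notNil[OF qcycle_walk[OF that]] unfolding is_shift_def
    by (intro exI[of _ "length p"]) (auto simp: Suc_le_eq)
  then show ?thesis
    using assms unfolding chain_def distinct_conv_nth sorted_wrt_iff_nth_less
    by (metis linorder_neqE_nat nth_mem)
qed

text \<open>Guarantees that the maximum in \<open>max_chain_length\<close> is taken over a finite
  set.\<close>

lemma finite_chains: "finite {ps. chain ps}"
  by (rule finite_subset[OF _ finite_subset_distinct[OF finite_qcycles]])
    (use chain_distinct in \<open>auto simp: chain_def\<close>)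

subsection \<open>Exponential growth\<close>

text \<open>If \<open>p @ w = w @ p\<close> and \<open>w\<close> is at least as long as
  \<open>p\<close>, then \<open>p\<close> is a prefix of \<open>w\<close>. If \<open>w\<close> is
  shorter, it is a prefix of \<open>p\<close>, and the edge from \<open>w\<close> back to
  \<open>hd p\<close> makes it a closed walk that violates the minimality of
  \<open>p\<close>.\<close>

lemma detour_not_commute:
  assumes p: "qcycle p" and w: "\<not> prefix p w" "walk w" "walk (p @ w @ p)"
  shows "p @ w \<noteq> w @ p"
proof
  assume eq: "p @ w = w @ p"
  show False
  proof (cases "length p \<le> length w")
    case True
    with eq w(1) show False by (metis append_eq_append_conv_if prefixI append_take_drop_id)
  next
    case False
    then obtain v where v: "p = w @ v" using eq unfolding append_eq_append_conv2 by auto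
    have ne: "w \<noteq> []" "p \<noteq> []" using w walk_notNil qcycle_walk[OF p] by auto
    have "R (last w) (hd p)" using w(3) ne by (simp add: walk_append)
    then have "closed_walk w" using w(2) v ne by (simp add: closed_walk_iff)
    moreover have "sublist w (p @ p)" unfolding v sublist_def
      by (intro exI[of _ "[]"] exI[of _ "v @ w @ v"]) simp
    ultimately show False using qcycle_minimal[OF p] False by auto
  qed
qed

lemma walks_exponential:
  assumes p: "qcycle p" and pp: "detour p p"
  shows "\<exists>L\<ge>1. \<forall>m. 2 ^ m \<le> card (walks (L * m))"
proof -
  obtain w where w: "walk w" "\<not> prefix p w" "walk (p @ w @ p)" using pp by (auto simp: detour_def)
  \<comment> \<open>Both blocks have the same length, start with \<open>hd p\<close> and end in a
    letter that \<open>hd p\<close> may follow, so they can be concatenated in any order. They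
    differ since \<open>p @ w\<close> and \<open>w @ p\<close> do, and equal block length makes the
    choices recoverable from the word.\<close>
  define A where "A = p @ p @ w"
  define B where "B = p @ w @ p"
  have ne: "w \<noteq> []" "p \<noteq> []" using w walk_notNil qcycle_walk[OF p] by auto
  have pc: "walk p" "R (last p) (hd p)" using qcycle_closed[OF p] by (auto simp: closed_walk_iff)
  have AB: "A \<noteq> B" using detour_not_commute[OF p w(2,1,3)] by (simp add: A_def B_def)
  have C: "closed_walk A" "closed_walk B" "hd A = hd p" "hd B = hd p" "length B = length A"
    using ne w pc by (auto simp: A_def B_def closed_walk_iff walk_append)
  define wd where "wd bs = concat (map (\<lambda>b. if b then A else B) bs)" for bs
  have len: "length (wd bs) = length A * length bs" for bs
    using C(5) by (induction bs) (auto simp: wd_def)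
  have walks: "set (wd bs) \<subseteq> E \<and> successively R (wd bs) \<and> (bs \<noteq> [] \<longrightarrow> hd (wd bs) = hd p)" for bs
  proof (induction bs)
    case (Cons b bs)
    have "wd (b # bs) = (if b then A else B) @ wd bs" by (simp add: wd_def)
    moreover have "wd bs = []" if "bs = []" using that by (simp add: wd_def)
    ultimately show ?case using C Cons by (auto simp: successively_append_iff closed_walk_iff walk_def)
  qed (auto simp: wd_def)
  have inj: "inj_on wd {bs. length bs = m}" for m
  proof (rule inj_onI)
    fix as bs assume l: "as \<in> {bs. length bs = m}" "bs \<in> {bs. length bs = m}" and eq: "wd as = wd bs"
    have "map (\<lambda>b. if b then A else B) as = map (\<lambda>b. if b then A else B) bs"
      using eq l C(5) unfolding wd_def
      by (subst (asm) concat_eq_concat_iff) (auto simp: set_zip)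
    moreover have "inj (\<lambda>b. if b then A else B)" using AB by (auto simp: inj_def split: if_splits)
    ultimately show "as = bs" by (rule map_injective)
  qed
  have "2 ^ m \<le> card (walks (length A * m))" for m
  proof -
    have "(2::nat) ^ m = card {bs :: bool list. length bs = m}"
      using card_lists_length_eq[of "UNIV :: bool set" m] by simp
    also have "\<dots> \<le> card (walks (length A * m))"
      by (rule card_inj_on_le[OF inj _ finite_walks]) (use walks len in \<open>auto simp: walks_def\<close>)
    finally show ?thesis .
  qed
  moreover have "length A \<ge> 1" using ne by (cases p) (auto simp: A_def)
  ultimately show ?thesis by blast
qed

subsection \<open>Reachability\<close>

text \<open>The endpoint is split off as last letter because it is afterwards replaced by a cycle
  that starts with it.\<close>

lemma step_path:
  assumes "step\<^sup>*\<^sup>* x y" "x \<in> E"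
  shows "\<exists>us. walk (us @ [y]) \<and> hd (us @ [y]) = x"
  using assms
proof (induction rule: rtranclp_induct)
  case base
  then show ?case by (intro exI[of _ "[]"]) (auto simp: walk_def)
next
  case (step y z)
  then obtain us where us: "walk (us @ [y])" "hd (us @ [y]) = x" by auto
  have "walk ((us @ [y]) @ [z])" using us step(2) unfolding step_def
    by (subst walk_append) (auto simp: walk_def)
  then show ?case using us(2) by (intro exI[of _ "us @ [y]"]) (cases us; simp)
qed

lemma walk_steps: "walk (x # xs) \<Longrightarrow> y \<in> set (x # xs) \<Longrightarrow> step\<^sup>*\<^sup>* x y"
proof (induction xs arbitrary: x)
  case (Cons z xs)
  then have "step x z" "walk (z # xs)" by (auto simp: walk_def step_def)
  with Cons show ?case by (metis converse_rtranclp_into_rtranclp rtranclp.rtrancl_refl set_ConsD)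
qed auto

text \<open>Starting at \<open>x\<close> inside the first copy of \<open>p @ p\<close>, the walk
  still runs through the whole second copy.\<close>

lemma closed_walk_steps:
  assumes "closed_walk p" "x \<in> set p" "y \<in> set p" shows "step\<^sup>*\<^sup>* x y"
proof -
  obtain us vs where p: "p = us @ x # vs" using split_list[OF assms(2)] by auto
  have "walk (x # vs @ p)"
    using assms(1) unfolding closed_walk_def
    by (rule walk_sublist) (auto simp: p sublist_def intro: exI[of _ us] exI[of _ "[]"])
  then show ?thesis by (rule walk_steps) (use assms(3) in auto)
qed

lemma steps_in_E: "step\<^sup>*\<^sup>* x y \<Longrightarrow> x \<in> E \<Longrightarrow> y \<in> E"
  by (induction rule: rtranclp_induct) (auto simp: step_def)

lemma closed_walk_subset: "closed_walk p \<Longrightarrow> x \<in> set p \<Longrightarrow> x \<in> E"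
  by (auto simp: closed_walk_def walk_def)

text \<open>A connecting word of minimal length cannot start with \<open>p\<close>, since \<open>p\<close> could be cut off.\<close>

lemma connected_toI:
  assumes p: "closed_walk p" and q: "closed_walk q"
    and x: "x \<in> set p" and y: "y \<in> set q" and xy: "step\<^sup>*\<^sup>* x y"
  shows "connected_to p q"
proof -
  have ne: "p \<noteq> []" "q \<noteq> []" using x y by auto
  have "step\<^sup>*\<^sup>* (hd p) (hd q)"
    using closed_walk_steps[OF p _ x, of "hd p"] closed_walk_steps[OF q y, of "hd q"] xy ne
    by (auto intro: rtranclp_trans)
  then obtain us where us: "walk (us @ [hd q])" "hd (us @ [hd q]) = hd p"
    using step_path closed_walk_subset[OF p] ne by (metis hd_in_set)
  have pq: "walk p" "R (last p) (hd p)" "walk q" using p q by (auto simp: closed_walk_iff)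
  have "walk (p @ us @ q)"
  proof (cases "us = []")
    case True then show ?thesis using us pq ne by (simp add: walk_append)
  next
    case False
    then have "walk us" "R (last us) (hd q)" using us(1) by (auto simp: walk_append)
    then show ?thesis using us(2) pq ne False by (simp add: walk_append)
  qed
  then obtain u where u: "walk (p @ u @ q)" "\<And>v. walk (p @ v @ q) \<Longrightarrow> length u \<le> length v"
    using ex_has_least_nat[of "\<lambda>u. walk (p @ u @ q)" us length] by blast
  show ?thesis
  proof (cases "u = []")
    case True then show ?thesis using u by (simp add: connected_to_def)
  next
    case False
    have "\<not> prefix p u"
    proof
      assume "prefix p u"
      then obtain v where v: "u = p @ v" by (auto simp: prefix_def)
      have "walk (p @ v @ q)"
        by (rule walk_sublist[OF u(1)]) (use ne in \<open>auto simp: v sublist_def intro: exI[of _ p] exI[of _ "[]"]\<close>)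
      from u(2)[OF this] v ne show False by simp
    qed
    moreover have "walk u" using u(1) False ne by (simp add: walk_append)
    ultimately show ?thesis using u(1) by (auto simp: connected_to_def detour_def)
  qed
qed

text \<open>Take a shortest connecting word among those that contain \<open>y\<close>. If
  \<open>p\<close> were a prefix of it, cutting \<open>p\<close> off would give a shorter connecting
  word, still containing \<open>y\<close> because \<open>y\<close> does not lie on
  \<open>p\<close>.\<close>

lemma detour_selfI:
  assumes p: "closed_walk p" and x: "x \<in> set p" "x' \<in> set p" and y: "y \<notin> set p"
    and xy: "step\<^sup>*\<^sup>* x y" and yx: "step\<^sup>*\<^sup>* y x'"
  shows "detour p p"
proof -
  have ne: "p \<noteq> []" using x by auto
  have hE: "hd p \<in> E" using closed_walk_subset[OF p] ne by auto
  have 1: "step\<^sup>*\<^sup>* (hd p) y" "step\<^sup>*\<^sup>* y (hd p)"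
    using closed_walk_steps[OF p _ x(1), of "hd p"] closed_walk_steps[OF p x(2), of "hd p"] xy yx ne
    by (auto intro: rtranclp_trans)
  obtain us where us: "walk (us @ [y])" "hd (us @ [y]) = hd p" using step_path[OF 1(1) hE] by auto
  obtain vs where vs: "walk (vs @ [hd p])" "hd (vs @ [hd p]) = y"
    using step_path[OF 1(2) steps_in_E[OF 1(1) hE]] by auto
  have pc: "walk p" "R (last p) (hd p)" using p by (auto simp: closed_walk_iff)
  have vne: "vs \<noteq> []" using vs(2) y ne by auto
  then have vs': "walk vs" "R (last vs) (hd p)" "hd vs = y" using vs by (auto simp: walk_append)
  have une: "us \<noteq> []" using us(2) y ne by auto
  then have us': "walk us" "R (last us) y" "hd us = hd p" using us by (auto simp: walk_append)
  have "walk (p @ (us @ vs) @ p) \<and> y \<in> set (us @ vs)"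
    using vs' us' vne une ne pc hd_in_set[OF vne] by (simp add: walk_append)
  then obtain u where u: "walk (p @ u @ p)" "y \<in> set u"
    "\<And>v. walk (p @ v @ p) \<and> y \<in> set v \<Longrightarrow> length u \<le> length v"
    using ex_has_least_nat[of "\<lambda>u. walk (p @ u @ p) \<and> y \<in> set u" "us @ vs" length] by blast
  have "\<not> prefix p u"
  proof
    assume "prefix p u"
    then obtain v where v: "u = p @ v" by (auto simp: prefix_def)
    have "walk (p @ v @ p)"
      by (rule walk_sublist[OF u(1)]) (use ne in \<open>auto simp: v sublist_def intro: exI[of _ p] exI[of _ "[]"]\<close>)
    with u(2,3) v y ne show False by fastforce
  qed
  moreover have "walk u" using u(1,2) ne by (cases "u = []") (auto simp: walk_append)
  ultimately show ?thesis using u(1) by (auto simp: detour_def)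
qed

text \<open>A shortest closed walk with letters in \<open>set c\<close> works: sublists of
  \<open>p @ p\<close> use no other letters. Comparing letter sets instead of sublists avoids the
  wrap-around in \<open>p @ p\<close>.\<close>

lemma closed_walk_contains_qcycle:
  assumes "closed_walk c" shows "\<exists>p. qcycle p \<and> set p \<subseteq> set c"
proof -
  obtain p where p: "closed_walk p" "set p \<subseteq> set c"
    "\<And>q. closed_walk q \<and> set q \<subseteq> set c \<Longrightarrow> length p \<le> length q"
    using ex_has_least_nat[of "\<lambda>p. closed_walk p \<and> set p \<subseteq> set c" c length] assms by blast
  have "length p \<le> length w" if "sublist w (p @ p)" "closed_walk w" for w
    using p(2,3) that set_mono_sublist[of w "p @ p"] by auto
  with p show ?thesis by (auto simp: qcycle_def)
qed

text \<open>Quasi-cycles have no chords: an edge from \<open>z\<close> to any letter other than the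
  cyclically next one would cut off a part of \<open>p\<close> and close a shorter walk.\<close>

lemma qcycle_unique_step:
  assumes p: "qcycle p" and z: "z \<in> set p" and a: "a \<in> set p" "R z a" and b: "b \<in> set p" "R z b"
  shows "a = b"
proof -
  obtain us vs where eq: "p = us @ z # vs" using split_list[OF z] by auto
  have "c = (if vs = [] then hd p else hd vs)" if c: "c \<in> set p" "R z c" for c
  proof (cases "c \<in> set vs")
    case True
    then obtain vs1 vs2 where v: "vs = vs1 @ c # vs2" using split_list[of c vs] by blast
    \<comment> \<open>From \<open>c\<close> forward to the end of \<open>p\<close> and on from its
      beginning to \<open>z\<close>; only \<open>vs1\<close> is skipped, so minimality empties
      it.\<close>
    let ?w = "c # vs2 @ us @ [z]"
    have sl: "sublist ?w (p @ p)" unfolding eq v sublist_def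
      by (intro exI[of _ "us @ z # vs1"] exI[of _ "vs1 @ c # vs2"]) simp
    then have "walk ?w" using walk_sublist qcycle_closed[OF p] by (auto simp: closed_walk_def)
    then have "closed_walk ?w" using c by (simp add: closed_walk_iff)
    from qcycle_minimal[OF p sl this] have "vs1 = []" by (simp add: eq v)
    then show ?thesis by (simp add: v)
  next
    case False
    then have "c \<in> set (us @ [z])" using c eq by auto
    \<comment> \<open>Splitting \<open>us @ [z]\<close> instead of \<open>us\<close> includes the
      loop \<open>c = z\<close>.\<close>
    then obtain us1 us2 where u: "us @ [z] = us1 @ c # us2" using split_list[of c "us @ [z]"] by blast
    have "p = (us @ [z]) @ vs" by (simp add: eq)
    then have eq': "p = us1 @ c # us2 @ vs" unfolding u by simp
    let ?w = "c # us2"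
    have sl: "sublist ?w (p @ p)" unfolding eq' sublist_def
      by (intro exI[of _ us1] exI[of _ "vs @ us1 @ c # us2 @ vs"]) simp
    then have "walk ?w" using walk_sublist qcycle_closed[OF p] by (auto simp: closed_walk_def)
    moreover have "last ?w = z" using arg_cong[OF u, of last] by simp
    ultimately have "closed_walk ?w" using c by (simp add: closed_walk_iff)
    from qcycle_minimal[OF p sl this] have "us1 = []" "vs = []" by (simp_all add: eq')
    then show ?thesis using eq' by simp
  qed
  with a b show ?thesis by metis
qed

text \<open>Otherwise rotate \<open>q\<close> to a closed walk \<open>r\<close> that starts with
  \<open>hd p\<close>. As \<open>p\<close> has no detour, \<open>p\<close> must be a prefix of
  \<open>r\<close>; then \<open>p\<close> is a closed walk inside \<open>q @ q\<close>, so
  minimality of \<open>q\<close> forces \<open>p = r\<close>, a shift of \<open>q\<close>. Thus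
  \<open>hd p\<close> can serve as a marker for passages through \<open>p\<close>.\<close>

lemma hd_notin_qcycle:
  assumes p: "qcycle p" "\<not> detour p p" and q: "qcycle q" and ns: "\<not> q \<approx>\<^sub>s p"
  shows "hd p \<notin> set q"
proof
  assume "hd p \<in> set q"
  then obtain us vs where eq: "q = us @ hd p # vs" using split_list[of "hd p" q] by blast
  define r where "r = hd p # vs @ us"
  have ne: "p \<noteq> []" using walk_notNil[OF qcycle_walk[OF p(1)]] .
  have "sublist (r @ [hd p]) (q @ q)" unfolding eq r_def sublist_def
    by (intro exI[of _ us] exI[of _ vs]) simp
  then have "walk (r @ [hd p])" using walk_sublist qcycle_closed[OF q] by (auto simp: closed_walk_def)
  then have r: "walk r" "R (last r) (hd p)" using walk_append[of r "[hd p]"] by (auto simp: r_def)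
  have pc: "closed_walk p" "walk p" "R (last p) (hd p)" using qcycle_closed[OF p(1)] by (auto simp: closed_walk_iff)
  have "walk (p @ r @ p)" using r pc ne walk_notNil[OF r(1)] by (simp add: walk_append) (simp add: r_def)
  with p(2) r have "prefix p r" by (auto simp: detour_def)
  then obtain t where t: "r = p @ t" by (auto simp: prefix_def)
  have "q @ q = us @ r @ hd p # vs" by (simp add: eq r_def)
  then have "sublist p (q @ q)" unfolding t sublist_def
    by (intro exI[of _ us] exI[of _ "t @ hd p # vs"]) simp
  from qcycle_minimal[OF q this pc(1)] have "length q \<le> length p" .
  moreover have "length q = length r" by (simp add: eq r_def)
  ultimately have "p = r" using t by simp
  then have pr: "p = hd p # vs @ us" by (simp add: r_def)
  have "q \<approx>\<^sub>s p"
  \<comment> \<open>\<open>is_shift\<close> requires a positive rotation, so the trivial one is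
    expressed by rotating through the full length.\<close>
  proof (cases "us = []")
    case True
    then have "q = p" using pr eq by simp
    then show ?thesis using ne unfolding is_shift_def
      by (intro exI[of _ "length p"]) (simp add: Suc_le_eq)
  next
    case False
    have "drop (length us) q @ take (length us) q = p" unfolding eq by (simp add: pr[symmetric])
    then show ?thesis using False unfolding is_shift_def
      by (intro exI[of _ "length us"]) (simp add: eq Suc_le_eq)
  qed
  with ns show False by blast
qed

subsection \<open>Polynomial lower bound\<close>

text \<open>The exponent is \<open>Suc a\<close>, so every cycle is passed at least once and the
  connecting words fit for all choices of exponents.\<close>

fun chain_word :: "'a list list \<Rightarrow> 'a list list \<Rightarrow> nat list \<Rightarrow> 'a list" where
  "chain_word (p # ps) (w # ws) (a # as) = concat (replicate (Suc a) p) @ w @ chain_word ps ws as"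
| "chain_word _ _ _ = []"

lemma walk_replicate:
  assumes "closed_walk p"
  shows "walk (concat (replicate (Suc a) p)) \<and> hd (concat (replicate (Suc a) p)) = hd p
    \<and> last (concat (replicate (Suc a) p)) = last p"
proof (induction a)
  case 0
  then show ?case using assms by (simp add: closed_walk_iff)
next
  case (Suc a)
  have p: "walk p" "R (last p) (hd p)" "p \<noteq> []" using assms walk_notNil by (auto simp: closed_walk_iff)
  define c where "c = concat (replicate (Suc a) p)"
  have "concat (replicate (Suc (Suc a)) p) = p @ c" by (simp add: c_def)
  moreover have "walk c" "hd c = hd p" "last c = last p" using Suc by (simp_all only: c_def)
  moreover have "c \<noteq> []" using p by (simp add: c_def)
  ultimately show ?case using p by (simp add: walk_append)
qed

text \<open>The connecting words are chosen before the exponents, since the exponents are what will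
  be counted. The claim on the head carries the induction: a word that leads from \<open>p\<close>
  to \<open>q\<close> also leads to any walk starting with \<open>hd q\<close>.\<close>

lemma chain_word_walk:
  assumes "\<forall>p\<in>set ps. qcycle p" "successively connected_to ps"
  shows "\<exists>ws. length ws = length ps \<and> (\<forall>as. length as = length ps \<longrightarrow>
    (ps \<noteq> [] \<longrightarrow> walk (chain_word ps ws as) \<and> hd (chain_word ps ws as) = hd (hd ps)))"
  using assms
proof (induction ps)
  case Nil
  then show ?case by simp
next
  case (Cons p ps)
  have pc: "closed_walk p" "p \<noteq> []"
    using Cons.prems walk_notNil[OF qcycle_walk[of p]] by (auto simp: qcycle_closed)
  show ?case
  proof (cases ps)
    case Nil
    show ?thesis unfolding Nil
    proof (intro exI[of _ "[[]]"] conjI allI impI)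
      fix as :: "nat list" assume "length as = length [p]"
      then obtain a where "as = [a]" by (auto simp: length_Suc_conv)
      then show "walk (chain_word [p] [[]] as)" "hd (chain_word [p] [[]] as) = hd (hd [p])"
        using walk_replicate[OF pc(1), of a] by simp_all
    qed simp
  next
    case (Cons q qs)
    have q: "walk q" "q \<noteq> []" "successively connected_to ps"
      using Cons.prems Cons walk_notNil[OF qcycle_walk[of q]] by (auto simp: qcycle_walk)
    obtain ws where ws: "length ws = length ps" "\<And>as. length as = length ps \<Longrightarrow>
        walk (chain_word ps ws as) \<and> hd (chain_word ps ws as) = hd q"
      using Cons.IH Cons.prems q(3) Cons by auto
    have "connected_to p q" using Cons.prems Cons by simp
    then obtain w where w: "walk (p @ w @ q)"
      unfolding connected_to_def detour_def by (metis append_Nil)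
    show ?thesis
    proof (intro exI[of _ "w # ws"] conjI allI impI)
      fix as' :: "nat list" assume "length as' = length (p # ps)"
      then obtain a as where as: "as' = a # as" "length as = length ps" by (auto simp: length_Suc_conv)
      define u where "u = concat (replicate (Suc a) p)"
      define v where "v = chain_word ps ws as"
      have u: "walk u" "hd u = hd p" "last u = last p" using walk_replicate[OF pc(1), of a] by (auto simp: u_def)
      have v: "walk v" "hd v = hd q" using ws(2)[OF as(2)] by (auto simp: v_def)
      have ne: "u \<noteq> []" "v \<noteq> []" using u v walk_notNil by auto
      have eq: "chain_word (p # ps) (w # ws) as' = u @ w @ v" by (simp add: as u_def v_def)
      show "walk (chain_word (p # ps) (w # ws) as')"
        using w u v ne pc q unfolding eq by (cases "w = []") (simp_all add: walk_append)
      show "hd (chain_word (p # ps) (w # ws) as') = hd (hd (p # ps))" using eq u ne by simp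
    qed (use ws in simp)
  qed
qed

lemma count_list_concat_replicate: "count_list (concat (replicate n p)) x = n * count_list p x"
  by (induction n) auto

text \<open>A letter on none of the cycles occurs only in the connecting words, which do not depend
  on the exponents.\<close>

lemma count_list_chain_word:
  assumes "length ws = length ps" "length as = length ps" "length bs = length ps"
    and "\<forall>p\<in>set ps. x \<notin> set p"
  shows "count_list (chain_word ps ws as) x = count_list (chain_word ps ws bs) x"
  using assms
proof (induction ps arbitrary: ws as bs)
  case (Cons p ps)
  obtain w ws' a as' b bs' where e: "ws = w # ws'" "as = a # as'" "bs = b # bs'"
    using Cons.prems by (auto simp: length_Suc_conv)
  have "count_list (chain_word ps ws' as') x = count_list (chain_word ps ws' bs') x"
    using Cons.prems e by (intro Cons.IH) auto
  moreover have "count_list p x = 0" using Cons.prems(4) by (simp add: count_list_0_iff)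
  ultimately show ?case by (simp add: e count_list_concat_replicate)
qed auto

text \<open>The number of occurrences of \<open>hd p\<close> is \<open>Suc a\<close> times a
  positive number plus a contribution independent of the exponents, because later cycles avoid
  \<open>hd p\<close>. So the first exponent can be read off; cancel its block and recurse.\<close>

lemma chain_word_inj:
  assumes "length ws = length ps" "length as = length ps" "length bs = length ps"
    and "\<forall>p\<in>set ps. p \<noteq> []" "sorted_wrt (\<lambda>p q. hd p \<notin> set q) ps"
    and "chain_word ps ws as = chain_word ps ws bs"
  shows "as = bs"
  using assms
proof (induction ps arbitrary: ws as bs)
  case (Cons p ps)
  obtain w ws' a as' b bs' where e: "ws = w # ws'" "as = a # as'" "bs = b # bs'"
    using Cons.prems(1,2,3) by (auto simp: length_Suc_conv)
  have l: "length ws' = length ps" "length as' = length ps" "length bs' = length ps" using Cons.prems e by auto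
  have "count_list (chain_word ps ws' as') (hd p) = count_list (chain_word ps ws' bs') (hd p)"
    using Cons.prems l by (intro count_list_chain_word) auto
  then have "Suc a * count_list p (hd p) = Suc b * count_list p (hd p)"
    using arg_cong[OF Cons.prems(6), of "\<lambda>xs. count_list xs (hd p)"]
    by (simp add: e count_list_concat_replicate)
  moreover have "count_list p (hd p) \<noteq> 0" using Cons.prems(4) by (simp add: count_list_0_iff)
  ultimately have ab: "a = b" by simp
  then have "chain_word ps ws' as' = chain_word ps ws' bs'" using Cons.prems(6) by (simp add: e)
  then have "as' = bs'" using Cons.IH[OF l] Cons.prems by simp
  with ab show ?case by (simp add: e)
qed auto

lemma length_chain_word:
  assumes "\<forall>a\<in>set as. a < m"
  shows "length (chain_word ps ws as) \<le> m * (sum_list (map length ps) + sum_list (map length ws))"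
  using assms
proof (induction ps ws as rule: chain_word.induct)
  case (1 p ps w ws a as)
  have IH: "length (chain_word ps ws as) \<le> m * (sum_list (map length ps) + sum_list (map length ws))"
    using 1 by simp
  have "Suc a \<le> m" using 1 by auto
  then have "Suc a * length p \<le> m * length p" by (rule mult_le_mono1)
  moreover have "length w \<le> m * length w" using \<open>Suc a \<le> m\<close> by (cases m) auto
  moreover have "length (concat (replicate n p)) = n * length p" for n by (induction n) auto
  then have "length (chain_word (p # ps) (w # ws) (a # as))
      = Suc a * length p + length w + length (chain_word ps ws as)" by simp
  ultimately show ?case using IH by (simp only: sum_list.Cons list.map distrib_left)
qed auto

lemma walks_lower_bound:
  assumes nsc: "\<And>p. qcycle p \<Longrightarrow> \<not> detour p p" and ch: "chain ps"
  shows "\<exists>K\<ge>1. \<forall>m\<ge>1. m ^ length ps \<le> card (walks (K * m))"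
proof -
  obtain ws where ws: "length ws = length ps" "\<And>as. length as = length ps \<Longrightarrow> ps \<noteq> [] \<Longrightarrow> walk (chain_word ps ws as)"
    using chain_word_walk[of ps] ch by (auto simp: chain_def)
  \<comment> \<open>The sum is the length of one pass through all cycles and connecting words;
    exponents below \<open>m\<close> stretch it at most by the factor \<open>m\<close>. The
    \<open>Suc\<close> keeps \<open>K\<close> positive for the empty chain.\<close>
  define K where "K = Suc (sum_list (map length ps) + sum_list (map length ws))"
  have "m ^ length ps \<le> card (walks (K * m))" for m
  proof -
    let ?S = "{as. set as \<subseteq> {..<m} \<and> length as = length ps}"
    have ps: "\<forall>p\<in>set ps. p \<noteq> []" using ch walk_notNil qcycle_walk by (auto simp: chain_def)
    have srt: "sorted_wrt (\<lambda>p q. hd p \<notin> set q) ps"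
    proof (rule sorted_wrt_mono_rel[rotated])
      show "sorted_wrt (\<lambda>p q. \<not> p \<approx>\<^sub>s q \<and> \<not> q \<approx>\<^sub>s p) ps" using ch by (simp add: chain_def)
      show "hd p \<notin> set q" if "p \<in> set ps" "q \<in> set ps" "\<not> p \<approx>\<^sub>s q \<and> \<not> q \<approx>\<^sub>s p" for p q
        using hd_notin_qcycle[of p q] nsc ch that by (auto simp: chain_def)
    qed
    have inj: "inj_on (chain_word ps ws) ?S"
      by (rule inj_onI) (use chain_word_inj[OF ws(1) _ _ ps srt] in auto)
    have sub: "chain_word ps ws ` ?S \<subseteq> walks (K * m)"
    proof (rule image_subsetI)
      fix as assume as: "as \<in> ?S"
      then have "length (chain_word ps ws as) \<le> m * (sum_list (map length ps) + sum_list (map length ws))"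
        by (intro length_chain_word) auto
      also have "\<dots> \<le> K * m" by (simp add: K_def)
      finally show "chain_word ps ws as \<in> walks (K * m)"
        using ws(2)[of as] as by (cases "ps = []") (auto simp: walks_def walk_def)
    qed
    have "m ^ length ps = card ?S" by (simp add: card_lists_length_eq)
    also have "\<dots> \<le> card (walks (K * m))" by (rule card_inj_on_le[OF inj sub finite_walks])
    finally show ?thesis .
  qed
  then show ?thesis by (intro exI[of _ K]) (simp add: K_def)
qed

subsection \<open>Polynomial upper bound\<close>

definition walks_from :: "'a \<Rightarrow> nat \<Rightarrow> 'a list set" where
  "walks_from x n = {xs \<in> walks n. xs \<noteq> [] \<and> hd xs = x}"

text \<open>The chains still ahead of a walk that starts in \<open>x\<close>; reaching the first
  cycle suffices, since the others are reachable from it.\<close>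

definition chain_from :: "'a \<Rightarrow> 'a list list \<Rightarrow> bool" where
  "chain_from x ps \<longleftrightarrow> chain ps \<and> (ps \<noteq> [] \<longrightarrow> (\<exists>y\<in>set (hd ps). step\<^sup>*\<^sup>* x y))"

lemma finite_walks_from: "finite (walks_from x n)"
  by (simp add: walks_from_def finite_walks)

lemma walks_from_0: "walks_from x 0 = {}"
  by (auto simp: walks_from_def walks_def)

lemma walks_from_mono: "m \<le> n \<Longrightarrow> card (walks_from x m) \<le> card (walks_from x n)"
  by (rule card_mono[OF finite_walks_from]) (auto simp: walks_from_def walks_def)

lemma walks_from_Suc:
  "card (walks_from x (Suc n)) \<le> 1 + (\<Sum>y | step x y. card (walks_from y n))"
proof -
  have fin: "finite {y. step x y}" by (rule finite_subset[OF _ finite_E]) (auto simp: step_def)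
  have "walks_from x (Suc n) \<subseteq> Cons x ` ({[]} \<union> (\<Union>y\<in>{y. step x y}. walks_from y n))"
  proof
    fix xs assume xs: "xs \<in> walks_from x (Suc n)"
    then obtain ys where ys: "xs = x # ys" by (cases xs) (auto simp: walks_from_def)
    show "xs \<in> Cons x ` ({[]} \<union> (\<Union>y\<in>{y. step x y}. walks_from y n))"
      using xs unfolding ys by (cases ys) (auto simp: walks_from_def walks_def step_def)
  qed
  then have "card (walks_from x (Suc n)) \<le> card (Cons x ` ({[]} \<union> (\<Union>y\<in>{y. step x y}. walks_from y n)))"
    by (rule card_mono[rotated]) (simp add: fin finite_walks_from)
  also have "\<dots> \<le> card ({[]} \<union> (\<Union>y\<in>{y. step x y}. walks_from y n))"
    by (rule card_image_le) (simp add: fin finite_walks_from)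
  also have "\<dots> \<le> 1 + card (\<Union>y\<in>{y. step x y}. walks_from y n)"
    using card_Un_le[of "{[]}"] by simp
  also have "\<dots> \<le> 1 + (\<Sum>y | step x y. card (walks_from y n))"
    using card_UN_le[OF fin] by simp
  finally show ?thesis .
qed

lemma chain_from_reach: "step\<^sup>*\<^sup>* x y \<Longrightarrow> chain_from y ps \<Longrightarrow> chain_from x ps"
  unfolding chain_from_def by (meson rtranclp_trans)

lemma chain_reach:
  assumes "\<forall>p\<in>set ps. closed_walk p" "successively connected_to ps" "q \<in> set ps" "x \<in> set (hd ps)" "y \<in> set q"
  shows "step\<^sup>*\<^sup>* x y"
  using assms
proof (induction ps arbitrary: x)
  case (Cons p ps)
  show ?case
  proof (cases "q = p")
    case True then show ?thesis using Cons.prems closed_walk_steps by auto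
  next
    case False
    then obtain r rs where ps: "ps = r # rs" using Cons.prems by (cases ps) auto
    have r: "walk r" "r \<noteq> []" using Cons.prems ps by (auto simp: closed_walk_iff walk_notNil)
    obtain w where w: "walk (p @ w @ r)"
      using Cons.prems ps unfolding connected_to_def detour_def by (auto intro: that[of "[]"])
    have "p \<noteq> []" using Cons.prems by auto
    obtain z zs where p: "p = z # zs" using \<open>p \<noteq> []\<close> by (cases p) auto
    have "step\<^sup>*\<^sup>* z (hd r)" using walk_steps[of z "zs @ w @ r"] w r by (simp add: p)
    moreover have "step\<^sup>*\<^sup>* x z" using closed_walk_steps[of p x z] Cons.prems p by auto
    moreover have "step\<^sup>*\<^sup>* (hd r) y" using Cons False ps r by auto
    ultimately show ?thesis by (meson rtranclp_trans)
  qed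
qed simp

text \<open>If a cycle ahead of \<open>y\<close> had the letters of \<open>p\<close>, then
  \<open>y\<close> could return to \<open>x\<close>, which would be a detour of \<open>p\<close>.
  The connection from \<open>p\<close> to the next cycle comes from reachability alone.\<close>

lemma chain_Cons:
  assumes nsc: "\<And>p. qcycle p \<Longrightarrow> \<not> detour p p" and p: "qcycle p" and x: "x \<in> set p"
    and y: "y \<notin> set p" "step\<^sup>*\<^sup>* x y" and ps: "chain_from y ps"
  shows "chain_from x (p # ps)"
proof -
  have ch: "chain ps" "\<forall>p\<in>set ps. closed_walk p" using ps by (auto simp: chain_from_def chain_def qcycle_closed)
  have "\<not> p \<approx>\<^sub>s q \<and> \<not> q \<approx>\<^sub>s p" if q: "q \<in> set ps" for q
  proof (rule ccontr)
    assume "\<not> (\<not> p \<approx>\<^sub>s q \<and> \<not> q \<approx>\<^sub>s p)"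
    then have "set p = set q" unfolding is_shift_def
      by (metis append_take_drop_id set_append sup_commute)
    with x have xq: "x \<in> set q" by simp
    obtain z where z: "z \<in> set (hd ps)" "step\<^sup>*\<^sup>* y z" using ps q by (auto simp: chain_from_def)
    have "step\<^sup>*\<^sup>* z x" using chain_reach[OF ch(2) _ q z(1) xq] ch(1) by (simp add: chain_def)
    then have "detour p p"
      using detour_selfI[OF qcycle_closed[OF p] x x y] z(2) by (meson rtranclp_trans)
    with nsc p show False by blast
  qed
  moreover have "connected_to p (hd ps)" if ne: "ps \<noteq> []"
  proof -
    obtain z where z: "z \<in> set (hd ps)" "step\<^sup>*\<^sup>* y z" using ps ne by (auto simp: chain_from_def)
    show ?thesis
      by (rule connected_toI[OF qcycle_closed[OF p] _ x z(1)]) (use ch ne z(2) y(2) in \<open>auto intro: rtranclp_trans\<close>)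
  qed
  ultimately have "chain (p # ps)" using ch(1) p by (auto simp: chain_def successively_Cons)
  then show ?thesis using x by (auto simp: chain_from_def)
qed

lemma chain_from_single: "qcycle p \<Longrightarrow> x \<in> set p \<Longrightarrow> chain_from x [p]"
  by (auto simp: chain_from_def chain_def)

text \<open>Decrease of the induction measure: \<open>x\<close> reaches itself but is lost from
  \<open>y\<close>.\<close>

lemma reach_subset:
  assumes "step\<^sup>*\<^sup>* x y" "\<not> step\<^sup>*\<^sup>* y x" "x \<in> E"
  shows "card {z. step\<^sup>*\<^sup>* y z} < card {z. step\<^sup>*\<^sup>* x z}"
proof (rule psubset_card_mono)
  show "finite {z. step\<^sup>*\<^sup>* x z}" by (rule finite_subset[OF _ finite_E]) (use steps_in_E assms(3) in blast)
  show "{z. step\<^sup>*\<^sup>* y z} \<subset> {z. step\<^sup>*\<^sup>* x z}" using assms by (auto intro: rtranclp_trans)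
qed

text \<open>If \<open>x\<close> lies on a quasi-cycle \<open>p\<close>, a walk follows
  \<open>p\<close> without choice until it leaves for good; chains ahead of the exit point can be
  prolonged by \<open>p\<close>, so the exponent there is one less, and summing over the exit times
  restores it. If \<open>x\<close> lies on no quasi-cycle, its successors cannot return to it and
  inherit the exponent. The exponent therefore varies in the induction.\<close>

lemma walks_from_upper_bound:
  assumes nsc: "\<And>p. qcycle p \<Longrightarrow> \<not> detour p p"
    and "x \<in> E" and "\<And>ps. chain_from x ps \<Longrightarrow> length ps \<le> d"
  shows "\<exists>C. \<forall>n. card (walks_from x n) \<le> C * Suc n ^ d"
  using assms(2,3)
proof (induction "card {z. step\<^sup>*\<^sup>* x z}" arbitrary: x d rule: less_induct)
  case less
  show ?case
  proof (cases "\<exists>p. qcycle p \<and> x \<in> set p")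
    case True
    then obtain p where p: "qcycle p" "x \<in> set p" by auto
    \<comment> \<open>The one-element chain \<open>[p]\<close> forces \<open>d\<close> to be
      positive.\<close>
    obtain e where d: "d = Suc e" using less.prems(2)[OF chain_from_single[OF p]] by (cases d) auto
    define Y where "Y = {y \<in> E. y \<notin> set p \<and> step\<^sup>*\<^sup>* x y}"
    have finY: "finite Y" by (simp add: Y_def finite_E)
    have "\<exists>C. \<forall>n. card (walks_from y n) \<le> C * Suc n ^ e" if y: "y \<in> Y" for y
    proof (rule less.hyps)
      have "\<not> step\<^sup>*\<^sup>* y x"
        using detour_selfI[OF qcycle_closed[OF p(1)] p(2) p(2)] nsc[OF p(1)] y by (auto simp: Y_def)
      then show "card {z. step\<^sup>*\<^sup>* y z} < card {z. step\<^sup>*\<^sup>* x z}"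
        using y less.prems(1) by (intro reach_subset) (auto simp: Y_def)
      show "y \<in> E" using y by (simp add: Y_def)
      show "length ps \<le> e" if "chain_from y ps" for ps
        using less.prems(2)[OF chain_Cons[OF nsc p _ _ that]] y d by (auto simp: Y_def)
    qed
    then obtain C where C: "\<And>y n. y \<in> Y \<Longrightarrow> card (walks_from y n) \<le> C y * Suc n ^ e" by metis
    define c where "c = sum C Y"
    have sumY: "(\<Sum>y\<in>Y. card (walks_from y n)) \<le> c * Suc n ^ e" for n
      unfolding c_def sum_distrib_right by (rule sum_mono) (rule C)
    \<comment> \<open>Stated for all letters of \<open>p\<close> because the walk moves along the
      cycle. At each of at most \<open>n\<close> times it may stop, which gives the
      \<open>1\<close>, or leave into \<open>Y\<close>.\<close>
    have bound: "card (walks_from z n) \<le> n * (1 + c * Suc n ^ e)" if "z \<in> set p" for z n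
      using that
    proof (induction n arbitrary: z)
      case 0
      then show ?case by (simp add: walks_from_0)
    next
      case (Suc n)
      let ?S = "{y. step z y}"
      have xz: "step\<^sup>*\<^sup>* x z" using closed_walk_steps[OF qcycle_closed[OF p(1)] p(2) Suc.prems] .
      have finS: "finite ?S" by (rule finite_subset[OF _ finite_E]) (auto simp: step_def)
      have "\<exists>a. ?S \<inter> set p \<subseteq> {a}"
        using qcycle_unique_step[OF p(1) Suc.prems] unfolding step_def by blast
      then obtain a where a: "?S \<inter> set p \<subseteq> {a}" by auto
      have mono: "n * (1 + c * Suc n ^ e) \<le> n * (1 + c * Suc (Suc n) ^ e)"
        by (intro mult_le_mono add_le_mono power_mono) auto
      have "(\<Sum>y\<in>?S \<inter> set p. card (walks_from y n)) \<le> n * (1 + c * Suc (Suc n) ^ e)"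
      proof (cases "?S \<inter> set p = {}")
        case False
        then have "?S \<inter> set p = {a}" "a \<in> set p" using a by auto
        then show ?thesis using le_trans[OF Suc.IH[of a] mono] by simp
      qed simp
      moreover have "(\<Sum>y\<in>?S - set p. card (walks_from y n)) \<le> c * Suc (Suc n) ^ e"
      proof -
        have "(\<Sum>y\<in>?S - set p. card (walks_from y n)) \<le> (\<Sum>y\<in>Y. card (walks_from y n))"
          by (rule sum_mono2[OF finY])
            (use xz in \<open>auto simp: Y_def step_def intro: rtranclp.rtrancl_into_rtrancl\<close>)
        also have "\<dots> \<le> c * Suc n ^ e" by (rule sumY)
        also have "\<dots> \<le> c * Suc (Suc n) ^ e" by (intro mult_le_mono power_mono) auto
        finally show ?thesis .
      qed
      moreover have "(\<Sum>y\<in>?S. card (walks_from y n))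
          = (\<Sum>y\<in>?S \<inter> set p. card (walks_from y n)) + (\<Sum>y\<in>?S - set p. card (walks_from y n))"
        by (rule sum.Int_Diff[OF finS])
      ultimately show ?case using walks_from_Suc[of z n] by simp
    qed
    have "card (walks_from x n) \<le> (1 + c) * Suc n ^ d" for n
    proof -
      have "1 + c * Suc n ^ e \<le> (1 + c) * Suc n ^ e" by simp
      then have "n * (1 + c * Suc n ^ e) \<le> Suc n * ((1 + c) * Suc n ^ e)" by (intro mult_le_mono) auto
      also have "\<dots> = (1 + c) * Suc n ^ d" by (simp add: d algebra_simps)
      finally show ?thesis using bound[OF p(2), of n] by linarith
    qed
    then show ?thesis by blast
  next
    case False
    let ?Y = "{y. step x y}"
    have finY: "finite ?Y" by (rule finite_subset[OF _ finite_E]) (auto simp: step_def)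
    have "\<exists>C. \<forall>n. card (walks_from y n) \<le> C * Suc n ^ d" if y: "y \<in> ?Y" for y
    proof (rule less.hyps)
      have "\<not> step\<^sup>*\<^sup>* y x"
      proof
        assume yx: "step\<^sup>*\<^sup>* y x"
        \<comment> \<open>A return to \<open>x\<close> closes a walk. The quasi-cycle inside that
          walk misses \<open>x\<close> by the case assumption, yet reaches \<open>x\<close> and is
          reached from it, so it has a detour through \<open>x\<close>.\<close>
        obtain us where us: "walk (us @ [x])" "hd (us @ [x]) = y"
          using step_path[OF yx] y by (auto simp: step_def)
        then have c: "closed_walk (us @ [x])" using y by (simp add: closed_walk_iff step_def)
        then obtain p where p: "qcycle p" "set p \<subseteq> set (us @ [x])"
          using closed_walk_contains_qcycle by blast
        obtain z where z: "z \<in> set p" using walk_notNil[OF qcycle_walk[OF p(1)]] by (cases p) auto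
        have "detour p p"
          by (rule detour_selfI[OF qcycle_closed[OF p(1)] z z, of x])
            (use False p z closed_walk_steps[OF c] in auto)
        with nsc p show False by blast
      qed
      then show "card {z. step\<^sup>*\<^sup>* y z} < card {z. step\<^sup>*\<^sup>* x z}"
        using y less.prems(1) by (intro reach_subset) auto
      show "y \<in> E" using y by (simp add: step_def)
      show "length ps \<le> d" if "chain_from y ps" for ps
        using less.prems(2)[OF chain_from_reach[OF _ that]] y by blast
    qed
    then obtain C where C: "\<And>y n. y \<in> ?Y \<Longrightarrow> card (walks_from y n) \<le> C y * Suc n ^ d" by metis
    define c where "c = sum C ?Y"
    have "card (walks_from x n) \<le> (1 + c) * Suc n ^ d" for n
    proof -
      have "card (walks_from x n) \<le> card (walks_from x (Suc n))" by (rule walks_from_mono) simp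
      also have "\<dots> \<le> 1 + (\<Sum>y\<in>?Y. card (walks_from y n))" by (rule walks_from_Suc)
      also have "\<dots> \<le> 1 + (\<Sum>y\<in>?Y. C y * Suc n ^ d)" using C by (intro add_left_mono sum_mono) auto
      also have "\<dots> = 1 + c * Suc n ^ d" by (simp only: c_def sum_distrib_right)
      also have "\<dots> \<le> (1 + c) * Suc n ^ d" by simp
      finally show ?thesis .
    qed
    then show ?thesis by blast
  qed
qed

lemma walks_upper_bound:
  assumes nsc: "\<And>p. qcycle p \<Longrightarrow> \<not> detour p p"
    and d: "\<And>ps. chain ps \<Longrightarrow> length ps \<le> d"
  shows "\<exists>C. \<forall>n. card (walks n) \<le> C * Suc n ^ d"
proof -
  have "\<exists>C. \<forall>n. card (walks_from x n) \<le> C * Suc n ^ d" if "x \<in> E" for x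
    using walks_from_upper_bound[OF nsc that] d by (auto simp: chain_from_def)
  then obtain C where C: "\<And>x n. x \<in> E \<Longrightarrow> card (walks_from x n) \<le> C x * Suc n ^ d" by metis
  have "card (walks n) \<le> (1 + sum C E) * Suc n ^ d" for n
  proof -
    have "walks n = insert [] (\<Union>x\<in>E. walks_from x n)"
    proof (intro Set.set_eqI iffI)
      fix xs assume "xs \<in> walks n"
      then show "xs \<in> insert [] (\<Union>x\<in>E. walks_from x n)"
        by (cases xs) (auto simp: walks_from_def walks_def)
    qed (auto simp: walks_from_def walks_def)
    then have "card (walks n) \<le> 1 + card (\<Union>x\<in>E. walks_from x n)"
      by (simp add: card_insert_if finite_E finite_walks_from)
    also have "\<dots> \<le> 1 + (\<Sum>x\<in>E. card (walks_from x n))" using card_UN_le[OF finite_E] by simp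
    also have "\<dots> \<le> 1 + (\<Sum>x\<in>E. C x * Suc n ^ d)" using C by (intro add_left_mono sum_mono) auto
    also have "\<dots> = 1 + sum C E * Suc n ^ d" by (simp only: sum_distrib_right)
    also have "\<dots> \<le> (1 + sum C E) * Suc n ^ d" by simp
    finally show ?thesis .
  qed
  then show ?thesis by blast
qed

end

section \<open>The normal form basis\<close>

locale leavitt_data = finite_hypergraph H for H :: "('v, 'e) hypergraph" +
  fixes \<sigma> \<rho> :: "'e \<Rightarrow> 'v list"
  assumes listings: "listings H \<sigma> \<rho>"
begin

text \<open>
  Edges and ghost edges are exchanged by swapping the roles of source and range. The letter
  \<open>letter d h i j\<close> runs from index \<open>i\<close> on side \<open>d\<close> to index \<open>j\<close> on the other side, which merges
  relations (iii) and (iv) into one family.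
\<close>

definition side :: "bool \<Rightarrow> 'e \<Rightarrow> 'v list" where
  "side d h = (if d then \<rho> h else \<sigma> h)"

definition letter :: "bool \<Rightarrow> 'e \<Rightarrow> nat \<Rightarrow> nat \<Rightarrow> ('v, 'e) gen" where
  "letter d h i j = (if d then Ghost h j i else Edge h i j)"

text \<open>This is also meaningful for a vertex as first letter: its range is itself and it begins
  no forbidden word.\<close>

definition follows :: "('v, 'e) gen \<Rightarrow> ('v, 'e) gen \<Rightarrow> bool" where
  "follows x y \<longleftrightarrow> gen_rng \<sigma> \<rho> x = gen_src \<sigma> \<rho> y \<and> [x, y] \<notin> forbidden H \<sigma> \<rho>"

text \<open>
  A nod-path is stored with its initial vertex as first letter, so that paths of length zero need
  no separate treatment.
\<close>

definition nform :: "('v, 'e) gen list \<Rightarrow> bool" where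
  "nform w \<longleftrightarrow> w \<noteq> [] \<and> hd w \<in> Vertex ` verts H \<and> set (tl w) \<subseteq> edges H \<sigma> \<rho> \<and> successively follows w"

lemma side_notNil: assumes "h \<in> hedges H" shows "side d h \<noteq> []"
proof -
  have "mset (\<sigma> h) \<noteq> {#}" "mset (\<rho> h) \<noteq> {#}"
    using listings src_ne rng_ne assms by (auto simp: listings_def)
  then show ?thesis by (auto simp: side_def)
qed

lemma side_in_verts:
  assumes "h \<in> hedges H" "i < length (side d h)" shows "side d h ! i \<in> verts H"
proof -
  have "mset (\<sigma> h) = src H h" "mset (\<rho> h) = rng H h" using listings assms(1) by (auto simp: listings_def)
  then have "set (\<sigma> h) \<subseteq> verts H" "set (\<rho> h) \<subseteq> verts H"
    using src_sub[OF assms(1)] rng_sub[OF assms(1)] by (metis set_mset_mset)+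
  then show ?thesis using nth_mem[OF assms(2)] by (auto simp: side_def split: if_splits)
qed

lemma letter_src [simp]: "gen_src \<sigma> \<rho> (letter d h i j) = side d h ! i"
  and letter_rng [simp]: "gen_rng \<sigma> \<rho> (letter d h i j) = side (\<not> d) h ! j"
  by (auto simp: letter_def side_def)

lemma letter_eq_iff [simp]: "letter d h i j = letter d' h' i' j' \<longleftrightarrow> d = d' \<and> h = h' \<and> i = i' \<and> j = j'"
  by (auto simp: letter_def)

lemma letter_edges [simp]:
  "letter d h i j \<in> edges H \<sigma> \<rho> \<longleftrightarrow> h \<in> hedges H \<and> i < length (side d h) \<and> j < length (side (\<not> d) h)"
  by (auto simp: letter_def side_def edges_def)

lemma letter_neq_Vertex [simp]: "letter d h i j \<noteq> Vertex v" "Vertex v \<noteq> letter d h i j"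
  by (auto simp: letter_def)

lemma edgesE:
  assumes "x \<in> edges H \<sigma> \<rho>"
  obtains d h i j where "x = letter d h i j" "h \<in> hedges H" "i < length (side d h)" "j < length (side (\<not> d) h)"
proof -
  have "\<exists>d h i j. x = letter d h i j"
    using assms by (auto simp: edges_def letter_def intro: exI[of _ False] exI[of _ True])
  with assms that show thesis by auto
qed

lemma Vertex_notin_edges [simp]: "Vertex v \<notin> edges H \<sigma> \<rho>"
  by (auto simp: edges_def)

lemma forbidden_iff:
  "[x, y] \<in> forbidden H \<sigma> \<rho> \<longleftrightarrow> (\<exists>d h i j. h \<in> hedges H \<and> i < length (side d h) \<and> j < length (side d h)
     \<and> x = letter d h i 0 \<and> y = letter (\<not> d) h 0 j)"
proof
  assume "[x, y] \<in> forbidden H \<sigma> \<rho>"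
  then show "\<exists>d h i j. h \<in> hedges H \<and> i < length (side d h) \<and> j < length (side d h)
     \<and> x = letter d h i 0 \<and> y = letter (\<not> d) h 0 j"
  proof cases
    case (1 h i j)
    then show ?thesis by (intro exI[of _ False] exI[of _ h] exI[of _ i] exI[of _ j]) (simp add: side_def letter_def)
  next
    case (2 h i j)
    then show ?thesis by (intro exI[of _ True] exI[of _ h] exI[of _ i] exI[of _ j]) (simp add: side_def letter_def)
  qed
next
  assume "\<exists>d h i j. h \<in> hedges H \<and> i < length (side d h) \<and> j < length (side d h)
     \<and> x = letter d h i 0 \<and> y = letter (\<not> d) h 0 j"
  then show "[x, y] \<in> forbidden H \<sigma> \<rho>"
    by (auto simp: side_def letter_def split: if_splits intro: forbidden.intros)
qed

lemma forbidden_letter_iff: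
  "[x, letter d h i j] \<in> forbidden H \<sigma> \<rho> \<longleftrightarrow>
     h \<in> hedges H \<and> i = 0 \<and> j < length (side (\<not> d) h) \<and> (\<exists>m < length (side (\<not> d) h). x = letter (\<not> d) h m 0)"
proof
  assume "[x, letter d h i j] \<in> forbidden H \<sigma> \<rho>"
  then obtain d' h' m j' where *: "h' \<in> hedges H" "m < length (side d' h')" "j' < length (side d' h')"
    "x = letter d' h' m 0" "letter d h i j = letter (\<not> d') h' 0 j'"
    unfolding forbidden_iff by blast
  moreover have "d' = (\<not> d)" using *(5) by simp
  ultimately show "h \<in> hedges H \<and> i = 0 \<and> j < length (side (\<not> d) h)
      \<and> (\<exists>m < length (side (\<not> d) h). x = letter (\<not> d) h m 0)" by auto
next
  assume "h \<in> hedges H \<and> i = 0 \<and> j < length (side (\<not> d) h) \<and> (\<exists>m < length (side (\<not> d) h). x = letter (\<not> d) h m 0)"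
  then show "[x, letter d h i j] \<in> forbidden H \<sigma> \<rho>"
    unfolding forbidden_iff by (intro exI[of _ "\<not> d"] exI[of _ h]) auto
qed

lemma not_follows_letterE:
  assumes "\<not> follows x (letter d h i j)" "gen_rng \<sigma> \<rho> x = side d h ! i"
  obtains m where "x = letter (\<not> d) h m 0" "i = 0" "h \<in> hedges H" "m < length (side (\<not> d) h)"
    "j < length (side (\<not> d) h)"
  using assms by (auto simp: follows_def forbidden_letter_iff)

text \<open>The forbidden pattern and the source ignore the last index of the second letter. Hence
  the final letter of a normal word keeps its place when that index changes, which is why reduced
  words are again normal.\<close>

lemma follows_letter_iff:
  assumes "j < length (side (\<not> d) h)" "k < length (side (\<not> d) h)"
  shows "follows x (letter d h i j) \<longleftrightarrow> follows x (letter d h i k)"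
  using assms by (simp add: follows_def forbidden_letter_iff)

text \<open>Exactly one summand of each relation (iii) or (iv) is forbidden, so the relation can be
  read as a rewriting rule for it.\<close>

lemma follows_letters:
  assumes "h \<in> hedges H" "i < length (side d h)" "j < length (side d h)"
  shows "follows (letter d h i k) (letter (\<not> d) h k j) \<longleftrightarrow> k \<noteq> 0"
  using assms by (auto simp: follows_def forbidden_letter_iff)

lemma nform_Vertex: "nform [Vertex v] \<longleftrightarrow> v \<in> verts H"
  by (auto simp: nform_def)

lemma nform_snoc:
  "w \<noteq> [] \<Longrightarrow> nform (w @ [x]) \<longleftrightarrow> nform w \<and> x \<in> edges H \<sigma> \<rho> \<and> follows (last w) x"
  by (auto simp: nform_def successively_append_iff)

lemma nform_prefix: "nform (w @ xs) \<Longrightarrow> w \<noteq> [] \<Longrightarrow> nform w"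
  by (auto simp: nform_def successively_append_iff)

lemma nform_snocE:
  assumes "nform w" "last w = letter d h i j"
  obtains u where "w = u @ [letter d h i j]" "u \<noteq> []" "nform u"
    "h \<in> hedges H" "i < length (side d h)" "j < length (side (\<not> d) h)" "follows (last u) (letter d h i j)"
proof -
  have ne: "w \<noteq> []" using assms by (simp add: nform_def)
  have w: "w = butlast w @ [letter d h i j]" using append_butlast_last_id[OF ne] assms(2) by simp
  have b: "butlast w \<noteq> []"
  proof
    assume "butlast w = []"
    then have "w = [letter d h i j]" using w by simp
    then show False using assms(1) by (auto simp: nform_def)
  qed
  show thesis using that[OF w b] nform_snoc[OF b, of "letter d h i j"] w assms(1) by simp
qed

subsection \<open>The dual action\<close>

text \<open>
  Right multiplication by a letter, followed by one reduction step, maps normal words to linear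
  combinations of normal words. The transposed operators act on arbitrary functions on normal words.
\<close>

fun reduct :: "('v, 'e) gen \<Rightarrow> ('v, 'e) gen \<Rightarrow> (('v, 'e) gen list \<Rightarrow> 'k) \<Rightarrow> ('v, 'e) gen list \<Rightarrow> 'k::field" where
  "reduct (Edge h i _) (Ghost _ j _) f u =
     (if i = j then f u else 0) - (\<Sum>k=1..<length (\<rho> h). f (u @ [Edge h i k, Ghost h j k]))"
| "reduct (Ghost h _ i) (Edge _ _ j) f u =
     (if i = j then f u else 0) - (\<Sum>k=1..<length (\<sigma> h). f (u @ [Ghost h k i, Edge h k j]))"
| "reduct _ _ _ _ = 0"

text \<open>The last branch is reached only by composable pairs that fail \<open>follows\<close>,
  that is, by forbidden pairs. Both letters then belong to the same hyperedge, and
  \<open>reduct\<close> reads it from the first letter.\<close>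

definition act :: "('v, 'e) gen \<Rightarrow> (('v, 'e) gen list \<Rightarrow> 'k) \<Rightarrow> ('v, 'e) gen list \<Rightarrow> 'k::field" where
  "act x f w =
    (if \<not> nform w \<or> gen_rng \<sigma> \<rho> (last w) \<noteq> gen_src \<sigma> \<rho> x then 0
     else if x \<in> Vertex ` verts H then f w
     else if x \<notin> edges H \<sigma> \<rho> then 0
     else if follows (last w) x then f (w @ [x])
     else reduct (last w) x f (butlast w))"

text \<open>Transposition reverses right multiplication, so the first letter ends up outermost: the
  value at \<open>w\<close> is \<open>f\<close> extended linearly to the reduced product of
  \<open>w\<close> with the word.\<close>

definition act_word :: "('v, 'e) gen list \<Rightarrow> (('v, 'e) gen list \<Rightarrow> 'k) \<Rightarrow> ('v, 'e) gen list \<Rightarrow> 'k::field" where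
  "act_word = foldr act"

lemma act_word_simps [simp]:
  "act_word [] f = f" "act_word (x # xs) f = act x (act_word xs f)"
  "act_word (xs @ ys) f = act_word xs (act_word ys f)"
  by (simp_all add: act_word_def)

lemma reduct_letter: "reduct (letter d h i l) (letter (\<not> d) h m j) f u =
    (if i = j then f u else 0) - (\<Sum>k=1..<length (side (\<not> d) h). f (u @ [letter d h i k, letter (\<not> d) h k j]))"
  by (simp add: letter_def side_def)

lemma act_Vertex: "v \<in> verts H \<Longrightarrow> act (Vertex v) f w = (if nform w \<and> gen_rng \<sigma> \<rho> (last w) = v then f w else 0)"
  by (auto simp: act_def)

lemma act_not_nform: "\<not> nform w \<or> gen_rng \<sigma> \<rho> (last w) \<noteq> gen_src \<sigma> \<rho> x \<Longrightarrow> act x f w = 0"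
  by (auto simp: act_def)

lemma act_follows:
  assumes "nform w" "x \<in> edges H \<sigma> \<rho>" "follows (last w) x"
  shows "act x f w = f (w @ [x])"
  using assms by (auto simp: act_def follows_def)

lemma act_forbidden:
  assumes "nform (u @ [letter d h i 0])" "u \<noteq> []" "j < length (side d h)"
  shows "act (letter (\<not> d) h 0 j) f (u @ [letter d h i 0]) =
    (if i = j then f u else 0) - (\<Sum>k=1..<length (side (\<not> d) h). f (u @ [letter d h i k, letter (\<not> d) h k j]))"
proof -
  have *: "h \<in> hedges H" "i < length (side d h)" "0 < length (side (\<not> d) h)"
    using assms by (auto simp: nform_snoc)
  then have "\<not> follows (letter d h i 0) (letter (\<not> d) h 0 j)"
    using assms(3) follows_letters[of h i d j 0] by simp
  then show ?thesis using assms * by (auto simp: act_def reduct_letter)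
qed

text \<open>The reduction of the summand \<open>k = 0\<close> contains the negatives of all other
  summands; only the Kronecker term survives.\<close>

lemma sum_act_letters:
  assumes u: "nform u" "u \<noteq> []" and h: "h \<in> hedges H" "i < length (side d h)" "j < length (side d h)"
    and fl: "follows (last u) (letter d h i 0)"
  shows "(\<Sum>k<length (side (\<not> d) h). act (letter (\<not> d) h k j) f (u @ [letter d h i k])) = (if i = j then f u else 0)"
proof -
  let ?n = "length (side (\<not> d) h)"
  have n: "0 < ?n" using side_notNil[OF h(1)] by simp
  have nrm: "nform (u @ [letter d h i k])" if "k < ?n" for k
    using that u h fl follows_letter_iff[OF that n] by (simp add: nform_snoc)
  have "act (letter (\<not> d) h k j) f (u @ [letter d h i k]) = f (u @ [letter d h i k, letter (\<not> d) h k j])"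
    if "k \<in> {1..<?n}" for k
    using that nrm[of k] h follows_letters[of h i d j k] by (subst act_follows) auto
  then have "(\<Sum>k=1..<?n. act (letter (\<not> d) h k j) f (u @ [letter d h i k]))
      = (\<Sum>k=1..<?n. f (u @ [letter d h i k, letter (\<not> d) h k j]))" by (intro sum.cong) auto
  moreover have "{..<?n} = insert 0 {1..<?n}" using n by auto
  ultimately show ?thesis using act_forbidden[OF nrm[OF n] u(2) h(3), of f] by simp
qed

text \<open>The operators satisfy (iii) and (iv). If \<open>letter d h i 0\<close> may follow
  \<open>w\<close>, this is \<open>sum_act_letters\<close>. Otherwise \<open>w\<close> ends in
  \<open>letter (\<not> d) h m 0\<close> and \<open>i = 0\<close>: two forbidden words overlap, and
  reducing the left one first must give the same result.\<close>

lemma act_relation: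
  assumes h: "h \<in> hedges H" "i < length (side d h)" "j < length (side d h)"
  shows "(\<Sum>k<length (side (\<not> d) h). act (letter d h i k) (act (letter (\<not> d) h k j) f) w)
    = (if i = j then act (Vertex (side d h ! i)) f w else 0)"
proof (cases "nform w \<and> gen_rng \<sigma> \<rho> (last w) = side d h ! i")
  case False
  then show ?thesis by (auto simp: act_not_nform)
next
  case True
  let ?n = "length (side (\<not> d) h)"
  have n: "0 < ?n" using side_notNil[OF h(1)] by simp
  have w: "w \<noteq> []" using True by (simp add: nform_def)
  have V: "act (Vertex (side d h ! i)) f w = f w" using True side_in_verts[OF h(1,2)] by (simp add: act_Vertex)
  show ?thesis
  proof (cases "follows (last w) (letter d h i 0)")
    case fl: True
    have "act (letter d h i k) (act (letter (\<not> d) h k j) f) w = act (letter (\<not> d) h k j) f (w @ [letter d h i k])"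
      if "k < ?n" for k
      using that True fl h follows_letter_iff[OF that n] by (intro act_follows) auto
    then have "(\<Sum>k<?n. act (letter d h i k) (act (letter (\<not> d) h k j) f) w)
        = (\<Sum>k<?n. act (letter (\<not> d) h k j) f (w @ [letter d h i k]))" by simp
    also have "\<dots> = (if i = j then f w else 0)"
      using True by (intro sum_act_letters[OF _ w h fl]) simp
    finally show ?thesis by (simp only: V)
  next
    case False
    then obtain m where m: "last w = letter (\<not> d) h m 0" "i = 0" "m < ?n"
      using not_follows_letterE[OF False] True by metis
    obtain u where u: "w = u @ [letter (\<not> d) h m 0]" "u \<noteq> []" "nform u" "follows (last u) (letter (\<not> d) h m 0)"
      using nform_snocE[OF _ m(1)] True by metis
    have d0: "0 < length (side d h)" using h by auto
    have nu: "nform (u @ [letter (\<not> d) h m l])" if "l < length (side d h)" for l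
      using u m h that d0 follows_letter_iff[of l "\<not> d" h 0 "last u" m] by (simp add: nform_snoc)
    \<comment> \<open>The left pair is forbidden for every \<open>k\<close>. After summation over
      \<open>k\<close>, its Kronecker term gives the word ending in
      \<open>letter (\<not> d) h m j\<close>, while for fixed \<open>l\<close> the inner sum is
      again of the shape of \<open>sum_act_letters\<close>.\<close>
    have step: "act (letter d h i k) g w = (if m = k then g u else 0)
        - (\<Sum>l=1..<length (side d h). g (u @ [letter (\<not> d) h m l, letter d h l k]))" if "k < ?n" for k g
      using act_forbidden[of u "\<not> d" h m k g] nu[OF d0] u that by (simp add: m(2))
    have "(\<Sum>k<?n. act (letter d h i k) (act (letter (\<not> d) h k j) f) w)
      = (\<Sum>k<?n. if m = k then act (letter (\<not> d) h k j) f u else 0)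
        - (\<Sum>l=1..<length (side d h). \<Sum>k<?n. act (letter (\<not> d) h k j) f ((u @ [letter (\<not> d) h m l]) @ [letter d h l k]))"
      by (subst sum.swap) (simp add: step sum_subtractf)
    also have "(\<Sum>k<?n. if m = k then act (letter (\<not> d) h k j) f u else 0) = f (u @ [letter (\<not> d) h m j])"
      using m(3) nu[OF h(3)] u h(1,3) by (simp add: act_follows nform_snoc)
    also have "(\<Sum>l=1..<length (side d h). \<Sum>k<?n. act (letter (\<not> d) h k j) f ((u @ [letter (\<not> d) h m l]) @ [letter d h l k]))
      = (\<Sum>l=1..<length (side d h). if l = j then f (u @ [letter (\<not> d) h m l]) else 0)"
    proof (rule sum.cong[OF refl])
      fix l assume l: "l \<in> {1..<length (side d h)}"
      show "(\<Sum>k<?n. act (letter (\<not> d) h k j) f ((u @ [letter (\<not> d) h m l]) @ [letter d h l k]))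
          = (if l = j then f (u @ [letter (\<not> d) h m l]) else 0)"
        using l h m nu[of l] n follows_letters[of h m "\<not> d" 0 l]
        by (intro sum_act_letters) auto
    qed
    \<comment> \<open>The index \<open>l\<close> starts at \<open>1\<close>, so nothing is cancelled
      exactly when \<open>j = 0\<close>; the surviving word is then \<open>w\<close> itself, in
      agreement with \<open>i = 0\<close>.\<close>
    also have "\<dots> = (if j = 0 then 0 else f (u @ [letter (\<not> d) h m j]))"
      using h(3) by (auto simp: sum.delta)
    finally show ?thesis using V m(2) u(1) by simp
  qed
qed

lemma act_src:
  assumes "x \<in> edges H \<sigma> \<rho>" shows "act (Vertex (gen_src \<sigma> \<rho> x)) (act x f) = act x f"
proof
  fix w
  have "gen_src \<sigma> \<rho> x \<in> verts H" using assms by (auto elim!: edgesE simp: side_in_verts)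
  then show "act (Vertex (gen_src \<sigma> \<rho> x)) (act x f) w = act x f w"
    by (auto simp: act_Vertex act_not_nform)
qed

text \<open>All words produced by a reduction end where \<open>x\<close> ends: the longer ones end
  in a letter with that range, and the shortened word \<open>u\<close> occurs only for
  \<open>i = j\<close>, when its range is the same vertex.\<close>

lemma act_rng:
  assumes x: "x \<in> edges H \<sigma> \<rho>" shows "act x (act (Vertex (gen_rng \<sigma> \<rho> x)) f) = act x f"
proof
  fix w
  have v: "gen_rng \<sigma> \<rho> x \<in> verts H" using assms by (auto elim!: edgesE simp: side_in_verts)
  show "act x (act (Vertex (gen_rng \<sigma> \<rho> x)) f) w = act x f w"
  proof (cases "nform w \<and> gen_rng \<sigma> \<rho> (last w) = gen_src \<sigma> \<rho> x")
    case False
    then show ?thesis by (auto simp: act_not_nform)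
  next
    case True
    then have ne: "w \<noteq> []" by (simp add: nform_def)
    show ?thesis
    proof (cases "follows (last w) x")
      case fl: True
      then show ?thesis using True v x ne by (simp add: act_follows act_Vertex nform_snoc)
    next
      case False
      then obtain d h i j where xy: "last w = letter d h i 0" "x = letter (\<not> d) h 0 j"
        "h \<in> hedges H" "i < length (side d h)" "j < length (side d h)"
        using True by (auto simp: follows_def forbidden_iff)
      obtain u where u: "w = u @ [letter d h i 0]" "u \<noteq> []" "nform u" "follows (last u) (letter d h i 0)"
        "0 < length (side (\<not> d) h)"
        using nform_snocE[OF _ xy(1)] True by metis
      have nrm: "nform (u @ [letter d h i k, letter (\<not> d) h k j])" if "k \<in> {1..<length (side (\<not> d) h)}" for k
      proof -
        have "nform (u @ [letter d h i k])"
          using u xy that follows_letter_iff[of k d h 0 "last u" i] by (simp add: nform_snoc)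
        moreover have "follows (letter d h i k) (letter (\<not> d) h k j)"
          using xy that follows_letters[of h i d j k] by simp
        ultimately have "nform ((u @ [letter d h i k]) @ [letter (\<not> d) h k j])"
          using xy that by (subst nform_snoc) auto
        then show ?thesis by simp
      qed
      have "gen_rng \<sigma> \<rho> (last u) = side d h ! i" using u by (simp add: follows_def)
      then show ?thesis
        using True v u xy act_forbidden[of u d h i j f]
          act_forbidden[of u d h i j "act (Vertex (side d h ! j)) f"] nrm by (simp add: act_Vertex)
    qed
  qed
qed

lemma act_Vertex_Vertex:
  assumes "u \<in> verts H" "v \<in> verts H"
  shows "act (Vertex u) (act (Vertex v) f) w = (if u = v then act (Vertex u) f w else 0)"
  using assms by (auto simp: act_Vertex)

lemma act_nform:
  assumes "nform (w @ xs)" "w \<noteq> []" shows "act_word xs f w = f (w @ xs)"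
  using assms
proof (induction xs arbitrary: w)
  case (Cons x xs)
  have "nform ((w @ [x]) @ xs)" using Cons.prems by simp
  then have "nform (w @ [x])" by (rule nform_prefix) simp
  then have "act x (act_word xs f) w = act_word xs f (w @ [x])"
    using Cons.prems(2) by (intro act_follows) (auto simp: nform_snoc)
  then show ?case using Cons.IH[of "w @ [x]"] Cons.prems by simp
qed simp

section \<open>Linear extension to the free algebra, and linear independence\<close>

lemma act_linear:
  "act x (\<lambda>w. \<Sum>l\<in>S. c l * f l w) w = (\<Sum>l\<in>S. c l * act x (f l) w)"
proof -
  have red: "reduct y x (\<lambda>w. \<Sum>l\<in>S. c l * f l w) u = (\<Sum>l\<in>S. c l * reduct y x (f l) u)" for y u
    \<comment> \<open>The third entry merely supplies a function of the right type; the distinction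
      is on the two letters.\<close>
    by (cases "(y, x, f undefined, u)" rule: reduct.cases)
      (auto simp: sum_subtractf right_diff_distrib sum_distrib_left intro: sum.swap)
  show ?thesis by (auto simp: act_def red)
qed

lemma act_word_linear:
  "act_word xs (\<lambda>w. \<Sum>l\<in>S. c l * f l w) = (\<lambda>w. \<Sum>l\<in>S. c l * act_word xs (f l) w)"
  by (induction xs) (auto simp: act_linear)

lemma act_word_0: "act_word xs (\<lambda>_. 0) w = (0 :: 'k::field)"
  using act_word_linear[where S = "{}" and xs = xs and f = "\<lambda>_ _. 0 :: 'k"] by (simp add: fun_eq_iff)

definition eval :: "(('v, 'e) gen list \<Rightarrow>\<^sub>0 'k) \<Rightarrow> (('v, 'e) gen list \<Rightarrow> 'k) \<Rightarrow> ('v, 'e) gen list \<Rightarrow> 'k::field" where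
  "eval p f w = (\<Sum>k\<in>Poly_Mapping.keys p. Poly_Mapping.lookup p k * act_word k f w)"

lemma eval_superset:
  assumes "finite S" "Poly_Mapping.keys p \<subseteq> S"
  shows "eval p f w = (\<Sum>k\<in>S. Poly_Mapping.lookup p k * act_word k f w)"
  unfolding eval_def by (rule sum.mono_neutral_left[OF assms]) (auto simp: in_keys_iff)

lemma eval_add: "eval (p + q) f w = eval p f w + eval q f w"
proof -
  let ?S = "Poly_Mapping.keys p \<union> Poly_Mapping.keys q"
  show ?thesis using Poly_Mapping.keys_add[of p q]
    by (simp add: eval_superset[of ?S] lookup_add distrib_right sum.distrib)
qed

lemma eval_0: "eval 0 f w = 0"
  by (simp add: eval_def)

lemma eval_single: "eval (Poly_Mapping.single k c) f w = c * act_word k f w"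
  by (simp add: eval_superset[of "{k}"] lookup_single)

lemma eval_scale: "eval (scale c p) f w = c * eval p f w"
proof -
  have "Poly_Mapping.keys (scale c p) \<subseteq> Poly_Mapping.keys p" by (auto simp: in_keys_iff lookup_scale)
  then show ?thesis
    by (simp add: eval_superset[of "Poly_Mapping.keys p"] lookup_scale sum_distrib_left mult.assoc)
qed

lemma eval_diff: "eval (p - q) f w = eval p f w - eval q f w"
  using eval_add[of "p - q" q f w] by simp

lemma eval_sum: "eval (sum g S) f w = (\<Sum>s\<in>S. eval (g s) f w)"
  by (induction S rule: infinite_finite_induct) (auto simp: eval_add eval_0)

lemma poly_mapping_sum_single:
  "p = (\<Sum>k\<in>Poly_Mapping.keys p. Poly_Mapping.single k (Poly_Mapping.lookup p k))"
  by (rule poly_mapping_eqI) (simp add: lookup_sum lookup_single when_def in_keys_iff)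

lemma eval_mult: "eval (p * q) f w = eval p (eval q f) w"
proof -
  have "p * q = (\<Sum>k\<in>Poly_Mapping.keys p. \<Sum>l\<in>Poly_Mapping.keys q.
      Poly_Mapping.single (k @ l) (Poly_Mapping.lookup p k * Poly_Mapping.lookup q l))"
  proof -
    have "p * q = (\<Sum>k\<in>Poly_Mapping.keys p. Poly_Mapping.single k (Poly_Mapping.lookup p k))
        * (\<Sum>l\<in>Poly_Mapping.keys q. Poly_Mapping.single l (Poly_Mapping.lookup q l))"
      by (simp only: poly_mapping_sum_single[symmetric])
    then show ?thesis by (simp only: sum_product mult_single plus_list_def)
  qed
  moreover have "eval q f = (\<lambda>w. \<Sum>k\<in>Poly_Mapping.keys q. Poly_Mapping.lookup q k * act_word k f w)"
    by (simp add: eval_def fun_eq_iff)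
  ultimately show ?thesis
    by (simp add: eval_sum eval_single eval_def[of p] act_word_linear sum_distrib_left mult.assoc)
qed

abbreviation "X \<equiv> generators H \<sigma> \<rho>"
abbreviation rels :: "(('v, 'e) gen list \<Rightarrow>\<^sub>0 'k::field) set" where "rels \<equiv> leavitt_relators H \<sigma> \<rho>"
abbreviation rel_ideal :: "(('v, 'e) gen list \<Rightarrow>\<^sub>0 'k::field) set" where "rel_ideal \<equiv> algebra_ideal X rels"

lemma eval_relator:
  assumes "p \<in> rels" shows "eval p f w = 0"
  using assms
proof cases
  case (vertices u v)
  then show ?thesis by (simp add: eval_diff eval_single eval_0 act_Vertex_Vertex)
next
  case (source_edge h i j)
  then show ?thesis using act_src[of "Edge h i j" f] by (simp add: eval_diff eval_single edges_def)
next
  case (edge_range h i j)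
  then show ?thesis using act_rng[of "Edge h i j" f] by (simp add: eval_diff eval_single edges_def)
next
  case (range_ghost h i j)
  then show ?thesis using act_src[of "Ghost h i j" f] by (simp add: eval_diff eval_single edges_def)
next
  case (ghost_source h i j)
  then show ?thesis using act_rng[of "Ghost h i j" f] by (simp add: eval_diff eval_single edges_def)
next
  case (edge_ghost h i j)
  then show ?thesis using act_relation[of h i False j f w]
    by (simp add: eval_diff eval_single eval_sum eval_0 letter_def side_def)
next
  case (ghost_edge h i j)
  then show ?thesis using act_relation[of h i True j f w]
    by (simp add: eval_diff eval_single eval_sum eval_0 letter_def side_def)
qed

text \<open>By \<open>eval_mult\<close> the free algebra acts on functions, and elements acting as
  zero are closed under multiplication from both sides; the left factor is then applied to the zero
  function.\<close>

lemma eval_ideal: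
  assumes "p \<in> rel_ideal" shows "eval p f w = 0"
  using assms
proof (induction arbitrary: f w)
  case (left a p)
  have "eval p f = (\<lambda>_. 0)" using left by auto
  then show ?case by (simp add: eval_mult eval_def[of a] act_word_0)
next
  case (right p a)
  then show ?case by (simp add: eval_mult)
qed (auto simp: eval_0 eval_relator eval_add eval_scale)

text \<open>Evaluate at the initial vertex of \<open>s\<close> with the indicator function of
  \<open>s\<close>. The first letter of a normal word acts as a projection that removes other
  initial vertices, and the rest acts without any reduction, so only the coefficient of
  \<open>s\<close> remains.\<close>

lemma nform_independent:
  fixes c :: "('v, 'e) gen list \<Rightarrow> 'k::field"
  assumes "finite T" "\<And>w. w \<in> T \<Longrightarrow> nform w"
    and "(\<Sum>w\<in>T. Poly_Mapping.single w (c w)) \<in> rel_ideal" and "s \<in> T"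
  shows "c s = 0"
proof -
  obtain v xs where s: "s = Vertex v # xs" "v \<in> verts H"
    using assms(2)[OF assms(4)] by (cases s) (auto simp: nform_def)
  define f where "f w = (if w = s then 1 else 0 :: 'k)" for w
  have "act_word w f [Vertex v] = (if w = s then 1 else 0)" if wT: "w \<in> T" for w
  proof -
    obtain u ys where w: "w = Vertex u # ys" "u \<in> verts H"
      using assms(2)[OF wT] by (cases w) (auto simp: nform_def)
    have "act_word w f [Vertex v] = (if u = v then act_word ys f [Vertex v] else 0)"
      using w s by (auto simp: act_Vertex nform_Vertex)
    also have "\<dots> = (if u = v then f (Vertex v # ys) else 0)"
      using act_nform[of "[Vertex v]" ys f] assms(2)[OF wT] w by (cases "u = v") simp_all
    finally show ?thesis using s w by (auto simp: f_def)
  qed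
  then have "eval (\<Sum>w\<in>T. Poly_Mapping.single w (c w)) f [Vertex v] = (\<Sum>w\<in>T. if w = s then c w else 0)"
    by (auto simp: eval_sum eval_single intro!: sum.cong)
  then show ?thesis using eval_ideal[OF assms(3)] assms(1,4) by simp
qed

end

section \<open>Growth with respect to a generating subspace\<close>

text \<open>Independent subsets of the subspace stay independent in the whole space, so exchange
  bounds their size by \<open>card S\<close>; a maximal one is a basis. Finite-dimensionality is
  part of the claim because \<open>dim\<close> is informative only with it.\<close>

lemma (in vectorspace) subspace_of_span_dim:
  assumes U: "submodule K U V" "U \<subseteq> span S" and S: "finite S" "S \<subseteq> carrier V"
  shows "vectorspace.fin_dim K (vs U)" and "vectorspace.dim K (vs U) \<le> card S"
proof -
  have "VectorSpace.subspace K U V" using U(1) by (simp add: VectorSpace.subspace_def vectorspace_axioms)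
  then interpret U: vectorspace K "vs U" by (rule subspace_is_vs)
  have finite_bound: "card T \<le> card S" if T: "T \<subseteq> U" "U.lin_indpt T" "finite T" for T
  proof -
    have "lin_indpt T" using T span_li_not_depend(2)[OF T(1) U(1)] by simp
    then show ?thesis using replacement[OF T(3) S(1) S(2)] T(1) U(2) by force
  qed
  have bound: "finite T \<and> card T \<le> card S" if T: "T \<subseteq> U \<and> U.lin_indpt T" for T
  proof (cases "finite T")
    case False
    \<comment> \<open>An infinite independent set would contain a finite one that is too large by
      one.\<close>
    then obtain T' where T': "T' \<subseteq> T" "finite T'" "card T' = Suc (card S)"
      by (meson infinite_arbitrarily_large)
    then show ?thesis using finite_bound[of T'] U.subset_li_is_li[of T T'] T by auto
  qed (use finite_bound T in auto)
  have "U.lin_indpt {}" by (simp add: U.lin_dep_def)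
  then obtain B where B: "finite B" "maximal B (\<lambda>T. T \<subseteq> carrier (vs U) \<and> U.lin_indpt T)"
    using maximal_exists[of "\<lambda>T. T \<subseteq> carrier (vs U) \<and> U.lin_indpt T" "card S" "{}"] bound by auto
  have b: "U.basis B" using U.max_li_is_basis[OF B(2)] .
  then show "U.fin_dim" using B(1) by (auto simp: U.fin_dim_def U.basis_def)
  show "U.dim \<le> card S" using U.dim_basis[OF B(1) b] finite_bound[of B] b B(1) by (auto simp: U.basis_def)
qed

lemma (in vectorspace) card_le_subspace_dim:
  assumes U: "submodule K U V" "vectorspace.fin_dim K (vs U)" and T: "T \<subseteq> U" "lin_indpt T"
  shows "card T \<le> vectorspace.dim K (vs U)"
proof -
  have "VectorSpace.subspace K U V" using U(1) by (simp add: VectorSpace.subspace_def vectorspace_axioms)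
  then interpret U: vectorspace K "vs U" by (rule subspace_is_vs)
  show ?thesis using U.li_le_dim(2)[OF U(2)] T span_li_not_depend(2)[OF T(1) U(1)] by simp
qed

context nonunital_algebra
begin

lemma smult_0: "x \<in> carrier A \<Longrightarrow> (0 :: 'k) \<odot> x = \<zero>"
  using smult_l_null[of x] by (simp add: class_ring_simps)

lemma zero_mult: assumes "x \<in> carrier A" shows "\<zero> \<otimes> x = \<zero>" "x \<otimes> \<zero> = \<zero>"
proof -
  have "\<zero> \<otimes> x = (0 \<odot> \<zero>) \<otimes> x" by (simp add: smult_0)
  also have "\<dots> = 0 \<odot> (\<zero> \<otimes> x)" using assms by (intro smult_mult) auto
  also have "\<dots> = \<zero>" using mult_closed[OF _ assms, of \<zero>] by (simp add: smult_0)
  finally show "\<zero> \<otimes> x = \<zero>" .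
  have "x \<otimes> \<zero> = x \<otimes> (0 \<odot> \<zero>)" by (simp add: smult_0)
  also have "\<dots> = 0 \<odot> (x \<otimes> \<zero>)" using assms by (intro mult_smult) auto
  also have "\<dots> = \<zero>" using mult_closed[OF assms, of \<zero>] by (simp add: smult_0)
  finally show "x \<otimes> \<zero> = \<zero>" .
qed

lemma submoduleI:
  assumes "N \<subseteq> carrier A" "\<zero> \<in> N" "\<And>x y. x \<in> N \<Longrightarrow> y \<in> N \<Longrightarrow> x \<oplus> y \<in> N"
    "\<And>c x. x \<in> N \<Longrightarrow> c \<odot> x \<in> N"
  shows "submodule class_ring N A"
  using assms by (intro submodule.intro) (auto intro: module_axioms)

text \<open>Bilinearity in two rounds: for fixed \<open>t\<close> the admissible left factors form a
  submodule that contains \<open>S\<close>, and for fixed \<open>x\<close> in the span the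
  admissible right factors form one that contains \<open>T\<close>.\<close>

lemma span_mult:
  assumes N: "submodule class_ring N A" and S: "S \<subseteq> carrier A" and T: "T \<subseteq> carrier A"
    and ST: "\<And>s t. s \<in> S \<Longrightarrow> t \<in> T \<Longrightarrow> s \<otimes> t \<in> N"
    and x: "x \<in> span S" and y: "y \<in> span T"
  shows "x \<otimes> y \<in> N"
proof -
  interpret N: submodule "class_ring :: 'k ring" N A by (rule N)
  have xS: "x \<in> carrier A" using span_is_subset2[OF S] x by auto
  have xt: "x \<otimes> t \<in> N" if t: "t \<in> T" for t
  proof -
    have tA: "t \<in> carrier A" using t T by auto
    have "submodule class_ring {x \<in> carrier A. x \<otimes> t \<in> N} A"
      using tA by (intro submoduleI) (auto simp: zero_mult add_mult smult_mult)
    then have "span S \<subseteq> {x \<in> carrier A. x \<otimes> t \<in> N}"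
      by (rule span_is_subset[rotated]) (use S ST t in auto)
    with x show ?thesis by auto
  qed
  have "submodule class_ring {y \<in> carrier A. x \<otimes> y \<in> N} A"
    using xS by (intro submoduleI) (auto simp: zero_mult mult_add mult_smult)
  then have "span T \<subseteq> {y \<in> carrier A. x \<otimes> y \<in> N}"
    by (rule span_is_subset[rotated]) (use T xt in auto)
  with y show ?thesis by auto
qed

lemma foldl_mult_closed: "v \<in> carrier A \<Longrightarrow> set ys \<subseteq> carrier A \<Longrightarrow> foldl (\<otimes>) v ys \<in> carrier A"
  by (induction ys arbitrary: v) (auto simp: mult_closed)

lemma foldl_mult_append:
  assumes "v \<in> carrier A" "set ys \<subseteq> carrier A" "w \<in> carrier A" "set ws \<subseteq> carrier A"
  shows "foldl (\<otimes>) v ys \<otimes> foldl (\<otimes>) w ws = foldl (\<otimes>) v (ys @ w # ws)"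
  using assms(4)
proof (induction ws rule: rev_induct)
  case (snoc z ws)
  have "foldl (\<otimes>) v ys \<otimes> foldl (\<otimes>) w (ws @ [z]) = (foldl (\<otimes>) v ys \<otimes> foldl (\<otimes>) w ws) \<otimes> z"
    using assms snoc.prems by (simp add: mult_assoc foldl_mult_closed)
  then show ?case using snoc by simp
qed simp

lemma power_space_submodule:
  assumes "V \<subseteq> carrier A" shows "submodule class_ring (power_space A V n) A"
  unfolding power_space_def using assms by (intro span_is_submodule) (auto intro!: foldl_mult_closed)

lemma power_space_mono: "m \<le> n \<Longrightarrow> power_space A V m \<subseteq> power_space A V n"
  unfolding power_space_def by (intro span_is_monotone) fastforce

lemma power_space_base:
  assumes "V \<subseteq> carrier A" shows "V \<subseteq> power_space A V 1"
proof
  fix v assume v: "v \<in> V"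
  let ?G = "{foldl (\<otimes>) v ys | v ys. v \<in> V \<and> set ys \<subseteq> V \<and> Suc (length ys) \<le> 1}"
  have "?G \<subseteq> span ?G" by (rule in_own_span) (use assms in \<open>auto intro!: foldl_mult_closed\<close>)
  moreover have "v \<in> ?G" using v by (intro CollectI exI[of _ v] exI[of _ "[]"]) simp
  ultimately show "v \<in> power_space A V 1" unfolding power_space_def by blast
qed

lemma power_space_mult:
  assumes V: "V \<subseteq> carrier A" and x: "x \<in> power_space A V m" and y: "y \<in> power_space A V n"
  shows "x \<otimes> y \<in> power_space A V (m + n)"
proof (rule span_mult[OF power_space_submodule[OF V] _ _ _ x[unfolded power_space_def] y[unfolded power_space_def]])
  fix s t
  assume "s \<in> {foldl (\<otimes>) v ys | v ys. v \<in> V \<and> set ys \<subseteq> V \<and> Suc (length ys) \<le> m}"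
    and "t \<in> {foldl (\<otimes>) v ys | v ys. v \<in> V \<and> set ys \<subseteq> V \<and> Suc (length ys) \<le> n}"
  then obtain v ys w ws where *: "s = foldl (\<otimes>) v ys" "v \<in> V" "set ys \<subseteq> V" "Suc (length ys) \<le> m"
    "t = foldl (\<otimes>) w ws" "w \<in> V" "set ws \<subseteq> V" "Suc (length ws) \<le> n" by blast
  let ?G = "{foldl (\<otimes>) v ys | v ys. v \<in> V \<and> set ys \<subseteq> V \<and> Suc (length ys) \<le> m + n}"
  have "s \<otimes> t = foldl (\<otimes>) v (ys @ w # ws)" using * V by (simp add: foldl_mult_append subset_eq)
  then have "s \<otimes> t \<in> ?G" using * by (intro CollectI exI[of _ v] exI[of _ "ys @ w # ws"]) simp
  moreover have "?G \<subseteq> span ?G" by (rule in_own_span) (use V in \<open>auto intro!: foldl_mult_closed\<close>)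
  ultimately show "s \<otimes> t \<in> power_space A V (m + n)" unfolding power_space_def by blast
qed (use V in \<open>auto intro!: foldl_mult_closed\<close>)

lemma generating_subspaceD:
  assumes "generating_subspace A V"
  shows "V \<subseteq> carrier A" "submodule class_ring V A" "vectorspace.fin_dim class_ring (A\<lparr>carrier := V\<rparr>)"
proof -
  show sub: "submodule class_ring V A" and "vectorspace.fin_dim class_ring (A\<lparr>carrier := V\<rparr>)"
    using assms by (auto simp: generating_subspace_def VectorSpace.subspace_def)
  show "V \<subseteq> carrier A" by (rule submodule.subset[OF sub])
qed

text \<open>The union of the increasing power spaces is a subalgebra containing \<open>V\<close>,
  hence everything.\<close>

lemma generating_subspace_Union:
  assumes "generating_subspace A V" and x: "x \<in> carrier A"
  shows "\<exists>n. x \<in> power_space A V n"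
proof -
  note V = generating_subspaceD[OF assms(1)]
  note P = power_space_submodule[OF V(1)]
  let ?B = "\<Union>n. power_space A V n"
  have up: "x \<in> power_space A V (max m n)" "y \<in> power_space A V (max m n)"
    if "x \<in> power_space A V m" "y \<in> power_space A V n" for x y m n
    using that power_space_mono[of m "max m n"] power_space_mono[of n "max m n"] by auto
  have "submodule class_ring ?B A"
  proof (rule submoduleI)
    show "?B \<subseteq> carrier A" using submodule.subset[OF P] by auto
    show "\<zero> \<in> ?B" using submodule.zero_closed[OF P] by auto
    show "x \<oplus> y \<in> ?B" if xy: "x \<in> ?B" "y \<in> ?B" for x y
    proof -
      obtain m n where "x \<in> power_space A V m" "y \<in> power_space A V n" using xy by blast
      from submodule.m_closed[OF P up[OF this]] show ?thesis by blast
    qed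
    show "c \<odot> x \<in> ?B" if "x \<in> ?B" for c x
      using that submodule.smult_closed[OF P, of c] by (auto simp: class_ring_simps)
  qed
  moreover have "x \<otimes> y \<in> ?B" if xy: "x \<in> ?B" "y \<in> ?B" for x y
  proof -
    obtain m n where "x \<in> power_space A V m" "y \<in> power_space A V n" using xy by blast
    from power_space_mult[OF V(1) this] show ?thesis by blast
  qed
  ultimately have "subalgebra A ?B"
    unfolding subalgebra_def VectorSpace.subspace_def using vectorspace_axioms by blast
  moreover have "V \<subseteq> ?B" using power_space_base[OF V(1)] by blast
  ultimately have "?B = carrier A" using assms(1) unfolding generating_subspace_def by blast
  with x show ?thesis by blast
qed

text \<open>Finitely many spanning elements lie in finitely many levels, and the highest of these
  contains them all.\<close>

lemma fin_dim_subset_filtration: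
  fixes N :: "nat \<Rightarrow> 'a set"
  assumes V: "submodule class_ring V A" "vectorspace.fin_dim class_ring (A\<lparr>carrier := V\<rparr>)"
    and N: "\<And>n. submodule class_ring (N n) A" "\<And>m n. m \<le> n \<Longrightarrow> N m \<subseteq> N n" "V \<subseteq> (\<Union>n. N n)"
  shows "\<exists>c. V \<subseteq> N c"
proof -
  have "VectorSpace.subspace class_ring V A" using V(1) by (simp add: VectorSpace.subspace_def vectorspace_axioms)
  then interpret V: vectorspace "class_ring :: 'k ring" "A\<lparr>carrier := V\<rparr>" by (rule subspace_is_vs)
  obtain B where B: "finite B" "B \<subseteq> V" "V.span B = V" using V(2) by (auto simp: V.fin_dim_def)
  have sB: "span B = V" using B(2,3) span_li_not_depend(1)[OF B(2) V(1)] by simp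
  have "\<forall>b\<in>B. \<exists>n. b \<in> N n" using B(2) N(3) by blast
  then obtain f where f: "\<And>b. b \<in> B \<Longrightarrow> b \<in> N (f b)" by metis
  have "B \<subseteq> N (Max (f ` B))"
  proof
    fix b assume b: "b \<in> B"
    then have "f b \<le> Max (f ` B)" using B(1) by simp
    then show "b \<in> N (Max (f ` B))" using f[OF b] N(2) by blast
  qed
  then have "span B \<subseteq> N (Max (f ` B))" by (rule span_is_subset) (rule N(1))
  then show ?thesis using sB by blast
qed

lemma power_space_subset_filtration:
  fixes N :: "nat \<Rightarrow> 'a set"
  assumes N: "\<And>n. submodule class_ring (N n) A" "\<And>m n. m \<le> n \<Longrightarrow> N m \<subseteq> N n"
    "\<And>x y m n. x \<in> N m \<Longrightarrow> y \<in> N n \<Longrightarrow> x \<otimes> y \<in> N (m + n)" and V: "V \<subseteq> N c"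
  shows "power_space A V n \<subseteq> N (c * n)"
  unfolding power_space_def
proof (rule span_is_subset[OF _ N(1)], rule subsetI)
  fix x assume "x \<in> {foldl (\<otimes>) v ys | v ys. v \<in> V \<and> set ys \<subseteq> V \<and> Suc (length ys) \<le> n}"
  then obtain v ys where *: "x = foldl (\<otimes>) v ys" "v \<in> V" "set ys \<subseteq> V" "Suc (length ys) \<le> n" by blast
  have "foldl (\<otimes>) v ys \<in> N (c * Suc (length ys))" using *(3)
  proof (induction ys rule: rev_induct)
    case Nil
    then show ?case using *(2) V by auto
  next
    case (snoc w ws)
    then have "foldl (\<otimes>) v ws \<in> N (c * Suc (length ws))" "w \<in> N c" using V by auto
    from N(3)[OF this] show ?case by (simp add: algebra_simps)
  qed
  moreover have "c * Suc (length ys) \<le> c * n" using *(4) by (rule mult_le_mono2)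
  ultimately show "x \<in> N (c * n)" using N(2) *(1) by blast
qed

end

section \<open>Spanning and the growth of the Leavitt path algebra\<close>

context leavitt_data
begin

definition cong :: "(('v, 'e) gen list \<Rightarrow>\<^sub>0 'k::field) \<Rightarrow> (('v, 'e) gen list \<Rightarrow>\<^sub>0 'k) \<Rightarrow> bool" where
  "cong p q \<longleftrightarrow> p - q \<in> rel_ideal"

section \<open>Congruence modulo the ideal of relations\<close>

lemma rels_free: "rels \<subseteq> free_algebra X"
  by (rule leavitt_relators_free[OF hypergraph_axioms listings])

lemma cong_refl: "cong p p"
  by (simp add: cong_def algebra_ideal.zero)

lemma cong_sym: "cong p q \<Longrightarrow> cong q p"
  using algebra_ideal_diff[OF algebra_ideal.zero, of "p - q"] by (simp add: cong_def)

lemma cong_trans [trans]: "cong p q \<Longrightarrow> cong q r \<Longrightarrow> cong p r"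
  using algebra_ideal.add[of "p - q" X rels "q - r"] by (simp add: cong_def)

lemma cong_diff: "cong p q \<Longrightarrow> cong p' q' \<Longrightarrow> cong (p - p') (q - q')"
  using algebra_ideal_diff[of "p - q" X rels "p' - q'"] by (simp add: cong_def algebra_simps)

lemma monomial_append: "monomial (u @ v) = monomial u * monomial v"
  by (simp add: mult_single plus_list_def)

lemma single_eq_scale: "Poly_Mapping.single w c = scale c (monomial w)"
  by (simp add: scale_eq_mult mult_single)

lemma single_mult_monomial: "Poly_Mapping.single u c * monomial v = scale c (monomial (u @ v))"
  by (simp only: single_eq_scale[of u c] scale_laws monomial_append)

lemma monomial_Nil: "monomial [] = 1"
  by (simp add: single_one zero_list_def flip: zero_list_def)

lemma cong_mult_left:
  assumes "cong p q" "set u \<subseteq> X" shows "cong (monomial u * p) (monomial u * q)"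
\<comment> \<open>The empty word is the unit of the ambient ring and lies outside the nonunital free
  algebra, so the closure rules of the ideal do not cover it.\<close>
proof (cases "u = []")
  case False
  then have "monomial u * (p - q) \<in> rel_ideal"
    using assms by (intro algebra_ideal.left free_algebra_closed(6)) (auto simp: cong_def)
  then show ?thesis by (simp add: cong_def right_diff_distrib)
qed (use assms in \<open>simp add: monomial_Nil\<close>)

lemma cong_mult_right:
  assumes "cong p q" "set u \<subseteq> X" shows "cong (p * monomial u) (q * monomial u)"
proof (cases "u = []")
  case False
  then have "(p - q) * monomial u \<in> rel_ideal"
    using assms by (intro algebra_ideal.right free_algebra_closed(6)) (auto simp: cong_def)
  then show ?thesis by (simp add: cong_def left_diff_distrib)
qed (use assms in \<open>simp add: monomial_Nil\<close>)

lemma generatorsE: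
  assumes "x \<in> X"
  obtains v where "x = Vertex v" "v \<in> verts H" | "x \<in> edges H \<sigma> \<rho>"
  using assms by (auto simp: generators_def)

lemma Vertex_in_X: "Vertex v \<in> X \<longleftrightarrow> v \<in> verts H"
  by (auto simp: generators_def)

lemma gen_src_in_verts: "x \<in> X \<Longrightarrow> gen_src \<sigma> \<rho> x \<in> verts H"
  and gen_rng_in_verts: "x \<in> X \<Longrightarrow> gen_rng \<sigma> \<rho> x \<in> verts H"
  by (auto elim!: generatorsE edgesE simp: side_in_verts)

lemma cong_src: assumes "x \<in> X" shows "cong (monomial [Vertex (gen_src \<sigma> \<rho> x), x]) (monomial [x])"
  using assms leavitt_relators.vertices leavitt_relators.source_edge leavitt_relators.range_ghost
  unfolding cong_def generators_def edges_def
  by (auto intro!: algebra_ideal.relator) fastforce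

lemma cong_rng: assumes "x \<in> X" shows "cong (monomial [x, Vertex (gen_rng \<sigma> \<rho> x)]) (monomial [x])"
  using assms leavitt_relators.vertices leavitt_relators.edge_range leavitt_relators.ghost_source
  unfolding cong_def generators_def edges_def
  by (auto intro!: algebra_ideal.relator) fastforce

lemma cong_Vertex_Vertex:
  "u \<in> verts H \<Longrightarrow> v \<in> verts H \<Longrightarrow> u \<noteq> v \<Longrightarrow> cong (monomial [Vertex u, Vertex v]) 0"
  using leavitt_relators.vertices[of u H v \<sigma> \<rho>] by (auto simp: cong_def intro: algebra_ideal.relator)

lemma cong_letters:
  assumes "h \<in> hedges H" "i < length (side d h)" "j < length (side d h)"
  shows "cong (\<Sum>k<length (side (\<not> d) h). monomial [letter d h i k, letter (\<not> d) h k j])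
    (if i = j then monomial [Vertex (side d h ! i)] else 0)"
  using assms leavitt_relators.edge_ghost[of h H i \<sigma> j \<rho>] leavitt_relators.ghost_edge[of h H i \<rho> j \<sigma>]
  by (cases d) (auto simp: cong_def side_def letter_def intro: algebra_ideal.relator)

lemma nform_in_X: "nform w \<Longrightarrow> set w \<subseteq> X"
  by (cases w) (auto simp: nform_def generators_def)

text \<open>Insert the range of the last letter in front of \<open>v\<close> and use orthogonality
  of vertices.\<close>

lemma cong_snoc_Vertex:
  assumes w: "w \<noteq> []" "set w \<subseteq> X" and v: "v \<in> verts H"
  shows "cong (monomial (w @ [Vertex v]) :: _ \<Rightarrow>\<^sub>0 'k::field) (if gen_rng \<sigma> \<rho> (last w) = v then monomial w else 0)"
proof -
  obtain u x where wu: "w = u @ [x]" using w by (cases w rule: rev_cases) auto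
  have x: "x \<in> X" and u: "set u \<subseteq> X" using w wu by auto
  let ?r = "gen_rng \<sigma> \<rho> x"
  have "cong (monomial [x, Vertex v] :: _ \<Rightarrow>\<^sub>0 'k) (if ?r = v then monomial [x] else 0)"
  proof (cases "?r = v")
    case True then show ?thesis using cong_rng[OF x] by simp
  next
    case False
    have "cong (monomial [x] * monomial [Vertex v]) (monomial [x, Vertex ?r] * monomial [Vertex v])"
      using v by (intro cong_mult_right cong_sym[OF cong_rng[OF x]]) (simp add: Vertex_in_X)
    also have "monomial [x, Vertex ?r] * monomial [Vertex v] = monomial [x] * (monomial [Vertex ?r, Vertex v] :: _ \<Rightarrow>\<^sub>0 'k)"
      by (simp flip: monomial_append)
    also have "cong \<dots> (monomial [x] * 0)"
      using x v False by (intro cong_mult_left cong_Vertex_Vertex gen_rng_in_verts) auto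
    finally show ?thesis using False by (simp flip: monomial_append)
  qed
  from cong_mult_left[OF this u] show ?thesis
    by (cases "?r = v") (simp_all add: wu flip: monomial_append)
qed

text \<open>Modulo the ideal, the span of normal words with at most \<open>n\<close> edges;
  \<open>Suc n\<close> accounts for the stored initial vertex.\<close>

inductive_set filt :: "nat \<Rightarrow> (('v, 'e) gen list \<Rightarrow>\<^sub>0 'k::field) set" for n where
  ideal: "p \<in> rel_ideal \<Longrightarrow> p \<in> filt n"
| nform: "p \<in> filt n \<Longrightarrow> nform w \<Longrightarrow> length w \<le> Suc n \<Longrightarrow> p + Poly_Mapping.single w c \<in> filt n"

lemma filt_0: "0 \<in> filt n"
  by (intro filt.ideal algebra_ideal.zero)

lemma filt_monomial: "nform w \<Longrightarrow> length w \<le> Suc n \<Longrightarrow> monomial w \<in> filt n"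
  using filt.nform[OF filt_0, of w n 1] by simp

lemma filt_add: assumes "p \<in> filt n" "q \<in> filt n" shows "p + q \<in> filt n"
  using assms(2)
proof (induction rule: filt.induct)
  case (ideal q)
  show ?case using assms(1)
  proof (induction rule: filt.induct)
    case (ideal p)
    then show ?case using \<open>q \<in> rel_ideal\<close> by (intro filt.ideal algebra_ideal.add)
  next
    case (nform p w c)
    then show ?case using filt.nform[of "p + q" n w c] by (simp add: algebra_simps)
  qed
next
  case (nform q w c)
  then show ?case using filt.nform[of "p + q" n w c] by (simp add: algebra_simps)
qed

lemma filt_scale: assumes "p \<in> filt n" shows "scale c p \<in> filt n"
  using assms
proof (induction rule: filt.induct)
  case (nform p w d)
  have "scale c (p + Poly_Mapping.single w d) = scale c p + Poly_Mapping.single w (c * d)"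
    by (simp only: single_eq_scale[of w "c * d"] single_eq_scale[of w d] scale_laws)
  then show ?case using filt.nform[OF nform(4,2,3), of "c * d"] by simp
qed (intro filt.ideal algebra_ideal.scale)

lemma filt_diff: "p \<in> filt n \<Longrightarrow> q \<in> filt n \<Longrightarrow> p - q \<in> filt n"
  using filt_add[of p n "scale (- 1) q"] filt_scale[of q n "- 1"] by (simp add: scale_laws)

lemma filt_sum: "(\<And>s. s \<in> S \<Longrightarrow> f s \<in> filt n) \<Longrightarrow> sum f S \<in> filt n"
  by (induction S rule: infinite_finite_induct) (auto intro: filt_add filt_0)

lemma filt_mono: assumes "m \<le> n" shows "filt m \<subseteq> filt n"
proof
  fix p assume "p \<in> filt m"
  then show "p \<in> filt n"
    using assms by (induction rule: filt.induct) (auto intro: filt.intros)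
qed

lemma filt_cong: "cong p q \<Longrightarrow> q \<in> filt n \<Longrightarrow> p \<in> filt n"
  using filt_add[of "p - q" n q] by (auto simp: cong_def intro: filt.ideal)

lemma filt_free: assumes "p \<in> filt n" shows "p \<in> free_algebra X"
  using assms
proof (induction rule: filt.induct)
  case (nform p w c)
  have "monomial w \<in> free_algebra X"
    using nform(2) nform_in_X[OF nform(2)] by (intro free_algebra_closed(6)) (auto simp: nform_def)
  then show ?case unfolding single_eq_scale[of w c] by (intro free_algebra_closed(2,5) nform(4))
qed (rule algebra_ideal_sub[OF rels_free])

lemma filt_snoc_Vertex:
  assumes "nform w" "length w \<le> Suc n" "v \<in> verts H" shows "monomial (w @ [Vertex v]) \<in> filt n"
proof (rule filt_cong[OF cong_snoc_Vertex])
  show "w \<noteq> []" "set w \<subseteq> X" "v \<in> verts H" using assms nform_in_X by (auto simp: nform_def)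
qed (use assms in \<open>auto intro: filt_monomial filt_0\<close>)

text \<open>The spanning step. A non-composable product vanishes, an admissible one is normal, and a
  forbidden one is rewritten by its relation into normal words of the same length and a shorter
  one.\<close>

lemma filt_snoc_edge:
  assumes w: "nform w" "length w \<le> Suc n" and x: "x \<in> edges H \<sigma> \<rho>"
  shows "monomial (w @ [x]) \<in> (filt (Suc n) :: (('v, 'e) gen list \<Rightarrow>\<^sub>0 'k::field) set)"
proof -
  have ne: "w \<noteq> []" and wX: "set w \<subseteq> X" and xX: "x \<in> X"
    using w x nform_in_X by (auto simp: nform_def generators_def)
  consider "gen_rng \<sigma> \<rho> (last w) \<noteq> gen_src \<sigma> \<rho> x" | "follows (last w) x"
    | "[last w, x] \<in> forbidden H \<sigma> \<rho>" by (auto simp: follows_def)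
  then show ?thesis
  proof cases
    case 1
    let ?v = "Vertex (gen_src \<sigma> \<rho> x)"
    have "cong (monomial w * monomial [x]) (monomial w * (monomial [?v, x] :: _ \<Rightarrow>\<^sub>0 'k))"
      using wX by (intro cong_mult_left cong_sym[OF cong_src[OF xX]])
    also have "monomial w * monomial [?v, x] = (monomial (w @ [?v]) * monomial [x] :: _ \<Rightarrow>\<^sub>0 'k)"
      by (simp flip: monomial_append)
    also have "cong \<dots> (0 * monomial [x])"
      using cong_snoc_Vertex[OF ne wX gen_src_in_verts[OF xX]] 1 xX by (intro cong_mult_right) auto
    finally show ?thesis by (simp flip: monomial_append) (rule filt_cong[OF _ filt_0])
  next
    case 2
    then show ?thesis using w x ne by (intro filt_monomial) (auto simp: nform_snoc)
  next
    case 3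
    then obtain d h i j where xy: "last w = letter d h i 0" "x = letter (\<not> d) h 0 j"
      "h \<in> hedges H" "i < length (side d h)" "j < length (side d h)"
      by (auto simp: forbidden_iff)
    let ?n = "length (side (\<not> d) h)"
    obtain u where u: "w = u @ [letter d h i 0]" "u \<noteq> []" "nform u" "follows (last u) (letter d h i 0)" "0 < ?n"
      using nform_snocE[OF w(1) xy(1)] by metis
    define g :: "nat \<Rightarrow> (('v, 'e) gen list \<Rightarrow>\<^sub>0 'k)" where
      "g k = monomial (u @ [letter d h i k, letter (\<not> d) h k j])" for k
    have uX: "set u \<subseteq> X" using nform_in_X u by blast
    have "{..<?n} = insert 0 {1..<?n}" using u(5) by auto
    \<comment> \<open>Isolates the forbidden summand; the full sum is then replaced by means of the
      relation.\<close>
    then have "g 0 = (\<Sum>k<?n. g k) - (\<Sum>k=1..<?n. g k)" by simp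
    also have "(\<Sum>k<?n. g k) = monomial u * (\<Sum>k<?n. monomial [letter d h i k, letter (\<not> d) h k j])"
      by (simp add: g_def monomial_append sum_distrib_left)
    finally have g0: "g 0 = \<dots> - (\<Sum>k=1..<?n. g k)" .
    have 1: "cong (g 0) (monomial u * (if i = j then monomial [Vertex (side d h ! i)] else 0) - (\<Sum>k=1..<?n. g k))"
      unfolding g0 using xy uX by (intro cong_diff cong_mult_left cong_letters cong_refl) auto
    have 2: "g k \<in> filt (Suc n)" if k: "k \<in> {1..<?n}" for k
    proof -
      have "nform (u @ [letter d h i k])"
        using u xy k follows_letter_iff[of k d h 0 "last u" i] by (simp add: nform_snoc)
      moreover have "follows (letter d h i k) (letter (\<not> d) h k j)"
        using xy k follows_letters[of h i d j k] by simp
      ultimately have "nform ((u @ [letter d h i k]) @ [letter (\<not> d) h k j])"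
        using xy k by (subst nform_snoc) auto
      then show ?thesis unfolding g_def using w(2) u(1) by (intro filt_monomial) auto
    qed
    \<comment> \<open>The vertex appended to \<open>u\<close> is absorbed, so the Kronecker term
      does not raise the level.\<close>
    have 3: "monomial u * (if i = j then monomial [Vertex (side d h ! i)] else 0) \<in> (filt (Suc n) :: (_ \<Rightarrow>\<^sub>0 'k) set)"
      using filt_snoc_Vertex[of u "Suc n" "side d h ! i"] u w(2) xy side_in_verts[of h i d]
      by (auto simp: monomial_append filt_0)
    have "g 0 \<in> filt (Suc n)" by (rule filt_cong[OF 1 filt_diff[OF 3 filt_sum[OF 2]]])
    then show ?thesis by (simp add: g_def xy u(1))
  qed
qed

lemma filt_mult_Vertex:
  assumes "p \<in> filt n" "v \<in> verts H" shows "p * monomial [Vertex v] \<in> filt n"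
  using assms
proof (induction rule: filt.induct)
  case (ideal p)
  then show ?case
    by (intro filt.ideal algebra_ideal.right free_algebra_closed(6)) (auto simp: Vertex_in_X)
next
  case (nform p w c)
  then show ?case
    unfolding distrib_right single_mult_monomial by (intro filt_add filt_scale filt_snoc_Vertex) auto
qed

lemma filt_mult_edge:
  assumes "p \<in> filt n" "x \<in> edges H \<sigma> \<rho>" shows "p * monomial [x] \<in> filt (Suc n)"
  using assms
proof (induction rule: filt.induct)
  case (ideal p)
  then show ?case
    by (intro filt.ideal algebra_ideal.right free_algebra_closed(6)) (auto simp: generators_def)
next
  case (nform p w c)
  then show ?case
    unfolding distrib_right single_mult_monomial by (intro filt_add filt_scale filt_snoc_edge) auto
qed

lemma filt_mult_edges:
  assumes "p \<in> filt n" "set xs \<subseteq> edges H \<sigma> \<rho>" shows "p * monomial xs \<in> filt (n + length xs)"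
  using assms
proof (induction xs rule: rev_induct)
  case (snoc x xs)
  then have "(p * monomial xs) * monomial [x] \<in> filt (Suc (n + length xs))"
    by (intro filt_mult_edge) auto
  then show ?case by (simp add: monomial_append mult.assoc)
qed (simp add: monomial_Nil)

text \<open>Levels add because the initial vertex of the right factor costs nothing and each of its
  edges costs one.\<close>

lemma filt_mult: assumes "p \<in> filt m" "q \<in> filt n" shows "p * q \<in> filt (m + n)"
  using assms(2)
proof (induction rule: filt.induct)
  case (ideal q)
  then show ?case using filt_free[OF assms(1)] by (intro filt.ideal algebra_ideal.left)
next
  case (nform q w c)
  obtain v xs where w: "w = Vertex v # xs" "v \<in> verts H" "set xs \<subseteq> edges H \<sigma> \<rho>"
    using nform(2) by (cases w) (auto simp: nform_def)
  have "(p * monomial [Vertex v]) * monomial xs \<in> filt (m + length xs)"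
    by (intro filt_mult_edges filt_mult_Vertex assms w)
  then have "p * monomial w \<in> filt (m + length xs)"
    by (simp add: w mult.assoc flip: monomial_append)
  then have "p * monomial w \<in> filt (m + n)" using filt_mono[of "m + length xs" "m + n"] nform(3) w by auto
  moreover have "p * Poly_Mapping.single w c = scale c (p * monomial w)"
    by (simp only: single_eq_scale[of w c] scale_laws)
  ultimately show ?case using nform(4) unfolding distrib_left by (simp add: filt_add filt_scale)
qed

lemma filt_generator: assumes "x \<in> X" shows "monomial [x] \<in> filt 1"
  using assms
proof (cases rule: generatorsE)
  case (1 v)
  then show ?thesis by (auto intro!: filt_monomial simp: nform_Vertex)
next
  case 2
  have v: "gen_src \<sigma> \<rho> x \<in> verts H" by (rule gen_src_in_verts[OF assms])
  have "nform ([Vertex (gen_src \<sigma> \<rho> x)] @ [x])"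
    using 2 v by (subst nform_snoc) (auto simp: nform_Vertex follows_def forbidden_iff)
  then have "monomial [Vertex (gen_src \<sigma> \<rho> x), x] \<in> filt 1" by (intro filt_monomial) auto
  then show ?thesis by (rule filt_cong[OF cong_sym[OF cong_src[OF assms]]])
qed

lemma filt_word: "w \<noteq> [] \<Longrightarrow> set w \<subseteq> X \<Longrightarrow> monomial w \<in> filt (length w)"
proof (induction w rule: list_nonempty_induct)
  case (single x)
  then show ?case using filt_generator by simp
next
  case (cons x w)
  then show ?case using filt_mult[OF filt_generator, of x "monomial w" "length w"]
    by (simp flip: monomial_append)
qed

lemma free_algebra_filt: assumes "p \<in> free_algebra X" shows "\<exists>n. p \<in> filt n"
proof -
  have "Poly_Mapping.single k (Poly_Mapping.lookup p k) \<in> filt (Max (length ` Poly_Mapping.keys p))"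
    if k: "k \<in> Poly_Mapping.keys p" for k
  proof -
    have "monomial k \<in> filt (length k)"
      using assms k by (intro filt_word) (auto simp: free_algebra_def)
    moreover have "length k \<le> Max (length ` Poly_Mapping.keys p)" using k by simp
    ultimately have "scale (Poly_Mapping.lookup p k) (monomial k) \<in> filt (Max (length ` Poly_Mapping.keys p))"
      using filt_mono by (intro filt_scale) blast
    then show ?thesis by (simp only: single_eq_scale[of k "Poly_Mapping.lookup p k"])
  qed
  then have "(\<Sum>k\<in>Poly_Mapping.keys p. Poly_Mapping.single k (Poly_Mapping.lookup p k)) \<in> filt (Max (length ` Poly_Mapping.keys p))"
    by (intro filt_sum)
  then show ?thesis unfolding poly_mapping_sum_single[symmetric] by blast
qed

end

section \<open>Comparison of the growth function with the number of normal words\<close>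

context leavitt_data
begin

abbreviation lpa :: "('k::field, (('v, 'e) gen list \<Rightarrow>\<^sub>0 'k) set) module" where
  "lpa \<equiv> presented_algebra X rels"

definition cls :: "(('v, 'e) gen list \<Rightarrow>\<^sub>0 'k::field) \<Rightarrow> (('v, 'e) gen list \<Rightarrow>\<^sub>0 'k) set" where
  "cls = coset rel_ideal"

definition nforms :: "nat \<Rightarrow> ('v, 'e) gen list set" where
  "nforms n = {w. nform w \<and> length w \<le> Suc n}"

lemma lpa_nonunital: "nonunital_algebra (lpa :: ('k::field, _) module)"
  by (rule presented_algebra_nonunital[OF rels_free])

lemmas lpa_ops = presented_algebra_ops[OF rels_free, folded cls_def]

lemma cls_eq_iff: "cls p = cls q \<longleftrightarrow> cong p q"
  by (simp add: cls_def cong_def coset_eq_iff)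

lemma cls_filt_closed: "p \<in> filt n \<Longrightarrow> cls p \<in> carrier lpa"
  by (auto simp: lpa_ops intro: filt_free)

lemma filt_submodule: "submodule class_ring (cls ` filt n) (lpa :: ('k::field, _) module)"
proof -
  interpret A: nonunital_algebra "lpa :: ('k, _) module" by (rule lpa_nonunital)
  show ?thesis
  proof (rule A.submoduleI)
    show "cls ` filt n \<subseteq> carrier lpa" using cls_filt_closed by blast
    show "\<zero>\<^bsub>lpa\<^esub> \<in> cls ` filt n" by (simp add: lpa_ops imageI filt_0)
    show "x \<oplus>\<^bsub>lpa\<^esub> y \<in> cls ` filt n" if "x \<in> cls ` filt n" "y \<in> cls ` filt n" for x y
      using that by (auto simp: lpa_ops intro: filt_add)
    show "c \<odot>\<^bsub>lpa\<^esub> x \<in> cls ` filt n" if "x \<in> cls ` filt n" for c x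
      using that by (auto simp: lpa_ops intro: filt_scale)
  qed
qed

lemma cls_filt_mono: "m \<le> n \<Longrightarrow> cls ` filt m \<subseteq> cls ` filt n"
  by (rule image_mono[OF filt_mono])

lemma cls_filt_mult:
  "x \<in> cls ` filt m \<Longrightarrow> y \<in> cls ` filt n \<Longrightarrow> x \<otimes>\<^bsub>lpa\<^esub> y \<in> cls ` filt (m + n)"
  by (auto simp: lpa_ops filt_free intro: filt_mult)

lemma cls_filt_Union: "carrier lpa \<subseteq> (\<Union>n. cls ` filt n)"
  using free_algebra_filt by (fastforce simp: lpa_ops)

lemma finite_nforms: "finite (nforms n)"
  by (rule finite_subset[OF _ finite_lists_length_le[of X "Suc n"]])
    (use nform_in_X finite_generators[OF finite_hypergraph_axioms] in \<open>auto simp: nforms_def\<close>)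

text \<open>Linear independence of a set of classes would not notice coincidences between words;
  this makes counting classes the same as counting words.\<close>

lemma cls_monomial_inj: "inj_on (\<lambda>w. cls (monomial w :: _ \<Rightarrow>\<^sub>0 'k::field)) {w. nform w}"
proof (rule inj_onI, rule ccontr)
  fix u w :: "('v, 'e) gen list"
  assume nf: "u \<in> {w. nform w}" "w \<in> {w. nform w}" and eq: "cls (monomial u :: _ \<Rightarrow>\<^sub>0 'k) = cls (monomial w)"
    and ne: "u \<noteq> w"
  define c :: "('v, 'e) gen list \<Rightarrow> 'k" where "c s = (if s = u then 1 else - 1)" for s
  have "(\<Sum>s\<in>{u, w}. Poly_Mapping.single s (c s)) = monomial u - monomial w"
    using ne by (simp add: c_def single_uminus)
  then have "(\<Sum>s\<in>{u, w}. Poly_Mapping.single s (c s)) \<in> rel_ideal"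
    using eq by (simp add: cls_eq_iff cong_def)
  then have "c u = 0" using nf by (intro nform_independent[of "{u, w}"]) auto
  then show False by (simp add: c_def)
qed

lemma lincomb_cls:
  fixes a :: "_ \<Rightarrow> 'k::field"
  assumes "finite T" "\<And>w. w \<in> T \<Longrightarrow> nform w"
  shows "module.lincomb lpa a ((\<lambda>w. cls (monomial w)) ` T)
    = cls (\<Sum>w\<in>T. Poly_Mapping.single w (a (cls (monomial w))))"
proof -
  interpret A: nonunital_algebra "lpa :: ('k, _) module" by (rule lpa_nonunital)
  show ?thesis using assms
  proof (induction T rule: finite_induct)
    case empty
    show ?case by (simp add: A.lincomb_def lpa_ops)
  next
    case (insert w T)
    let ?f = "\<lambda>w. cls (monomial w) :: (_ \<Rightarrow>\<^sub>0 'k) set"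
    have cl: "?f s \<in> carrier lpa" if "s \<in> insert w T" for s
      using insert.prems[OF that] nform_in_X[of s] by (auto simp: lpa_ops nform_def intro!: free_algebra_closed(6))
    have notin: "?f w \<notin> ?f ` T"
    proof
      assume "?f w \<in> ?f ` T"
      then obtain s where s: "s \<in> T" "?f w = ?f s" by auto
      then have "w = s" using inj_onD[OF cls_monomial_inj, of w s] insert.prems by auto
      with s insert.hyps show False by simp
    qed
    have "A.lincomb a (insert (?f w) (?f ` T)) = a (?f w) \<odot>\<^bsub>lpa\<^esub> ?f w \<oplus>\<^bsub>lpa\<^esub> A.lincomb a (?f ` T)"
      unfolding A.lincomb_def using cl insert.hyps notin
      by (subst A.finsum_insert) (auto intro!: A.smult_closed)
    also have "\<dots> = cls (\<Sum>s\<in>insert w T. Poly_Mapping.single s (a (?f s)))"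
      using insert.hyps insert.prems
      by (simp add: insert.IH lpa_ops flip: single_eq_scale)
    finally show ?case by simp
  qed
qed

lemma cls_nforms_independent:
  "\<not> module.lin_dep class_ring (lpa :: ('k::field, _) module) ((\<lambda>w. cls (monomial w)) ` nforms n)"
proof -
  interpret A: nonunital_algebra "lpa :: ('k, _) module" by (rule lpa_nonunital)
  let ?f = "\<lambda>w. cls (monomial w) :: (_ \<Rightarrow>\<^sub>0 'k) set"
  show ?thesis
  proof
    assume "A.lin_dep (?f ` nforms n)"
    then obtain B a v where B: "finite B" "B \<subseteq> ?f ` nforms n" "A.lincomb a B = \<zero>\<^bsub>lpa\<^esub>" "v \<in> B" "a v \<noteq> 0"
      unfolding A.lin_dep_def by auto
    then obtain T where T: "T \<subseteq> nforms n" "B = ?f ` T" by (meson subset_imageE)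
    have fT: "finite T" using T finite_nforms finite_subset by blast
    have nf: "nform w" if "w \<in> T" for w using T that by (auto simp: nforms_def)
    have "cls (\<Sum>w\<in>T. Poly_Mapping.single w (a (?f w))) = cls 0"
      using B(3) lincomb_cls[OF fT nf, of a] by (simp add: T(2) lpa_ops)
    then have rel: "(\<Sum>w\<in>T. Poly_Mapping.single w (a (?f w))) \<in> rel_ideal"
      by (simp add: cls_eq_iff cong_def)
    obtain w where "w \<in> T" "v = ?f w" using B(4) T(2) by auto
    then show False using nform_independent[OF fT nf rel] B(5) by simp
  qed
qed

lemma cls_nforms_closed: "(\<lambda>w. cls (monomial w)) ` nforms n \<subseteq> carrier lpa"
  by (auto simp: nforms_def intro!: cls_filt_closed[of _ n] filt_monomial)

lemma cls_filt_subset_span: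
  "cls ` filt n \<subseteq> LinearCombinations.module.span class_ring lpa ((\<lambda>w. cls (monomial w)) ` nforms n :: (_ \<Rightarrow>\<^sub>0 'k::field) set set)"
proof -
  interpret A: nonunital_algebra "lpa :: ('k, _) module" by (rule lpa_nonunital)
  let ?S = "(\<lambda>w. cls (monomial w)) ` nforms n :: (_ \<Rightarrow>\<^sub>0 'k) set set"
  note S = cls_nforms_closed[of n, where 'a = 'k]
  interpret S: submodule "class_ring :: 'k ring" "A.span ?S" lpa by (rule A.span_is_submodule[OF S])
  have "cls p \<in> A.span ?S" if "p \<in> filt n" for p
    using that
  proof (induction rule: filt.induct)
    case (ideal p)
    then have "cls p = cls 0" by (simp add: cls_eq_iff cong_def)
    then show ?case using S.zero_closed by (simp add: lpa_ops)
  next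
    case (nform p w c)
    have "cls (monomial w) \<in> A.span ?S" using A.in_own_span[OF S] nform by (auto simp: nforms_def)
    then have "cls p \<oplus>\<^bsub>lpa\<^esub> (c \<odot>\<^bsub>lpa\<^esub> cls (monomial w)) \<in> A.span ?S"
      using nform.IH by (intro S.m_closed S.smult_closed) auto
    then show ?case by (simp add: lpa_ops flip: single_eq_scale)
  qed
  then show ?thesis by blast
qed

lemma card_cls_nforms: "card ((\<lambda>w. cls (monomial w :: _ \<Rightarrow>\<^sub>0 'k::field)) ` nforms n) = card (nforms n)"
  by (rule card_image, rule inj_on_subset[OF cls_monomial_inj]) (auto simp: nforms_def)

text \<open>Being finite-dimensional, \<open>V\<close> sits in one level of the multiplicative
  filtration, so its powers climb at most linearly.\<close>

lemma power_space_bound: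
  assumes V: "generating_subspace (lpa :: ('k::field, _) module) V"
  shows "\<exists>c\<ge>1. \<forall>n. power_space lpa V n \<subseteq> cls ` filt (c * n)"
proof -
  interpret A: nonunital_algebra "lpa :: ('k, _) module" by (rule lpa_nonunital)
  note V' = A.generating_subspaceD[OF V]
  have "\<exists>c. V \<subseteq> cls ` filt c"
    by (rule A.fin_dim_subset_filtration[where N = "\<lambda>n. cls ` filt n", OF V'(2,3) filt_submodule cls_filt_mono
          subset_trans[OF V'(1) cls_filt_Union]])
  then obtain c where "V \<subseteq> cls ` filt c" by blast
  then have Vc: "V \<subseteq> cls ` filt (Suc c)" by (rule subset_trans) (rule cls_filt_mono, simp)
  have "power_space lpa V n \<subseteq> cls ` filt (Suc c * n)" for n
  proof (rule A.power_space_subset_filtration[where N = "\<lambda>n. cls ` filt n"])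
    show "submodule class_ring (cls ` filt n) (lpa :: ('k, _) module)" for n by (rule filt_submodule)
    show "V \<subseteq> cls ` filt (Suc c)" by (rule Vc)
  qed (rule cls_filt_mono cls_filt_mult, assumption+)+
  then show ?thesis by (intro exI[of _ "Suc c"]) simp
qed

lemma growth_upper:
  assumes V: "generating_subspace (lpa :: ('k::field, _) module) V"
  shows "\<exists>c\<ge>1. \<forall>n. vectorspace.fin_dim class_ring (lpa\<lparr>carrier := power_space lpa V n\<rparr>)
    \<and> growth lpa V n \<le> card (nforms (c * n))"
proof -
  interpret A: nonunital_algebra "lpa :: ('k, _) module" by (rule lpa_nonunital)
  note V' = A.generating_subspaceD[OF V]
  obtain c where c: "c \<ge> 1" "\<And>n. power_space lpa V n \<subseteq> cls ` filt (c * n)" using power_space_bound[OF V] by blast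
  have "power_space lpa V n \<subseteq> A.span ((\<lambda>w. cls (monomial w)) ` nforms (c * n))" for n
    using c(2)[of n] cls_filt_subset_span[of "c * n", where 'k = 'k] by blast
  from A.subspace_of_span_dim[OF A.power_space_submodule[OF V'(1)] this finite_imageI[OF finite_nforms] cls_nforms_closed]
  show ?thesis using c(1) unfolding growth_def card_cls_nforms by blast
qed

text \<open>All generators lie in a common power of \<open>V\<close>, so a word lies in a power
  linear in its length. Level \<open>n\<close> has words of \<open>Suc n\<close> letters because of
  the initial vertex.\<close>

lemma growth_lower:
  assumes V: "generating_subspace (lpa :: ('k::field, _) module) V"
  shows "\<exists>c\<ge>1. \<forall>n. card (nforms n) \<le> growth lpa V (c * Suc n)"
proof -
  interpret A: nonunital_algebra "lpa :: ('k, _) module" by (rule lpa_nonunital)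
  note V' = A.generating_subspaceD[OF V]
  have mX: "cls (monomial w :: _ \<Rightarrow>\<^sub>0 'k) \<in> carrier lpa" if "w \<noteq> []" "set w \<subseteq> X" for w
    using that by (auto simp: lpa_ops intro!: free_algebra_closed(6))
  have "\<exists>n. cls (monomial [x]) \<in> power_space lpa V n" if "x \<in> X" for x
    using A.generating_subspace_Union[OF V mX[of "[x]"]] that by simp
  then obtain f where f: "\<And>x. x \<in> X \<Longrightarrow> cls (monomial [x]) \<in> power_space lpa V (f x)" by metis
  \<comment> \<open>The sum dominates each \<open>f x\<close>, and \<open>Suc\<close> makes the
    constant positive.\<close>
  define c where "c = Suc (sum f X)"
  have fX: "finite X" by (rule finite_generators[OF finite_hypergraph_axioms])
  have 1: "cls (monomial [x]) \<in> power_space lpa V c" if "x \<in> X" for x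
  proof -
    have "f x \<le> c" unfolding c_def using member_le_sum[OF that, of f] fX by simp
    then show ?thesis using f[OF that] A.power_space_mono by blast
  qed
  have word: "cls (monomial w) \<in> power_space lpa V (c * length w)" if "w \<noteq> []" "set w \<subseteq> X" for w
    using that
  proof (induction w rule: list_nonempty_induct)
    case (single x)
    then show ?case using 1 by simp
  next
    case (cons x w)
    then have "cls (monomial [x]) \<otimes>\<^bsub>lpa\<^esub> cls (monomial w) \<in> power_space lpa V (c + c * length w)"
      using 1 by (intro A.power_space_mult V') auto
    moreover have "cls (monomial [x]) \<otimes>\<^bsub>lpa\<^esub> cls (monomial w) = (cls (monomial (x # w)) :: (_ \<Rightarrow>\<^sub>0 'k) set)"
      using cons by (subst lpa_ops) (auto intro!: free_algebra_closed(6) simp flip: monomial_append)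
    ultimately show ?case by simp
  qed
  obtain b where b: "\<And>n. vectorspace.fin_dim class_ring (lpa\<lparr>carrier := power_space lpa V n\<rparr>)"
    using growth_upper[OF V] by blast
  have "card (nforms n) \<le> growth lpa V (c * Suc n)" for n
  proof -
    have "(\<lambda>w. cls (monomial w)) ` nforms n \<subseteq> power_space lpa V (c * Suc n)"
    proof (rule image_subsetI)
      fix w assume w: "w \<in> nforms n"
      then have "cls (monomial w) \<in> power_space lpa V (c * length w)"
        using nform_in_X[of w] by (intro word) (auto simp: nforms_def nform_def)
      moreover have "c * length w \<le> c * Suc n" using w by (intro mult_le_mono2) (simp add: nforms_def)
      ultimately show "cls (monomial w) \<in> power_space lpa V (c * Suc n)" using A.power_space_mono by blast
    qed
    from A.card_le_subspace_dim[OF A.power_space_submodule[OF V'(1)] b this cls_nforms_independent]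
    show ?thesis unfolding growth_def card_cls_nforms .
  qed
  then show ?thesis by (intro exI[of _ c]) (simp add: c_def)
qed

lemma growth_mono:
  assumes V: "generating_subspace (lpa :: ('k::field, _) module) V" and mn: "m \<le> n"
  shows "growth lpa V m \<le> growth lpa V n"
proof -
  interpret A: nonunital_algebra "lpa :: ('k, _) module" by (rule lpa_nonunital)
  note V' = A.generating_subspaceD[OF V]
  note P = A.power_space_submodule[OF V'(1)]
  have fd: "vectorspace.fin_dim class_ring (lpa\<lparr>carrier := power_space lpa V k\<rparr>)" for k
    using growth_upper[OF V] by blast
  have sub: "VectorSpace.subspace class_ring (power_space lpa V k) lpa" for k
    using P by (simp add: VectorSpace.subspace_def A.vectorspace_axioms)
  interpret N: vectorspace "class_ring :: 'k ring" "lpa\<lparr>carrier := power_space lpa V n\<rparr>"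
    by (rule A.subspace_is_vs[OF sub])
  obtain B where B: "finite B" "N.basis B" using N.finite_basis_exists[OF fd] by blast
  have Bn: "B \<subseteq> power_space lpa V n" using B(2) by (simp add: N.basis_def)
  have "A.span B = power_space lpa V n"
    using B(2) A.span_li_not_depend(1)[OF Bn P] by (simp add: N.basis_def)
  then have "power_space lpa V m \<subseteq> A.span B" using A.power_space_mono[OF mn] by blast
  moreover have "B \<subseteq> carrier lpa" using Bn submodule.subset[OF P] by blast
  ultimately have "growth lpa V m \<le> card B"
    unfolding growth_def using A.subspace_of_span_dim(2)[OF P _ B(1)] by blast
  then show ?thesis unfolding growth_def N.dim_basis[OF B] .
qed

end

section \<open>Nod-paths as walks\<close>

lemma sublist_two_iff: "sublist [a, b] p \<longleftrightarrow> (\<exists>i. Suc i < length p \<and> p ! i = a \<and> p ! Suc i = b)"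
proof
  assume "sublist [a, b] p"
  then obtain us vs where "p = us @ [a, b] @ vs" by (auto simp: sublist_def)
  then show "\<exists>i. Suc i < length p \<and> p ! i = a \<and> p ! Suc i = b"
    by (intro exI[of _ "length us"]) (auto simp: nth_append)
next
  assume "\<exists>i. Suc i < length p \<and> p ! i = a \<and> p ! Suc i = b"
  then obtain i where i: "Suc i < length p" "p ! i = a" "p ! Suc i = b" by blast
  have "p = take i p @ p ! i # p ! Suc i # drop (Suc (Suc i)) p"
    using i(1) by (simp add: Cons_nth_drop_Suc)
  then show "sublist [a, b] p"
    using i unfolding sublist_def by (metis append_Cons append_Nil)
qed

context leavitt_data
begin

lemma finite_edges: "finite (edges H \<sigma> \<rho>)"
  using finite_generators[OF finite_hypergraph_axioms, of \<sigma> \<rho>] by (simp add: generators_def)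

sublocale D: finite_digraph "edges H \<sigma> \<rho>" follows
  by standard (rule finite_edges)

lemma forbidden_length: "w \<in> forbidden H \<sigma> \<rho> \<Longrightarrow> \<exists>a b. w = [a, b]"
  by (auto elim: forbidden.cases)

lemma nod_path_iff: "nod_path H \<sigma> \<rho> p \<longleftrightarrow> (\<exists>v\<in>verts H. p = [Vertex v]) \<or> D.walk p"
proof -
  have forb: "(\<forall>w. sublist w p \<longrightarrow> w \<notin> forbidden H \<sigma> \<rho>)
      \<longleftrightarrow> (\<forall>i. Suc i < length p \<longrightarrow> [p ! i, p ! Suc i] \<notin> forbidden H \<sigma> \<rho>)" for p
    using forbidden_length sublist_two_iff by metis
  show ?thesis
    unfolding nod_path_def dpath_def forb D.walk_def successively_conv_nth follows_def by auto
qed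

text \<open>A doubled word is never a single letter, so vertices drop out.\<close>

lemma nod2_path_iff: "nod2_path H \<sigma> \<rho> p \<longleftrightarrow> D.closed_walk p"
proof -
  have "p @ p \<noteq> [x]" for x by (cases p) auto
  then show ?thesis
    unfolding nod2_path_def nod_path_iff by (auto simp: D.closed_walk_def) (auto simp: D.walk_def successively_append_iff)
qed

lemma path_length_closed_walk: "D.closed_walk p \<Longrightarrow> path_length p = length p"
  by (cases p rule: path_length.cases) (auto simp: D.closed_walk_def D.walk_def)

lemma quasi_cycle_iff: "quasi_cycle H \<sigma> \<rho> p \<longleftrightarrow> D.qcycle p"
  unfolding quasi_cycle_def D.qcycle_def nod2_path_iff
  using path_length_closed_walk by (metis not_le)

lemma nod_conn_iff:
  assumes "D.walk p" "D.walk q" shows "nod_conn H \<sigma> \<rho> p q \<longleftrightarrow> D.detour p q"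
proof -
  have "p \<noteq> []" "q \<noteq> []" using assms D.walk_notNil by auto
  then have "p @ w @ q \<noteq> [x]" for w x by (cases p) auto
  then have "nod_path H \<sigma> \<rho> (p @ w @ q) \<longleftrightarrow> D.walk (p @ w @ q)" for w by (simp add: nod_path_iff)
  moreover have "nod_path H \<sigma> \<rho> w \<longleftrightarrow> D.walk w" if "D.walk (p @ w @ q)" for w
    using that unfolding nod_path_iff by (auto simp: D.walk_def)
  ultimately show ?thesis unfolding nod_conn_def D.detour_def by blast
qed

lemma conn_iff:
  assumes "D.walk p" "D.walk q" shows "conn H \<sigma> \<rho> p q \<longleftrightarrow> D.connected_to p q"
proof -
  have "p \<noteq> []" "q \<noteq> []" using assms D.walk_notNil by auto
  then have "p @ q \<noteq> [x]" for x by (cases p) auto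
  then show ?thesis by (simp add: conn_def D.connected_to_def nod_conn_iff[OF assms] nod_path_iff)
qed

lemma quasi_cycle_chain_iff: "quasi_cycle_chain H \<sigma> \<rho> ps \<longleftrightarrow> D.chain ps"
proof -
  have "(\<forall>i j. i < length ps \<and> j < length ps \<and> i \<noteq> j \<longrightarrow> \<not> ps ! i \<approx>\<^sub>s ps ! j)
      \<longleftrightarrow> sorted_wrt (\<lambda>p q. \<not> p \<approx>\<^sub>s q \<and> \<not> q \<approx>\<^sub>s p) ps" (is "?L \<longleftrightarrow> ?R")
  proof
    assume ?L
    then show ?R unfolding sorted_wrt_iff_nth_less by auto
  next
    assume R: ?R
    show ?L
    proof (intro allI impI)
      fix i j assume "i < length ps \<and> j < length ps \<and> i \<noteq> j"
      then show "\<not> ps ! i \<approx>\<^sub>s ps ! j"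
        using R unfolding sorted_wrt_iff_nth_less by (cases i j rule: linorder_cases) auto
    qed
  qed
  moreover have "(\<forall>i. Suc i < length ps \<longrightarrow> conn H \<sigma> \<rho> (ps ! i) (ps ! Suc i)) \<longleftrightarrow> successively D.connected_to ps"
    if "\<forall>p\<in>set ps. D.qcycle p"
    unfolding successively_conv_nth using that by (auto simp: conn_iff D.qcycle_walk)
  ultimately show ?thesis unfolding quasi_cycle_chain_def D.chain_def quasi_cycle_iff by blast
qed

lemma selfconnected_iff: "quasi_cycle H \<sigma> \<rho> p \<and> selfconnected H \<sigma> \<rho> p \<longleftrightarrow> D.qcycle p \<and> D.detour p p"
  using nod_conn_iff[of p p] D.qcycle_walk[of p] by (auto simp: quasi_cycle_iff selfconnected_def)

lemma max_chain_length:
  shows "\<exists>ps. D.chain ps \<and> length ps = max_chain_length H \<sigma> \<rho>"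
    and "D.chain ps \<Longrightarrow> length ps \<le> max_chain_length H \<sigma> \<rho>"
proof -
  let ?L = "{length ps | ps. quasi_cycle_chain H \<sigma> \<rho> ps}"
  have L: "?L = length ` {ps. D.chain ps}" by (auto simp: quasi_cycle_chain_iff)
  then have fin: "finite ?L" using D.finite_chains by simp
  have "D.chain []" by (simp add: D.chain_def)
  then have "?L \<noteq> {}" using L by blast
  then have "Max ?L \<in> ?L" by (rule Max_in[OF fin])
  then show "\<exists>ps. D.chain ps \<and> length ps = max_chain_length H \<sigma> \<rho>"
    unfolding max_chain_length_def quasi_cycle_chain_iff by auto
  show "length ps \<le> max_chain_length H \<sigma> \<rho>" if "D.chain ps"
    unfolding max_chain_length_def by (rule Max_ge[OF fin]) (use that in \<open>auto simp: quasi_cycle_chain_iff\<close>)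
qed

lemma card_walks_le: "card (D.walks n) \<le> card (nforms n)"
proof -
  \<comment> \<open>A vertex is needed as the image of the empty walk. It exists even if only a
    hyperedge is given, since sources are nonempty.\<close>
  obtain h0 where h0: "h0 \<in> verts H"
    using nonempty src_ne src_sub by (metis all_not_in_conv set_mset_eq_empty_iff subsetD)
  define f where "f xs = Vertex (if xs = [] then h0 else gen_src \<sigma> \<rho> (hd xs)) # xs" for xs
  have "f xs \<in> nforms n" if xs: "xs \<in> D.walks n" for xs
  proof (cases xs)
    case Nil
    then show ?thesis using h0 by (simp add: f_def nforms_def nform_Vertex)
  next
    case (Cons x ys)
    have "x \<in> edges H \<sigma> \<rho>" using xs Cons by (simp add: D.walks_def)
    then have "gen_src \<sigma> \<rho> x \<in> verts H" by (intro gen_src_in_verts) (simp add: generators_def)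
    moreover have "follows (Vertex (gen_src \<sigma> \<rho> x)) x" by (auto simp: follows_def forbidden_iff)
    ultimately show ?thesis using xs Cons by (simp add: f_def nforms_def nform_def D.walks_def)
  qed
  then have sub: "f ` D.walks n \<subseteq> nforms n" by blast
  have inj: "inj_on f (D.walks n)" by (rule inj_onI) (simp add: f_def)
  show ?thesis by (rule card_inj_on_le[OF inj sub finite_nforms])
qed

text \<open>Split off the initial vertex. The product bound is generous but costs only a constant
  factor.\<close>

lemma card_nforms_le: "card (nforms n) \<le> card (verts H) * card (D.walks n)"
proof -
  let ?P = "Vertex ` verts H :: ('v, 'e) gen set"
  have sub: "(\<lambda>w. (hd w, tl w)) ` nforms n \<subseteq> ?P \<times> D.walks n"
  proof (rule image_subsetI)
    fix w assume "w \<in> nforms n"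
    then show "(hd w, tl w) \<in> ?P \<times> D.walks n"
      by (cases w) (auto simp: nforms_def nform_def D.walks_def successively_Cons)
  qed
  have inj: "inj_on (\<lambda>w. (hd w, tl w)) (nforms n)"
    by (rule inj_onI) (auto simp: nforms_def nform_def intro: list.expand)
  have "finite (?P \<times> D.walks n)" using finite_verts D.finite_walks by simp
  then have "card (nforms n) \<le> card (?P \<times> D.walks n)" by (rule card_inj_on_le[OF inj sub])
  also have "\<dots> = card ?P * card (D.walks n)" by (rule card_cartesian_product)
  also have "\<dots> \<le> card (verts H) * card (D.walks n)" using finite_verts by (intro mult_le_mono1 card_image_le)
  finally show ?thesis .
qed

end

section \<open>Polynomial growth rates\<close>

lemma exp_not_le_power: "\<not> (\<forall>m\<ge>1. (2::real) ^ m \<le> C * real m ^ k)"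
proof
  assume bound: "\<forall>m\<ge>1. (2::real) ^ m \<le> C * real m ^ k"
  \<comment> \<open>Chosen so that \<open>D\<close> times the \<open>k\<close>-th power of
    \<open>real m * ln 2\<close> is the bound with \<open>\<bar>C\<bar>\<close>; then
    \<open>x ^ k / exp x\<close> tending to \<open>0\<close> applies with
    \<open>x = real m * ln 2\<close>.\<close>
  define D where "D = \<bar>C\<bar> / ln 2 ^ k"
  have "filterlim (\<lambda>m. real m * ln 2) at_top sequentially"
    by (rule filterlim_at_top_mult_tendsto_pos[OF tendsto_const _ filterlim_real_sequentially]) simp
  from filterlim_compose[OF tendsto_power_div_exp_0 this, of k]
  have "(\<lambda>m. D * ((real m * ln 2) ^ k / exp (real m * ln 2))) \<longlonglongrightarrow> D * 0"
    by (rule tendsto_mult[OF tendsto_const])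
  then have "eventually (\<lambda>m. D * ((real m * ln 2) ^ k / exp (real m * ln 2)) < 1) sequentially"
    by (rule order_tendstoD) simp
  then obtain N where N: "\<And>m. m \<ge> N \<Longrightarrow> D * ((real m * ln 2) ^ k / exp (real m * ln 2)) < 1"
    by (auto simp: eventually_sequentially)
  define m where "m = Suc N"
  have e: "exp (real m * ln 2) = 2 ^ m" by (simp add: exp_of_nat_mult)
  have "N \<le> m" by (simp add: m_def)
  note N[OF this, unfolded e]
  moreover have "D * (real m * ln 2) ^ k = \<bar>C\<bar> * real m ^ k" by (simp add: D_def power_mult_distrib)
  ultimately have "\<bar>C\<bar> * real m ^ k < 2 ^ m" by simp
  moreover have "C * real m ^ k \<le> \<bar>C\<bar> * real m ^ k" by (intro mult_right_mono) auto
  moreover have "1 \<le> m" by (simp add: m_def)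
  then have "2 ^ m \<le> C * real m ^ k" using bound by blast
  ultimately show False by linarith
qed

text \<open>Constant factors change the logarithm to base \<open>n\<close> only by a term of order
  \<open>1 / ln n\<close>, so the sequence even converges. Monotonicity carries the lower bound from
  multiples of \<open>D\<close> to all \<open>n\<close>.\<close>

lemma limsup_log_power_growth:
  fixes f :: "nat \<Rightarrow> nat"
  assumes mono: "\<And>m n. m \<le> n \<Longrightarrow> f m \<le> f n"
    and upper: "\<And>n. n \<ge> 1 \<Longrightarrow> f n \<le> K * n ^ d"
    and lower: "\<And>m. m \<ge> 1 \<Longrightarrow> m ^ d \<le> f (D * m)" and D: "D \<ge> 1"
  shows "limsup (\<lambda>n. ereal (log (real n) (real (f n)))) = ereal (real d)"
proof -
  have ln: "(\<lambda>n. c / ln (real n)) \<longlonglongrightarrow> 0" for c :: real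
    by (intro tendsto_divide_0[OF tendsto_const] filterlim_at_top_imp_at_infinity
        filterlim_compose[OF ln_at_top filterlim_real_sequentially])
  have "(\<lambda>n. log (real n) (real (f n))) \<longlonglongrightarrow> real d"
  proof (rule tendsto_sandwich)
    show "(\<lambda>n. real d - real d * ln (2 * real D) / ln (real n)) \<longlonglongrightarrow> real d"
      using tendsto_diff[OF tendsto_const ln, of "real d"] by simp
    show "(\<lambda>n. real d + ln (real (Suc K)) / ln (real n)) \<longlonglongrightarrow> real d"
      using tendsto_add[OF tendsto_const ln, of "real d"] by simp
    show "\<forall>\<^sub>F n in sequentially. real d - real d * ln (2 * real D) / ln (real n) \<le> log (real n) (real (f n))"
      using eventually_ge_at_top[of "max 2 D"]
    proof eventually_elim
      case (elim n)
      \<comment> \<open>The largest \<open>m\<close> for which \<open>D * m\<close> does not exceed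
        \<open>n\<close>. It is positive for \<open>n \<ge> D\<close>, and then
        \<open>n < D * Suc m \<le> 2 * D * m\<close>, which is the origin of the factor
        \<open>2 * D\<close>.\<close>
      define m where "m = n div D"
      have m: "m \<ge> 1" using elim D by (simp add: m_def Suc_le_eq div_greater_zero_iff)
      have "n < D * Suc m" using D unfolding m_def by (metis dividend_less_times_div Suc_le_eq One_nat_def mult_Suc_right add.commute)
      also have "\<dots> \<le> 2 * D * m" using m by (simp add: mult.commute)
      finally have nm: "real n \<le> 2 * real D * real m" by (metis less_imp_le of_nat_le_iff of_nat_mult of_nat_numeral)
      have "m ^ d \<le> f (D * m)" by (rule lower[OF m])
      also have "\<dots> \<le> f n" by (rule mono) (simp add: m_def)
      finally have "real m ^ d \<le> real (f n)" by (metis of_nat_le_iff of_nat_power)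
      moreover have "(real n / (2 * real D)) ^ d \<le> real m ^ d"
        using nm D by (intro power_mono) (auto simp: field_simps)
      ultimately have "(real n / (2 * real D)) ^ d \<le> real (f n)" by linarith
      then have "ln ((real n / (2 * real D)) ^ d) \<le> ln (real (f n))"
        using elim D by (intro ln_mono) auto
      then have "real d * (ln (real n) - ln (2 * real D)) \<le> ln (real (f n))"
        using elim D by (simp add: ln_realpow ln_div)
      then have "real d * (ln (real n) - ln (2 * real D)) / ln (real n) \<le> ln (real (f n)) / ln (real n)"
        using elim by (intro divide_right_mono) auto
      moreover have "real d * (ln (real n) - ln (2 * real D)) / ln (real n)
          = real d - real d * ln (2 * real D) / ln (real n)"
        using elim by (simp add: field_simps)
      ultimately show ?case by (simp add: log_def)
    qed
    show "\<forall>\<^sub>F n in sequentially. log (real n) (real (f n)) \<le> real d + ln (real (Suc K)) / ln (real n)"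
      using eventually_ge_at_top[of "max 2 D"]
    proof eventually_elim
      case (elim n)
      have "1 ^ d \<le> f (D * 1)" by (rule order_trans[OF _ lower]) auto
      also have "\<dots> \<le> f n" using elim by (intro mono) auto
      finally have pos: "0 < real (f n)" by simp
      \<comment> \<open>\<open>Suc K\<close> keeps the argument of the logarithm positive if
        \<open>K = 0\<close>.\<close>
      have "f n \<le> Suc K * n ^ d" using upper[of n] elim by simp
      then have "real (f n) \<le> real (Suc K) * real n ^ d"
        by (metis of_nat_le_iff of_nat_mult of_nat_power)
      then have "ln (real (f n)) \<le> ln (real (Suc K) * real n ^ d)" using pos by (intro ln_mono) auto
      also have "\<dots> = ln (real (Suc K)) + real d * ln (real n)"
        using elim by (subst ln_mult) (auto simp: ln_realpow)
      finally have "ln (real (f n)) / ln (real n) \<le> (ln (real (Suc K)) + real d * ln (real n)) / ln (real n)"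
        using elim by (intro divide_right_mono) auto
      also have "\<dots> = real d + ln (real (Suc K)) / ln (real n)" using elim by (simp add: field_simps)
      finally show ?case by (simp add: log_def)
    qed
  qed
  then show ?thesis by (intro lim_imp_Limsup) auto
qed
section \<open>Growth of Leavitt path algebras\<close>

context leavitt_data
begin

text \<open>Polynomial growth supplies some generating subspace, so the exponential lower bound is
  transferred to whichever \<open>V\<close> that is.\<close>

lemma selfconnected_not_polynomial:
  assumes p: "D.qcycle p" "D.detour p p"
  shows "\<not> polynomial_growth (lpa :: ('k::field, _) module)"
proof
  assume "polynomial_growth (lpa :: ('k, _) module)"
  then obtain V k c where V: "generating_subspace (lpa :: ('k, _) module) V"
    and "c \<ge> 1 \<and> (\<forall>n\<ge>1. real (growth lpa V n) \<le> real c * real (c * n) ^ k)"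
    unfolding polynomial_growth_def growth_le_def by blast
  then have c: "\<And>n. n \<ge> 1 \<Longrightarrow> real (growth lpa V n) \<le> real c * real (c * n) ^ k" by blast
  obtain L where L: "L \<ge> 1" "\<And>m. 2 ^ m \<le> card (D.walks (L * m))" using D.walks_exponential[OF p] by blast
  obtain b where b: "b \<ge> 1" "\<And>n. card (nforms n) \<le> growth lpa V (b * Suc n)" using growth_lower[OF V] by blast
  have "(2::real) ^ m \<le> (real c * real (c * b * Suc L) ^ k) * real m ^ k" if m: "m \<ge> 1" for m
  proof -
    have "2 ^ m \<le> growth lpa V (b * Suc (L * m))"
      using L(2)[of m] card_walks_le[of "L * m"] b(2)[of "L * m"] by linarith
    \<comment> \<open>For \<open>m \<ge> 1\<close> the additive one is absorbed, so that the
      argument becomes a multiple of \<open>m\<close>.\<close>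
    also have "\<dots> \<le> growth lpa V (b * (Suc L * m))"
      using m by (intro growth_mono[OF V] mult_le_mono2) simp
    finally have "2 ^ m \<le> growth lpa V (b * (Suc L * m))" .
    then have "(2::real) ^ m \<le> real (growth lpa V (b * (Suc L * m)))"
      by (metis of_nat_le_iff of_nat_numeral of_nat_power)
    also have "\<dots> \<le> real c * real (c * (b * (Suc L * m))) ^ k"
    proof (rule c)
      have "b * (Suc L * m) > 0" using b(1) m by simp
      then show "1 \<le> b * (Suc L * m)" by (simp only: Suc_le_eq One_nat_def)
    qed
    also have "c * (b * (Suc L * m)) = (c * b * Suc L) * m" by (simp only: mult.assoc)
    finally show ?thesis by (simp only: of_nat_mult power_mult_distrib mult.assoc)
  qed
  then show False using exp_not_le_power by blast
qed

lemma growth_polynomial_upper: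
  assumes nsc: "\<And>p. D.qcycle p \<Longrightarrow> \<not> D.detour p p" and V: "generating_subspace (lpa :: ('k::field, _) module) V"
  shows "\<exists>K. \<forall>n\<ge>1. growth lpa V n \<le> K * n ^ max_chain_length H \<sigma> \<rho>"
proof -
  let ?d = "max_chain_length H \<sigma> \<rho>"
  obtain C where C: "\<And>n. card (D.walks n) \<le> C * Suc n ^ ?d"
    using D.walks_upper_bound[OF nsc max_chain_length(2)] by blast
  obtain b where b: "\<And>n. growth lpa V n \<le> card (nforms (b * n))" using growth_upper[OF V] by blast
  have "growth lpa V n \<le> (card (verts H) * C * Suc b ^ ?d) * n ^ ?d" if n: "n \<ge> 1" for n
  proof -
    have "growth lpa V n \<le> card (verts H) * card (D.walks (b * n))"
      by (rule order_trans[OF b card_nforms_le])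
    also have "\<dots> \<le> card (verts H) * (C * Suc (b * n) ^ ?d)" by (rule mult_le_mono2[OF C])
    also have "\<dots> \<le> card (verts H) * (C * (Suc b * n) ^ ?d)"
      using n by (intro mult_le_mono2 power_mono) auto
    also have "\<dots> = (card (verts H) * C * Suc b ^ ?d) * n ^ ?d"
      by (simp only: power_mult_distrib mult.assoc)
    finally show ?thesis .
  qed
  then show ?thesis by blast
qed

lemma growth_polynomial_lower:
  assumes nsc: "\<And>p. D.qcycle p \<Longrightarrow> \<not> D.detour p p" and V: "generating_subspace (lpa :: ('k::field, _) module) V"
  shows "\<exists>b\<ge>1. \<forall>m\<ge>1. m ^ max_chain_length H \<sigma> \<rho> \<le> growth lpa V (b * m)"
proof -
  obtain ps where ps: "D.chain ps" "length ps = max_chain_length H \<sigma> \<rho>" using max_chain_length(1) by blast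
  obtain K where K: "K \<ge> 1" "\<And>m. m \<ge> 1 \<Longrightarrow> m ^ length ps \<le> card (D.walks (K * m))"
    using D.walks_lower_bound[OF nsc ps(1)] by blast
  obtain b where b: "b \<ge> 1" "\<And>n. card (nforms n) \<le> growth lpa V (b * Suc n)" using growth_lower[OF V] by blast
  have "m ^ length ps \<le> growth lpa V ((b * Suc K) * m)" if m: "m \<ge> 1" for m
  proof -
    have "m ^ length ps \<le> growth lpa V (b * Suc (K * m))"
      using K(2)[OF m] card_walks_le[of "K * m"] b(2)[of "K * m"] by linarith
    also have "\<dots> \<le> growth lpa V (b * (Suc K * m))"
      using m by (intro growth_mono[OF V] mult_le_mono2) simp
    finally show ?thesis by (simp only: mult.assoc)
  qed
  moreover have "b * Suc K \<ge> 1" using b(1) by simp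
  ultimately show ?thesis unfolding ps(2) by blast
qed

lemma generating_subspace_lpa: "\<exists>V. generating_subspace (lpa :: ('k::field, _) module) V"
  using leavitt_path_algebra_generating_subspace[OF finite_hypergraph_axioms listings]
  unfolding leavitt_path_algebra_def .

lemma polynomial_growth_iff:
  "polynomial_growth (lpa :: ('k::field, _) module) \<longleftrightarrow> \<not> (\<exists>p. D.qcycle p \<and> D.detour p p)"
proof
  assume "polynomial_growth (lpa :: ('k, _) module)"
  then show "\<not> (\<exists>p. D.qcycle p \<and> D.detour p p)" using selfconnected_not_polynomial by blast
next
  assume nsc: "\<not> (\<exists>p. D.qcycle p \<and> D.detour p p)"
  let ?d = "max_chain_length H \<sigma> \<rho>"
  obtain V where V: "generating_subspace (lpa :: ('k, _) module) V" using generating_subspace_lpa by blast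
  obtain K where K: "\<And>n. n \<ge> 1 \<Longrightarrow> growth lpa V n \<le> K * n ^ ?d"
    using growth_polynomial_upper[OF _ V] nsc by blast
  have "real (growth lpa V n) \<le> real (Suc K) * real (Suc K * n) ^ ?d" if n: "n \<ge> 1" for n
  proof -
    \<comment> \<open>\<open>growth_le\<close> uses a single positive constant both as a factor and
      inside the argument.\<close>
    have "K * n ^ ?d \<le> Suc K * (Suc K * n) ^ ?d" by (intro mult_le_mono power_mono) auto
    with K[OF n] have "growth lpa V n \<le> Suc K * (Suc K * n) ^ ?d" by linarith
    then show ?thesis by (metis of_nat_le_iff of_nat_mult of_nat_power)
  qed
  then have "(\<lambda>n. real (growth lpa V n)) \<preceq>\<^sub>g (\<lambda>n. real n ^ ?d)"
    unfolding growth_le_def by (intro exI[of _ "Suc K"]) simp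
  then show "polynomial_growth (lpa :: ('k, _) module)" unfolding polynomial_growth_def using V by blast
qed

lemma GKdim_lpa:
  assumes nsc: "\<And>p. D.qcycle p \<Longrightarrow> \<not> D.detour p p"
  shows "GKdim (lpa :: ('k::field, _) module) = ereal (real (max_chain_length H \<sigma> \<rho>))"
proof -
  \<comment> \<open>Existence makes the chosen space a generating subspace; the bounds hold for each
    such space, so the choice does not affect the value.\<close>
  define V where "V = (SOME V. generating_subspace (lpa :: ('k, _) module) V)"
  have V: "generating_subspace lpa V" unfolding V_def by (rule someI_ex[OF generating_subspace_lpa])
  obtain K where K: "\<And>n. n \<ge> 1 \<Longrightarrow> growth lpa V n \<le> K * n ^ max_chain_length H \<sigma> \<rho>"
    using growth_polynomial_upper[OF nsc V] by blast
  obtain b where b: "b \<ge> 1" "\<And>m. m \<ge> 1 \<Longrightarrow> m ^ max_chain_length H \<sigma> \<rho> \<le> growth lpa V (b * m)"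
    using growth_polynomial_lower[OF nsc V] by blast
  show ?thesis
    unfolding GKdim_def Let_def V_def[symmetric]
    by (rule limsup_log_power_growth[OF growth_mono[OF V] K b(2) b(1)])
qed

end

theorem theorem28:
  fixes H :: "('v, 'e) hypergraph"
    and \<sigma> \<rho> :: "'e \<Rightarrow> 'v list"
  assumes "finite_hypergraph H"
    and "listings H \<sigma> \<rho>"
  shows "(polynomial_growth (leavitt_path_algebra TYPE('k::field) H \<sigma> \<rho>) \<longleftrightarrow>
             \<not> (\<exists>p. quasi_cycle H \<sigma> \<rho> p \<and> selfconnected H \<sigma> \<rho> p))
       \<and> (polynomial_growth (leavitt_path_algebra TYPE('k) H \<sigma> \<rho>) \<longrightarrow>
             GKdim (leavitt_path_algebra TYPE('k) H \<sigma> \<rho>)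
               = ereal (real (max_chain_length H \<sigma> \<rho>)))"
proof -
  interpret L: leavitt_data H \<sigma> \<rho>
    using assms by (intro leavitt_data.intro leavitt_data_axioms.intro)
  show ?thesis
    unfolding leavitt_path_algebra_def L.selfconnected_iff L.polynomial_growth_iff
    using L.GKdim_lpa by blast
qed

end
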